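(* Let $\hbar>0$ and $n\ge1$. Let $\mathcal{A}_{\mathrm{Wick}}$ be the polynomial algebra $\mathbb{C}[z,\bar z]$ on $\mathbb{C}^n$ with the Wick star product $\star_{\mathrm{Wick}}$, endowed with the locally convex topology of the seminorms $\|\cdot\|_{m,\ell,(I,J)}$ built from the basis $\mathsf{e}_{I,J}$, $I,J\in\mathbb{N}_0^n$ (all of which are finite on polynomials). The completion $\widehat{\mathcal{A}}_{\mathrm{Wick}}$ is a strongly nuclear Fréchet algebra with absolute Schauder basis given by the Taylor monomials $\{\mathsf{e}_{I,J}\}_{I,J\in\mathbb{N}_0^n}$, and it consists of the real-analytic functions $a=\sum_{I,J}a_{I,J}\mathsf{e}_{I,J}$ with Taylor coefficients $a_{I,J}$ having sub-factorial growth with respect to $|I|+|J|$. The underlying Fréchet space is isomorphic to a Köthe space of sub-factorial growth.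
   Context: Multiindex notation is standard. The Wick star product of polynomials $f,g$ in $z^1,\dots,z^n,\bar z^1,\dots,\bar z^n$ is $$f\star_{\mathrm{Wick}}g=\sum_{N\in\mathbb{N}_0^n}\frac{(2\hbar)^{|N|}}{N!}\frac{\partial^{|N|}f}{\partial z^N}\frac{\partial^{|N|}g}{\partial\bar z^N},$$ and the basis used is $\mathsf{e}_{I,J}=\dfrac{z^I\bar z^J}{I!\,J!\,(2\hbar)^{|I|+|J|}}$. General construction of the topology: for an algebra with product $\star$, countable basis $(\mathsf{e}_\alpha)_{\alpha\in X}$ and structure constants $\mathsf{e}_\alpha\star\mathsf{e}_\beta=\sum_\gamma C^\gamma_{\alpha\beta}\mathsf{e}_\gamma$, define for formal series $a=\sum_\alpha a_\alpha\mathsf{e}_\alpha$, in $[0,\infty]$: $h_{0,0,\gamma}(a)=|a_\gamma|$, $h_{m+1,2\ell,\gamma}(a)=\sum_\alpha h_{m,\ell,\alpha}(a)^2\sum_\beta|C^\gamma_{\alpha\beta}|$, $h_{m+1,2\ell+1,\gamma}(a)=\sum_\beta h_{m,\ell,\beta}(a)^2\sum_\alpha|C^\gamma_{\alpha\beta}|$ ($0\le\ell\le2^m-1$), and $\|a\|_{m,\ell,\gamma}=h_{m,\ell,\gamma}(a)^{1/2^m}$. If these are finite on the algebra, they make the product continuous, and the completion is the Fréchet algebra of all formal series $a$ with all $\|a\|_{m,\ell,\gamma}<\infty$. Sub-factorial growth of $(a_{I,J})$ with respect to $|I|+|J|$: for every $\epsilon>0$ there is $c>0$ with $|a_{I,J}|\le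 c\,((|I|+|J|)!)^\epsilon$ for all $I,J$. The corresponding Köthe space of sub-factorial growth is the space of all such families with seminorms $\sup_{I,J}|a_{I,J}|/((|I|+|J|)!)^\epsilon$, $0<\epsilon<1$. A Fréchet algebra is a Fréchet space with continuous product. A Schauder basis is absolute if for each continuous seminorm $p$ there is a continuous seminorm $q$ with $\sum_\alpha|a_\alpha|p(\mathsf{e}_\alpha)\le q(a)$ for all $a$. Strongly nuclear: for every continuous seminorm $p$ there is a continuous seminorm $q\ge p$ such that the canonical map between the associated Banach spaces (for $q$ to that for $p$) has the form $x\mapsto\sum_k\lambda_k\varphi_k(x)y_k$ with $(\lambda_k)$ rapidly decreasing and $(\varphi_k)$, $(y_k)$ bounded. *)

theory Defs
  imports "HOL-Analysis.Analysis" "HOL-Library.Poly_Mapping" "HOL-Library.Function_Algebras"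
begin

section \<open>Locally convex spaces\<close>

text \<open>
  Complex vector spaces are given by an additive group \<open>'v\<close>, a scalar multiplication \<open>s\<close>, and a
  carrier \<open>V\<close> that is a subspace for \<open>s\<close>. Families of scalars carry the pointwise operations.
\<close>

definition lin_on :: "(complex \<Rightarrow> 'v::ab_group_add \<Rightarrow> 'v) \<Rightarrow> 'v set \<Rightarrow>
    (complex \<Rightarrow> 'w::ab_group_add \<Rightarrow> 'w) \<Rightarrow> ('v \<Rightarrow> 'w) \<Rightarrow> bool" where
  "lin_on s V s' f \<longleftrightarrow>
     (\<forall>x\<in>V. \<forall>y\<in>V. f (x + y) = f x + f y) \<and> (\<forall>c. \<forall>x\<in>V. f (s c x) = s' c (f x))"

definition seminorm_on :: "(complex \<Rightarrow> 'v::ab_group_add \<Rightarrow> 'v) \<Rightarrow> 'v set \<Rightarrow> ('v \<Rightarrow> real) \<Rightarrow> bool" where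
  "seminorm_on s V p \<longleftrightarrow>
     (\<forall>x\<in>V. 0 \<le> p x) \<and> (\<forall>x\<in>V. \<forall>y\<in>V. p (x + y) \<le> p x + p y) \<and>
     (\<forall>c. \<forall>x\<in>V. p (s c x) = norm c * p x)"

text \<open>The locally convex topology on \<open>V\<close> defined by a set \<open>P\<close> of seminorms: the open balls of
  the single seminorms form a subbasis.\<close>

definition lc_topology :: "'v::ab_group_add set \<Rightarrow> ('v \<Rightarrow> real) set \<Rightarrow> 'v topology" where
  "lc_topology V P =
     topology_generated_by (insert V {{y\<in>V. p (y - x) < r} | p x r. p \<in> P \<and> x \<in> V \<and> r > 0})"

definition continuous_seminorm ::
    "(complex \<Rightarrow> 'v::ab_group_add \<Rightarrow> 'v) \<Rightarrow> 'v set \<Rightarrow> 'v topology \<Rightarrow> ('v \<Rightarrow> real) \<Rightarrow> bool" where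
  "continuous_seminorm s V T p \<longleftrightarrow> seminorm_on s V p \<and> continuous_map T euclideanreal p"

definition seminorm_Cauchy :: "('v::ab_group_add \<Rightarrow> real) \<Rightarrow> (nat \<Rightarrow> 'v) \<Rightarrow> bool" where
  "seminorm_Cauchy p x \<longleftrightarrow> (\<forall>\<epsilon>>0. \<exists>N. \<forall>m\<ge>N. \<forall>n\<ge>N. p (x m - x n) < \<epsilon>)"

definition frechet_space ::
    "(complex \<Rightarrow> 'v::ab_group_add \<Rightarrow> 'v) \<Rightarrow> 'v set \<Rightarrow> 'v topology \<Rightarrow> bool" where
  "frechet_space s V T \<longleftrightarrow>
     vector_space s \<and> module.subspace s V \<and>
     (\<exists>P. countable P \<and> (\<forall>p\<in>P. seminorm_on s V p) \<and> T = lc_topology V P \<and>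
        (\<forall>x\<in>V. (\<forall>p\<in>P. p x = 0) \<longrightarrow> x = 0) \<and>
        (\<forall>X. range X \<subseteq> V \<and> (\<forall>p\<in>P. seminorm_Cauchy p X) \<longrightarrow> (\<exists>x\<in>V. limitin T X x sequentially)))"

definition frechet_algebra :: "(complex \<Rightarrow> 'v::ab_group_add \<Rightarrow> 'v) \<Rightarrow> 'v set \<Rightarrow> 'v topology \<Rightarrow>
    ('v \<Rightarrow> 'v \<Rightarrow> 'v) \<Rightarrow> bool" where
  "frechet_algebra s V T mul \<longleftrightarrow>
     frechet_space s V T \<and>
     (\<forall>x\<in>V. \<forall>y\<in>V. mul x y \<in> V) \<and>
     (\<forall>x\<in>V. lin_on s V s (mul x)) \<and> (\<forall>y\<in>V. lin_on s V s (\<lambda>x. mul x y)) \<and>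
     (\<forall>x\<in>V. \<forall>y\<in>V. \<forall>z\<in>V. mul (mul x y) z = mul x (mul y z)) \<and>
     continuous_map (prod_topology T T) T (\<lambda>(x, y). mul x y)"

text \<open>\<open>\<iota>\<close> exhibits the Frechet algebra \<open>V\<close> as a completion of the topological algebra \<open>W\<close>: a linear
  multiplicative homeomorphism onto a dense subspace. (A linear topological embedding is an
  embedding of uniform spaces, so no separate uniformity condition is needed.)\<close>

definition frechet_algebra_completion ::
    "(complex \<Rightarrow> 'w::ab_group_add \<Rightarrow> 'w) \<Rightarrow> 'w set \<Rightarrow> 'w topology \<Rightarrow> ('w \<Rightarrow> 'w \<Rightarrow> 'w) \<Rightarrow>
     (complex \<Rightarrow> 'v::ab_group_add \<Rightarrow> 'v) \<Rightarrow> 'v set \<Rightarrow> 'v topology \<Rightarrow> ('v \<Rightarrow> 'v \<Rightarrow> 'v) \<Rightarrow>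
     ('w \<Rightarrow> 'v) \<Rightarrow> bool" where
  "frechet_algebra_completion sW W TW mulW s V T mul \<iota> \<longleftrightarrow>
     frechet_algebra s V T mul \<and>
     \<iota> ` W \<subseteq> V \<and> lin_on sW W s \<iota> \<and> (\<forall>x\<in>W. \<forall>y\<in>W. \<iota> (mulW x y) = mul (\<iota> x) (\<iota> y)) \<and>
     embedding_map TW T \<iota> \<and> T closure_of (\<iota> ` W) = V"

text \<open>Expansions are unordered: \<open>a\<close> is the limit of the net of finite partial sums.\<close>

definition basis_expansion :: "(complex \<Rightarrow> 'v::ab_group_add \<Rightarrow> 'v) \<Rightarrow> 'v topology \<Rightarrow> ('i \<Rightarrow> 'v) \<Rightarrow>
    ('i \<Rightarrow> complex) \<Rightarrow> 'v \<Rightarrow> bool" where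
  "basis_expansion s T e c a \<longleftrightarrow>
     limitin T (\<lambda>F. \<Sum>\<alpha>\<in>F. s (c \<alpha>) (e \<alpha>)) a (finite_subsets_at_top UNIV)"

definition basis_coeff :: "(complex \<Rightarrow> 'v::ab_group_add \<Rightarrow> 'v) \<Rightarrow> 'v topology \<Rightarrow> ('i \<Rightarrow> 'v) \<Rightarrow>
    'v \<Rightarrow> 'i \<Rightarrow> complex" where
  "basis_coeff s T e a = (THE c. basis_expansion s T e c a)"

definition schauder_basis :: "(complex \<Rightarrow> 'v::ab_group_add \<Rightarrow> 'v) \<Rightarrow> 'v set \<Rightarrow> 'v topology \<Rightarrow>
    ('i \<Rightarrow> 'v) \<Rightarrow> bool" where
  "schauder_basis s V T e \<longleftrightarrow>
     range e \<subseteq> V \<and> (\<forall>a\<in>V. \<exists>!c. basis_expansion s T e c a) \<and>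
     (\<forall>\<alpha>. continuous_map T euclidean (\<lambda>a. basis_coeff s T e a \<alpha>))"

definition absolute_schauder_basis :: "(complex \<Rightarrow> 'v::ab_group_add \<Rightarrow> 'v) \<Rightarrow> 'v set \<Rightarrow> 'v topology \<Rightarrow>
    ('i \<Rightarrow> 'v) \<Rightarrow> bool" where
  "absolute_schauder_basis s V T e \<longleftrightarrow>
     schauder_basis s V T e \<and>
     (\<forall>p. continuous_seminorm s V T p \<longrightarrow>
        (\<exists>q. continuous_seminorm s V T q \<and>
           (\<forall>a\<in>V. (\<Sum>\<^sub>\<infinity>\<alpha>\<in>UNIV. ennreal (norm (basis_coeff s T e a \<alpha>) * p (e \<alpha>))) \<le> ennreal (q a))))"

text \<open>
  The Banach space associated with a seminorm \<open>p\<close> is the completion of \<open>V / ker p\<close>. Its elements are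
  represented by \<open>p\<close>-Cauchy sequences in \<open>V\<close>, and two of them represent the same element iff
  their difference has \<open>assoc_norm\<close> zero. For \<open>p \<le> q\<close> the canonical map between the Banach spaces
  for \<open>q\<close> and \<open>p\<close> sends the class of a \<open>q\<close>-Cauchy sequence to the class of the same sequence.
\<close>

definition assoc_banach :: "'v::ab_group_add set \<Rightarrow> ('v \<Rightarrow> real) \<Rightarrow> (nat \<Rightarrow> 'v) set" where
  "assoc_banach V p = {x. range x \<subseteq> V \<and> seminorm_Cauchy p x}"

definition assoc_norm :: "('v \<Rightarrow> real) \<Rightarrow> (nat \<Rightarrow> 'v) \<Rightarrow> real" where
  "assoc_norm p x = lim (\<lambda>n. p (x n))"

definition seq_scale :: "(complex \<Rightarrow> 'v \<Rightarrow> 'v) \<Rightarrow> complex \<Rightarrow> (nat \<Rightarrow> 'v) \<Rightarrow> (nat \<Rightarrow> 'v)" where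
  "seq_scale s c x = (\<lambda>n. s c (x n))"

definition rapidly_decreasing :: "(nat \<Rightarrow> complex) \<Rightarrow> bool" where
  "rapidly_decreasing lam \<longleftrightarrow> (\<forall>r::nat. Bseq (\<lambda>k. of_nat (k + 1) ^ r * lam k))"

definition strongly_nuclear ::
    "(complex \<Rightarrow> 'v::ab_group_add \<Rightarrow> 'v) \<Rightarrow> 'v set \<Rightarrow> 'v topology \<Rightarrow> bool" where
  "strongly_nuclear s V T \<longleftrightarrow>
     (\<forall>p. continuous_seminorm s V T p \<longrightarrow>
       (\<exists>q. continuous_seminorm s V T q \<and> (\<forall>x\<in>V. p x \<le> q x) \<and>
         (\<exists>lam \<phi> y. rapidly_decreasing lam \<and>
            (\<forall>k. lin_on (seq_scale s) (assoc_banach V q) (*) (\<phi> k)) \<and>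
            (\<exists>C. \<forall>k. \<forall>x\<in>assoc_banach V q. norm (\<phi> k x) \<le> C * assoc_norm q x) \<and>
            (\<forall>k. y k \<in> assoc_banach V p) \<and> (\<exists>C. \<forall>k. assoc_norm p (y k) \<le> C) \<and>
            (\<forall>x\<in>assoc_banach V q.
               (\<lambda>K. assoc_norm p (x - (\<Sum>k<K. seq_scale s (lam k * \<phi> k x) (y k))))
                 \<longlonglongrightarrow> 0))))"

definition lcs_isomorphic ::
    "(complex \<Rightarrow> 'v::ab_group_add \<Rightarrow> 'v) \<Rightarrow> 'v set \<Rightarrow> 'v topology \<Rightarrow>
     (complex \<Rightarrow> 'w::ab_group_add \<Rightarrow> 'w) \<Rightarrow> 'w set \<Rightarrow> 'w topology \<Rightarrow> bool" where
  "lcs_isomorphic s V T s' V' T' \<longleftrightarrow>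
     (\<exists>\<Phi>. lin_on s V s' \<Phi> \<and> bij_betw \<Phi> V V' \<and> homeomorphic_map T T' \<Phi>)"


section \<open>Seminorms from structure constants\<close>

text \<open>Formal series are families of coefficients \<open>a :: 'i \<Rightarrow> complex\<close>; \<open>C \<alpha> \<beta> \<gamma>\<close> is the
  coefficient of the basis vector \<open>\<gamma>\<close> in the product of the basis vectors \<open>\<alpha>\<close> and \<open>\<beta>\<close>.\<close>

definition fam_scale :: "complex \<Rightarrow> ('i \<Rightarrow> complex) \<Rightarrow> ('i \<Rightarrow> complex)" where
  "fam_scale c a = (\<lambda>\<alpha>. c * a \<alpha>)"

primrec hnorm :: "('i \<Rightarrow> 'i \<Rightarrow> 'i \<Rightarrow> complex) \<Rightarrow> nat \<Rightarrow> nat \<Rightarrow> 'i \<Rightarrow> ('i \<Rightarrow> complex) \<Rightarrow> ennreal" where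
  "hnorm C 0 l \<gamma> a = ennreal (norm (a \<gamma>))"
| "hnorm C (Suc m) l \<gamma> a =
     (if even l
      then \<Sum>\<^sub>\<infinity>\<alpha>\<in>UNIV. (hnorm C m (l div 2) \<alpha> a)\<^sup>2 * (\<Sum>\<^sub>\<infinity>\<beta>\<in>UNIV. ennreal (norm (C \<alpha> \<beta> \<gamma>)))
      else \<Sum>\<^sub>\<infinity>\<beta>\<in>UNIV. (hnorm C m (l div 2) \<beta> a)\<^sup>2 * (\<Sum>\<^sub>\<infinity>\<alpha>\<in>UNIV. ennreal (norm (C \<alpha> \<beta> \<gamma>))))"

definition snorm :: "('i \<Rightarrow> 'i \<Rightarrow> 'i \<Rightarrow> complex) \<Rightarrow> nat \<Rightarrow> nat \<Rightarrow> 'i \<Rightarrow> ('i \<Rightarrow> complex) \<Rightarrow> real" where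
  "snorm C m l \<gamma> a = root (2 ^ m) (enn2real (hnorm C m l \<gamma> a))"

definition snorms :: "('i \<Rightarrow> 'i \<Rightarrow> 'i \<Rightarrow> complex) \<Rightarrow> (('i \<Rightarrow> complex) \<Rightarrow> real) set" where
  "snorms C = {snorm C m l \<gamma> | m l \<gamma>. l < 2 ^ m}"

definition hat_space :: "('i \<Rightarrow> 'i \<Rightarrow> 'i \<Rightarrow> complex) \<Rightarrow> ('i \<Rightarrow> complex) set" where
  "hat_space C = {a. \<forall>m l \<gamma>. l < 2 ^ m \<longrightarrow> hnorm C m l \<gamma> a < \<infinity>}"

definition hat_topology :: "('i \<Rightarrow> 'i \<Rightarrow> 'i \<Rightarrow> complex) \<Rightarrow> ('i \<Rightarrow> complex) topology" where
  "hat_topology C = lc_topology (hat_space C) (snorms C)"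

definition hat_mult :: "('i \<Rightarrow> 'i \<Rightarrow> 'i \<Rightarrow> complex) \<Rightarrow> ('i \<Rightarrow> complex) \<Rightarrow> ('i \<Rightarrow> complex) \<Rightarrow>
    ('i \<Rightarrow> complex)" where
  "hat_mult C a b = (\<lambda>\<gamma>. \<Sum>\<^sub>\<infinity>(\<alpha>, \<beta>)\<in>UNIV. C \<alpha> \<beta> \<gamma> * a \<alpha> * b \<beta>)"


section \<open>Sub-factorial growth\<close>

definition subfactorial :: "('i \<Rightarrow> nat) \<Rightarrow> ('i \<Rightarrow> complex) \<Rightarrow> bool" where
  "subfactorial sz a \<longleftrightarrow> (\<forall>\<epsilon>>0. \<exists>c>0. \<forall>\<alpha>. norm (a \<alpha>) \<le> c * fact (sz \<alpha>) powr \<epsilon>)"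

definition kothe_norm :: "('i \<Rightarrow> nat) \<Rightarrow> real \<Rightarrow> ('i \<Rightarrow> complex) \<Rightarrow> real" where
  "kothe_norm sz \<epsilon> a = (SUP \<alpha>. norm (a \<alpha>) / fact (sz \<alpha>) powr \<epsilon>)"

definition kothe_topology :: "('i \<Rightarrow> nat) \<Rightarrow> ('i \<Rightarrow> complex) topology" where
  "kothe_topology sz =
     lc_topology {a. subfactorial sz a} {kothe_norm sz \<epsilon> | \<epsilon>. 0 < \<epsilon> \<and> \<epsilon> < 1}"


section \<open>Polynomials in z and its conjugate\<close>

text \<open>Multiindices are vectors \<open>nat ^ 'n\<close>. A polynomial maps the exponents \<open>(I, J)\<close> to the
  coefficient of \<open>z\<^sup>I (cnj z)\<^sup>J\<close>; the product \<open>(*)\<close> on this type is the ordinary commutative one.\<close>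

type_synonym 'n bidx = "(nat ^ 'n) \<times> (nat ^ 'n)"
type_synonym 'n zpoly = "'n bidx \<Rightarrow>\<^sub>0 complex"

definition mdeg :: "nat ^ 'n::finite \<Rightarrow> nat" where
  "mdeg I = (\<Sum>k\<in>UNIV. I $ k)"

definition mfact :: "nat ^ 'n::finite \<Rightarrow> nat" where
  "mfact I = (\<Prod>k\<in>UNIV. fact (I $ k))"

definition bideg :: "'n::finite bidx \<Rightarrow> nat" where
  "bideg \<alpha> = mdeg (fst \<alpha>) + mdeg (snd \<alpha>)"

definition poly_scale :: "complex \<Rightarrow> 'n::finite zpoly \<Rightarrow> 'n zpoly" where
  "poly_scale c f = Poly_Mapping.map ((*) c) f"

lemma lookup_poly_scale: "Poly_Mapping.lookup (poly_scale c f) \<alpha> = c * Poly_Mapping.lookup f \<alpha>"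
  unfolding poly_scale_def by (cases "Poly_Mapping.lookup f \<alpha> = 0") (simp_all add: map.rep_eq when_def)

lemma vector_space_poly_scale: "vector_space (poly_scale :: complex \<Rightarrow> 'n::finite zpoly \<Rightarrow> 'n zpoly)"
  by unfold_locales
    (simp_all add: poly_mapping_eq_iff fun_eq_iff lookup_poly_scale lookup_add algebra_simps)

lemma vector_space_fam_scale: "vector_space (fam_scale :: complex \<Rightarrow> ('i \<Rightarrow> complex) \<Rightarrow> _)"
  by unfold_locales (auto simp: fam_scale_def fun_eq_iff algebra_simps)

text \<open>\<open>\<partial>\<^sup>N z\<^sup>I = I! / (I - N)! z\<^sup>I\<^sup>-\<^sup>N\<close> if \<open>N \<le> I\<close> componentwise, and \<open>0\<close> otherwise.\<close>

definition pd_z :: "nat ^ 'n::finite \<Rightarrow> 'n zpoly \<Rightarrow> 'n zpoly" where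
  "pd_z N f = (\<Sum>(I, J)\<in>Poly_Mapping.keys f.
     if N \<le> I
     then Poly_Mapping.single (I - N, J)
            (of_nat (mfact I) / of_nat (mfact (I - N)) * Poly_Mapping.lookup f (I, J))
     else 0)"

definition pd_zbar :: "nat ^ 'n::finite \<Rightarrow> 'n zpoly \<Rightarrow> 'n zpoly" where
  "pd_zbar N f = (\<Sum>(I, J)\<in>Poly_Mapping.keys f.
     if N \<le> J
     then Poly_Mapping.single (I, J - N)
            (of_nat (mfact J) / of_nat (mfact (J - N)) * Poly_Mapping.lookup f (I, J))
     else 0)"

text \<open>For polynomials only finitely many summands are nonzero, so \<^const>\<open>Sum_any\<close> is the sum over
  all multiindices.\<close>

definition wick_mult :: "real \<Rightarrow> 'n::finite zpoly \<Rightarrow> 'n zpoly \<Rightarrow> 'n zpoly" where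
  "wick_mult hbar f g = Sum_any (\<lambda>N. poly_scale
     (of_real ((2 * hbar) ^ mdeg N / of_nat (mfact N))) (pd_z N f * pd_zbar N g))"

definition wick_basis :: "real \<Rightarrow> 'n::finite bidx \<Rightarrow> 'n zpoly" where
  "wick_basis hbar = (\<lambda>(I, J). Poly_Mapping.single (I, J)
     (of_real (1 / (of_nat (mfact I) * of_nat (mfact J) * (2 * hbar) ^ (mdeg I + mdeg J)))))"

definition wick_coords :: "real \<Rightarrow> 'n::finite zpoly \<Rightarrow> 'n bidx \<Rightarrow> complex" where
  "wick_coords hbar f =
     (\<lambda>\<gamma>. module.representation poly_scale (range (wick_basis hbar)) f (wick_basis hbar \<gamma>))"

lemma mfact_pos: "mfact I > 0"
  unfolding mfact_def by (simp add: prod_pos)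

lemma mfact_nonzero [simp]: "mfact I \<noteq> 0"
  using mfact_pos[of I] by simp

lemma lookup_wick_basis_sum:
  fixes hbar :: real
  assumes "hbar \<noteq> 0" "finite F"
  shows "Poly_Mapping.lookup (\<Sum>\<alpha>\<in>F. poly_scale (u \<alpha>) (wick_basis hbar \<alpha>)) \<beta> =
    (if \<beta> \<in> F then u \<beta> * of_real (1 / (of_nat (mfact (fst \<beta>)) * of_nat (mfact (snd \<beta>)) *
       (2 * hbar) ^ bideg \<beta>)) else 0)"
proof -
  have "Poly_Mapping.lookup (\<Sum>\<alpha>\<in>F. poly_scale (u \<alpha>) (wick_basis hbar \<alpha>)) \<beta> =
    (\<Sum>\<alpha>\<in>F. if \<beta> = \<alpha> then u \<beta> * of_real (1 / (of_nat (mfact (fst \<beta>)) * of_nat (mfact (snd \<beta>)) *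
       (2 * hbar) ^ bideg \<beta>)) else 0)"
    unfolding lookup_sum
    by (intro sum.cong refl)
      (auto simp: lookup_poly_scale wick_basis_def bideg_def lookup_single when_def split: prod.splits)
  then show ?thesis using assms by simp
qed

lemma inj_wick_basis:
  fixes hbar :: real
  assumes "hbar \<noteq> 0"
  shows "inj (wick_basis hbar :: 'n::finite bidx \<Rightarrow> _)"
proof (rule injI)
  fix \<alpha> \<beta> :: "'n bidx" assume "wick_basis hbar \<alpha> = wick_basis hbar \<beta>"
  then have "Poly_Mapping.keys (wick_basis hbar \<alpha>) = Poly_Mapping.keys (wick_basis hbar \<beta>)" by simp
  moreover have "Poly_Mapping.keys (wick_basis hbar \<gamma>) = {\<gamma>}" for \<gamma> :: "'n bidx"
    using assms mfact_pos[of "fst \<gamma>"] mfact_pos[of "snd \<gamma>"]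
    by (auto simp: wick_basis_def split: prod.splits)
  ultimately show "\<alpha> = \<beta>" by simp
qed

lemma wick_basis_expansion:
  assumes "hbar \<noteq> 0"
  shows "f = (\<Sum>\<alpha>\<in>Poly_Mapping.keys f. poly_scale (of_nat (mfact (fst \<alpha>)) * of_nat (mfact (snd \<alpha>)) *
    of_real ((2 * hbar) ^ bideg \<alpha>) * Poly_Mapping.lookup f \<alpha>) (wick_basis hbar \<alpha>))"
  using assms
  by (auto simp: poly_mapping_eq_iff fun_eq_iff lookup_wick_basis_sum in_keys_iff field_simps)

lemma independent_wick_basis:
  fixes hbar :: real
  assumes "hbar \<noteq> 0"
  shows "\<not> module.dependent poly_scale (range (wick_basis hbar :: 'n::finite bidx \<Rightarrow> _))"
proof -
  interpret V: vector_space "poly_scale :: complex \<Rightarrow> 'n zpoly \<Rightarrow> _"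
    by (rule vector_space_poly_scale)
  show ?thesis
    unfolding V.independent_explicit_module
  proof (intro allI impI)
    fix t u and v :: "'n zpoly"
    assume t: "finite t" "t \<subseteq> range (wick_basis hbar)" "(\<Sum>v\<in>t. poly_scale (u v) v) = 0" "v \<in> t"
    define F where "F = wick_basis hbar -` t"
    have inj: "inj (wick_basis hbar :: 'n bidx \<Rightarrow> _)" using inj_wick_basis[OF assms] .
    have F: "finite F" "t = wick_basis hbar ` F"
      using t inj by (auto simp: F_def finite_vimageI)
    obtain \<beta> where \<beta>: "v = wick_basis hbar \<beta>" "\<beta> \<in> F" using t F by auto
    have "(\<Sum>\<alpha>\<in>F. poly_scale (u (wick_basis hbar \<alpha>)) (wick_basis hbar \<alpha>)) = 0"
      using t(3) unfolding F(2) by (subst (asm) sum.reindex) (auto intro: inj_on_subset[OF inj])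
    then have "Poly_Mapping.lookup (\<Sum>\<alpha>\<in>F. poly_scale (u (wick_basis hbar \<alpha>)) (wick_basis hbar \<alpha>)) \<beta> = 0"
      by simp
    then show "u v = 0"
      using \<beta> assms mfact_pos[of "fst \<beta>"] mfact_pos[of "snd \<beta>"]
      by (simp add: lookup_wick_basis_sum[OF assms F(1)])
  qed
qed

lemma wick_coords_eq:
  fixes hbar :: real and f :: "'n::finite zpoly"
  assumes "hbar \<noteq> 0"
  shows "wick_coords hbar f \<alpha> = of_nat (mfact (fst \<alpha>)) * of_nat (mfact (snd \<alpha>)) *
    of_real ((2 * hbar) ^ bideg \<alpha>) * Poly_Mapping.lookup f \<alpha>"
proof -
  interpret V: vector_space "poly_scale :: complex \<Rightarrow> 'n zpoly \<Rightarrow> _"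
    by (rule vector_space_poly_scale)
  have inj: "inj (wick_basis hbar :: 'n bidx \<Rightarrow> _)" using inj_wick_basis[OF assms] .
  have ind: "V.independent (range (wick_basis hbar))" using independent_wick_basis[OF assms] .
  let ?c = "\<lambda>\<alpha>. of_nat (mfact (fst \<alpha>)) * of_nat (mfact (snd \<alpha>)) *
    of_real ((2 * hbar) ^ bideg \<alpha>) * Poly_Mapping.lookup f \<alpha>"
  let ?B = "range (wick_basis hbar :: 'n bidx \<Rightarrow> _)"
  have "V.representation ?B f (wick_basis hbar \<alpha>) =
      V.representation ?B (\<Sum>\<beta>\<in>Poly_Mapping.keys f. poly_scale (?c \<beta>) (wick_basis hbar \<beta>)) (wick_basis hbar \<alpha>)"
    using wick_basis_expansion[OF assms, of f] by simp
  also have "\<dots> = (\<Sum>\<beta>\<in>Poly_Mapping.keys f. ?c \<beta> * (if \<alpha> = \<beta> then 1 else 0))"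
    using inj by (auto simp: V.representation_sum[OF ind] V.representation_scale[OF ind] V.span_base
        V.span_scale V.representation_basis[OF ind] inj_eq intro!: sum.cong)
  also have "\<dots> = ?c \<alpha>"
    by (auto simp: in_keys_iff if_distrib cong: if_cong)
  finally show ?thesis unfolding wick_coords_def .
qed

definition wick_struct :: "real \<Rightarrow> 'n::finite bidx \<Rightarrow> 'n bidx \<Rightarrow> 'n bidx \<Rightarrow> complex" where
  "wick_struct hbar \<alpha> \<beta> \<gamma> = wick_coords hbar (wick_mult hbar (wick_basis hbar \<alpha>) (wick_basis hbar \<beta>)) \<gamma>"

definition wick_topology :: "real \<Rightarrow> 'n::finite zpoly topology" where
  "wick_topology hbar =
     lc_topology UNIV ((\<lambda>p f. p (wick_coords hbar f)) ` snorms (wick_struct hbar))"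


section \<open>Real-analytic functions and Taylor expansions\<close>

definition real_analytic :: "('a::euclidean_space \<Rightarrow> 'b::real_normed_vector) \<Rightarrow> bool" where
  "real_analytic f \<longleftrightarrow>
     (\<forall>p. \<exists>r>0. \<exists>c. \<forall>x\<in>ball p r.
        ((\<lambda>N. (\<Prod>b\<in>Basis. ((x - p) \<bullet> b) ^ N b) *\<^sub>R c N) has_sum f x) (Basis \<rightarrow>\<^sub>E (UNIV :: nat set)))"

definition poly_eval :: "'n::finite zpoly \<Rightarrow> complex ^ 'n \<Rightarrow> complex" where
  "poly_eval f z = (\<Sum>(I, J)\<in>Poly_Mapping.keys f. Poly_Mapping.lookup f (I, J) *
     (\<Prod>k\<in>UNIV. (z $ k) ^ (I $ k)) * (\<Prod>k\<in>UNIV. cnj (z $ k) ^ (J $ k)))"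

text \<open>The Wirtinger derivatives \<open>(\<partial>\<^sub>x \<mp> \<i> \<partial>\<^sub>y) / 2\<close> in the \<open>k\<close>-th variable \<open>z\<^sub>k = x + \<i> y\<close>.\<close>

definition wirtinger_z :: "'n::finite \<Rightarrow> (complex ^ 'n \<Rightarrow> complex) \<Rightarrow> (complex ^ 'n \<Rightarrow> complex)" where
  "wirtinger_z k f = (\<lambda>p.
     (vector_derivative (\<lambda>t::real. f (p + t *\<^sub>R axis k 1)) (at 0)
      - \<i> * vector_derivative (\<lambda>t::real. f (p + t *\<^sub>R axis k \<i>)) (at 0)) / 2)"

definition wirtinger_zbar :: "'n::finite \<Rightarrow> (complex ^ 'n \<Rightarrow> complex) \<Rightarrow> (complex ^ 'n \<Rightarrow> complex)" where
  "wirtinger_zbar k f = (\<lambda>p.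
     (vector_derivative (\<lambda>t::real. f (p + t *\<^sub>R axis k 1)) (at 0)
      + \<i> * vector_derivative (\<lambda>t::real. f (p + t *\<^sub>R axis k \<i>)) (at 0)) / 2)"

text \<open>
  \<open>f\<close> is everywhere the sum of its Taylor series at the origin, \<open>a\<close> being the Taylor coefficients
  with respect to the normalised monomials:
  \<open>a\<^sub>I\<^sub>,\<^sub>J = (2 hbar)\<^bsup>|I| + |J|\<^esup> (\<partial>\<^sup>I \<partial>bar\<^sup>J f) (0)\<close>. Higher derivatives are taken along arbitrary
  sequences \<open>ks\<close>, \<open>ls\<close> of variables, whose multiplicities are \<open>I\<close> and \<open>J\<close>.
\<close>

definition taylor_expansion :: "real \<Rightarrow> (complex ^ 'n::finite \<Rightarrow> complex) \<Rightarrow>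
    ('n bidx \<Rightarrow> complex) \<Rightarrow> bool" where
  "taylor_expansion hbar f a \<longleftrightarrow>
     (\<forall>ks ls. a (\<chi> k. count_list ks k, \<chi> k. count_list ls k) =
        of_real ((2 * hbar) ^ (length ks + length ls)) *
        foldr wirtinger_z ks (foldr wirtinger_zbar ls f) 0) \<and>
     (\<forall>z. ((\<lambda>\<alpha>. a \<alpha> * poly_eval (wick_basis hbar \<alpha>) z) has_sum f z) UNIV)"

definition taylor_sum :: "real \<Rightarrow> ('n::finite bidx \<Rightarrow> complex) \<Rightarrow> complex ^ 'n \<Rightarrow> complex" where
  "taylor_sum hbar a z = (\<Sum>\<^sub>\<infinity>\<alpha>\<in>UNIV. a \<alpha> * poly_eval (wick_basis hbar \<alpha>) z)"

end

theory Submission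
  imports Defs
begin

text \<open>
  The completion is a space of coefficient families, and everything follows once its seminorms are
  compared with the weighted sup-norms \<open>sup |a\<^sub>\<alpha>| / (|\<alpha>|!)\<^sup>\<epsilon>\<close> of sub-factorial growth.

  In the basis \<open>e\<^sub>I\<^sub>,\<^sub>J\<close> the structure constants are explicit (\<open>wick_struct_eq\<close>): the product of
  \<open>e\<close> at \<open>(K' + N, J)\<close> and \<open>e\<close> at \<open>(K, J' + N)\<close> has at \<open>(K' + K, J + J')\<close> the coefficient
  \<open>binom(K' + K, K) binom(J + J', J) / (N! (2 hbar)^|N|)\<close>, and \<open>N\<close>, the multiindex of the derivatives taken,
  is the only unbounded parameter once the result is fixed. The factor \<open>1 / N!\<close> has two consequences.

  Upper bound (\<open>hnorm_le\<close>): if the values of \<open>h\<^sub>m\<close> grow at most like \<open>(|\<alpha>|!)\<^sup>\<delta>\<close> with \<open>\<delta> < 1/4\<close>, their squares are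
  summable against \<open>1 / N!\<close>, and the sum \<open>h\<^sub>m\<^sub>+\<^sub>1\<close> grows at most like \<open>(|\<gamma>|!)\<close> to the power \<open>4 \<delta>\<close>. Starting
  from a small enough exponent, any number of steps is possible, so that every \<open>\<parallel>a\<parallel>\<^sub>m\<^sub>,\<^sub>l\<^sub>,\<^sub>\<gamma>\<close> is dominated by
  a weighted sup-norm.

  Lower bound (\<open>hnorm_path_ge\<close>): two steps of the recursion lead from the index \<open>(0, 0)\<close> via \<open>(I, 0)\<close> to \<open>(I, J)\<close>
  at the price of a factor that is \<open>I! (J!)\<^sup>2\<close> up to an exponential, and all further steps can stay at \<open>(I, J)\<close>, because \<open>e\<close> at
  \<open>(0, 0)\<close> is the unit. The root of order \<open>2\<^sup>m\<close> makes this price an arbitrarily small power of a factorial. So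
  each weighted sup-norm is dominated by one of the given seminorms, and \<open>hat_space_eq\<close> and
  \<open>hat_topology_eq\<close> identify the completion with the Koethe space.

  The remaining properties are properties of the weights. There are only polynomially many indices of each
  degree, so every negative power of \<open>|\<alpha>|!\<close> is summable, and rapidly decreasing along an enumeration by degree;
  passing from one exponent to a larger one gains such a factor. This gives convergence of the
  expansions, the absolute basis, and strong nuclearity through the diagonal operators of the weights.
  The product is continuous by the estimate used for the upper bound. On polynomials associativity
  passes from a factor to its products with the variables (\<open>wick_mult_assoc\<close>), and then it holds everywhere by density. Finally, a
  family of sub-factorial growth, divided by the factorials in \<open>e\<^sub>I\<^sub>,\<^sub>J\<close>, is a power series that converges
  absolutely everywhere; differentiating it term by term shifts the coefficients, and re-expanding it around any
  point, in the real and imaginary parts, converges on a ball of radius 1.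
\<close>

section \<open>Locally convex topologies\<close>

locale seminorm_family = vector_space scale
  for scale :: "complex \<Rightarrow> 'v::ab_group_add \<Rightarrow> 'v" +
  fixes V :: "'v set" and P :: "('v \<Rightarrow> real) set"
  assumes subspace_V: "subspace V"
    and seminorms: "p \<in> P \<Longrightarrow> seminorm_on scale V p"
    and nonempty: "P \<noteq> {}"
begin

lemma V_add: "x \<in> V \<Longrightarrow> y \<in> V \<Longrightarrow> x + y \<in> V"
  and V_diff: "x \<in> V \<Longrightarrow> y \<in> V \<Longrightarrow> x - y \<in> V"
  and V_zero: "0 \<in> V"
  and V_scale: "x \<in> V \<Longrightarrow> scale c x \<in> V"
  using subspace_add subspace_diff subspace_0 subspace_scale subspace_V by auto

lemma V_sum: "(\<And>i. i \<in> A \<Longrightarrow> f i \<in> V) \<Longrightarrow> sum f A \<in> V"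
  using subspace_sum[OF subspace_V] by blast

lemma seminorm_ge0: "seminorm_on scale V p \<Longrightarrow> x \<in> V \<Longrightarrow> 0 \<le> p x"
  and seminorm_triangle: "seminorm_on scale V p \<Longrightarrow> x \<in> V \<Longrightarrow> y \<in> V \<Longrightarrow> p (x + y) \<le> p x + p y"
  and seminorm_scale: "seminorm_on scale V p \<Longrightarrow> x \<in> V \<Longrightarrow> p (scale c x) = norm c * p x"
  by (auto simp: seminorm_on_def)

lemma seminorm_zero: "seminorm_on scale V p \<Longrightarrow> p 0 = 0"
  using seminorm_scale[of p 0 0] V_zero by simp

lemma seminorm_minus:
  assumes "seminorm_on scale V p" "x \<in> V" "y \<in> V" shows "p (x - y) = p (y - x)"
  using seminorm_scale[of p "x - y" "-1"] assms V_diff by simp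

lemma seminorm_triangle3:
  assumes "seminorm_on scale V p" "x \<in> V" "y \<in> V" "z \<in> V"
  shows "p (x - z) \<le> p (x - y) + p (y - z)"
  using seminorm_triangle[of p "x - y" "y - z"] assms V_diff by simp

lemma seminorm_reverse_triangle:
  assumes "seminorm_on scale V p" "x \<in> V" "y \<in> V"
  shows "\<bar>p x - p y\<bar> \<le> p (x - y)"
  using seminorm_triangle3[of p x y 0] seminorm_triangle3[of p y x 0] assms V_zero
    seminorm_minus[of p x y] by auto

lemma topspace_lc [simp]: "topspace (lc_topology V P) = V"
  unfolding lc_topology_def by (auto simp: topology_generated_by_topspace)

lemma openin_lc_ball:
  "p \<in> P \<Longrightarrow> x \<in> V \<Longrightarrow> r > 0 \<Longrightarrow> openin (lc_topology V P) {y\<in>V. p (y - x) < r}"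
  unfolding lc_topology_def by (rule topology_generated_by_Basis) blast

lemma openin_lcI:
  assumes "U \<subseteq> V" and "\<And>x. x \<in> U \<Longrightarrow> \<exists>p\<in>P. \<exists>r>0. {y\<in>V. p (y - x) < r} \<subseteq> U"
  shows "openin (lc_topology V P) U"
proof (subst openin_subopen, intro ballI)
  fix x assume x: "x \<in> U"
  then obtain p r where p: "p \<in> P" "r > 0" "{y\<in>V. p (y - x) < r} \<subseteq> U"
    using assms(2) by blast
  then show "\<exists>T. openin (lc_topology V P) T \<and> x \<in> T \<and> T \<subseteq> U"
    using x assms(1) seminorm_zero[OF seminorms[OF p(1)]] openin_lc_ball[OF p(1) _ p(2), of x]
    by (intro exI[of _ "{y\<in>V. p (y - x) < r}"]) auto
qed

text \<open>
  A seminorm dominated by a member of \<open>P\<close> is continuous, so its balls are open although they need not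
  belong to the subbasis.
\<close>

lemma openin_dominated_ball:
  assumes p: "seminorm_on scale V p" and q: "q \<in> P" "\<And>x. x \<in> V \<Longrightarrow> p x \<le> C * q x"
    and x: "x \<in> V" and r: "r > 0"
  shows "openin (lc_topology V P) {y\<in>V. p (y - x) < r}"
proof (rule openin_lcI)
  fix y assume y: "y \<in> {y\<in>V. p (y - x) < r}"
  define t where "t = (r - p (y - x)) / (\<bar>C\<bar> + 1)"
  have t: "t > 0" using y by (auto simp: t_def)
  have "p (z - x) < r" if z: "z \<in> V" "q (z - y) < t" for z
  proof -
    have "p (z - y) \<le> C * q (z - y)" using q(2) V_diff y z by auto
    also have "\<dots> \<le> (\<bar>C\<bar> + 1) * q (z - y)"
      using seminorm_ge0[OF seminorms[OF q(1)], of "z - y"] V_diff y z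
      by (intro mult_right_mono) auto
    also have "\<dots> < (\<bar>C\<bar> + 1) * t" using z(2) by (intro mult_strict_left_mono) auto
    also have "\<dots> = r - p (y - x)" by (simp add: t_def)
    finally show ?thesis using seminorm_triangle3[OF p, of z y x] x y z by auto
  qed
  then show "\<exists>p'\<in>P. \<exists>r'>0. {z \<in> V. p' (z - y) < r'} \<subseteq> {y \<in> V. p (y - x) < r}"
    using q(1) t by blast
qed auto

end

lemma lc_topology_finer:
  assumes P: "seminorm_family s V P" and Q: "seminorm_family s V Q"
    and dom: "\<And>p. p \<in> P \<Longrightarrow> \<exists>q\<in>Q. \<exists>C. \<forall>x\<in>V. p x \<le> C * q x"
    and U: "openin (lc_topology V P) U"
  shows "openin (lc_topology V Q) U"
proof -
  interpret P: seminorm_family s V P by fact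
  interpret Q: seminorm_family s V Q by fact
  have "generate_topology_on (insert V {{y\<in>V. p (y - x) < r} | p x r. p \<in> P \<and> x \<in> V \<and> r > 0}) U"
    using U unfolding lc_topology_def openin_topology_generated_by_iff .
  then show ?thesis
  proof induction
    case (Basis B)
    then consider "B = V" | p x r where "B = {y\<in>V. p (y - x) < r}" "p \<in> P" "x \<in> V" "r > 0" by blast
    then show ?case
    proof cases
      case 1 then show ?thesis using openin_topspace[of "lc_topology V Q"] by simp
    next
      case 2 then show ?thesis
        using dom[of p] Q.openin_dominated_ball[OF P.seminorms] by blast
    qed
  qed (auto intro: openin_Union)
qed

lemma lc_topology_eqI:
  assumes P: "seminorm_family s V P" and Q: "seminorm_family s V Q"
    and "\<And>p. p \<in> P \<Longrightarrow> \<exists>q\<in>Q. \<exists>C. \<forall>x\<in>V. p x \<le> C * q x"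
    and "\<And>q. q \<in> Q \<Longrightarrow> \<exists>p\<in>P. \<exists>C. \<forall>x\<in>V. q x \<le> C * p x"
  shows "lc_topology V P = lc_topology V Q"
  unfolding topology_eq
  using lc_topology_finer[OF P Q assms(3)] lc_topology_finer[OF Q P assms(4)] by blast

text \<open>
  For a directed family the balls are a basis of the topology and not just a subbasis, so neighbourhoods,
  limits and continuous seminorms can be described with one member of \<open>P\<close> at a time.
\<close>

locale directed_seminorms = seminorm_family +
  assumes directed: "p \<in> P \<Longrightarrow> q \<in> P \<Longrightarrow> \<exists>r\<in>P. \<forall>x\<in>V. p x \<le> r x \<and> q x \<le> r x"
begin

abbreviation "T \<equiv> lc_topology V P"

lemma openin_lc_iff:
  "openin T U \<longleftrightarrow> U \<subseteq> V \<and> (\<forall>x\<in>U. \<exists>p\<in>P. \<exists>r>0. {y\<in>V. p (y - x) < r} \<subseteq> U)"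
proof
  assume "openin T U"
  then have "generate_topology_on (insert V {{y\<in>V. p (y - x) < r} | p x r. p \<in> P \<and> x \<in> V \<and> r > 0}) U"
    unfolding lc_topology_def openin_topology_generated_by_iff .
  then show "U \<subseteq> V \<and> (\<forall>x\<in>U. \<exists>p\<in>P. \<exists>r>0. {y\<in>V. p (y - x) < r} \<subseteq> U)"
  proof induction
    case (Int A B)
    have "\<exists>p\<in>P. \<exists>r>0. {y\<in>V. p (y - x) < r} \<subseteq> A \<inter> B" if x: "x \<in> A \<inter> B" for x
    proof -
      obtain p r where p: "p \<in> P" "r > 0" "{y\<in>V. p (y - x) < r} \<subseteq> A" using Int x by blast
      obtain p' r' where p': "p' \<in> P" "r' > 0" "{y\<in>V. p' (y - x) < r'} \<subseteq> B" using Int x by blast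
      obtain q where q: "q \<in> P" "\<forall>x\<in>V. p x \<le> q x \<and> p' x \<le> q x" using directed p p' by blast
      have "x \<in> V" using x Int by blast
      then have "{y\<in>V. q (y - x) < min r r'} \<subseteq> A \<inter> B"
      proof (intro subsetI IntI)
        fix y assume y: "y \<in> {y\<in>V. q (y - x) < min r r'}"
        then have "p (y - x) \<le> q (y - x)" "p' (y - x) \<le> q (y - x)"
          using q(2) V_diff[of y x] \<open>x \<in> V\<close> by auto
        then have "p (y - x) < r" "p' (y - x) < r'" "y \<in> V" using y by auto
        then show "y \<in> A" "y \<in> B" using p(3) p'(3) by auto
      qed
      then show ?thesis using p(2) p'(2) q(1) by (intro bexI[of _ q] exI[of _ "min r r'"]) auto
    qed
    then show ?case using Int by blast
  next
    case (UN K)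
    have "\<exists>p\<in>P. \<exists>r>0. {y\<in>V. p (y - x) < r} \<subseteq> \<Union>K" if x: "x \<in> \<Union>K" for x
    proof -
      obtain k where k: "k \<in> K" "x \<in> k" using x by blast
      then obtain p r where "p \<in> P" "r > 0" "{y\<in>V. p (y - x) < r} \<subseteq> k" using UN by blast
      then show ?thesis using k(1) by (intro bexI[of _ p] exI[of _ r]) auto
    qed
    then show ?case using UN by blast
  next
    case (Basis B)
    then consider "B = V" | p x r where "B = {y\<in>V. p (y - x) < r}" "p \<in> P" "x \<in> V" "r > 0" by blast
    then show ?case
    proof cases
      case 1
      obtain p where "p \<in> P" using nonempty by blast
      then show ?thesis using 1 by (auto intro!: bexI[of _ p] exI[of _ "1::real"])
    next
      case 2
      have "{z\<in>V. p (z - y) < r - p (y - x)} \<subseteq> B" if "y \<in> B" for y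
        using seminorm_triangle3[OF seminorms[OF 2(2)], of _ y x] 2 that by fastforce
      then have "\<exists>p\<in>P. \<exists>r>0. {z \<in> V. p (z - y) < r} \<subseteq> B" if "y \<in> B" for y
        using that 2 by (intro bexI[of _ p] exI[of _ "r - p (y - x)"]) auto
      then show ?thesis using 2 by auto
    qed
  qed auto
qed (auto intro: openin_lcI)

lemma limitin_lc_iff:
  "limitin T f l F \<longleftrightarrow> l \<in> V \<and> (\<forall>p\<in>P. \<forall>r>0. \<forall>\<^sub>F x in F. f x \<in> V \<and> p (f x - l) < r)"
proof (intro iffI conjI ballI allI impI)
  assume L: "limitin T f l F"
  then show l: "l \<in> V" by (auto simp: limitin_def)
  fix p and r :: real assume p: "p \<in> P" "r > 0"
  have "l \<in> {y\<in>V. p (y - l) < r}" using l p seminorm_zero[OF seminorms[OF p(1)]] by auto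
  then show "\<forall>\<^sub>F x in F. f x \<in> V \<and> p (f x - l) < r"
    using L openin_lc_ball[OF p(1) l p(2)] unfolding limitin_def by fastforce
next
  assume R: "l \<in> V \<and> (\<forall>p\<in>P. \<forall>r>0. \<forall>\<^sub>F x in F. f x \<in> V \<and> p (f x - l) < r)"
  show "limitin T f l F" unfolding limitin_def
  proof (intro conjI allI impI)
    fix U assume "openin T U \<and> l \<in> U"
    then obtain p r where "p \<in> P" "r > 0" and sub: "{y\<in>V. p (y - l) < r} \<subseteq> U"
      unfolding openin_lc_iff by blast
    then have "\<forall>\<^sub>F x in F. f x \<in> V \<and> p (f x - l) < r" using R by blast
    then show "\<forall>\<^sub>F x in F. f x \<in> U" by eventually_elim (use sub in auto)
  qed (use R in simp)
qed

lemma continuous_seminorm_if_dominated: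
  assumes p: "seminorm_on scale V p" and q: "q \<in> P" "\<And>x. x \<in> V \<Longrightarrow> p x \<le> C * q x"
  shows "continuous_seminorm scale V T p"
  unfolding continuous_seminorm_def
proof (intro conjI p)
  have "openin T {x \<in> V. p x \<in> U}" if U: "open U" for U
  proof (subst openin_subopen, intro ballI)
    fix x assume x: "x \<in> {x \<in> V. p x \<in> U}"
    then obtain r where r: "r > 0" "ball (p x) r \<subseteq> U" using U open_contains_ball by blast
    have "{y\<in>V. p (y - x) < r} \<subseteq> {x \<in> V. p x \<in> U}"
      using r(2) seminorm_reverse_triangle[OF p, of _ x] x
      by (fastforce simp: dist_real_def abs_minus_commute subset_iff)
    moreover have "x \<in> {y\<in>V. p (y - x) < r}" using x r seminorm_zero[OF p] by auto
    ultimately show "\<exists>S. openin T S \<and> x \<in> S \<and> S \<subseteq> {x \<in> V. p x \<in> U}"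
      using openin_dominated_ball[OF p q, of x r] x r by blast
  qed
  then show "continuous_map T euclideanreal p"
    by (auto simp: continuous_map_def)
qed

lemma continuous_seminorm_dominated:
  assumes "continuous_seminorm scale V T p"
  shows "\<exists>q\<in>P. \<exists>C\<ge>0. \<forall>x\<in>V. p x \<le> C * q x"
proof -
  have p: "seminorm_on scale V p" and c: "continuous_map T euclideanreal p"
    using assms by (auto simp: continuous_seminorm_def)
  have "openin T {x \<in> V. p x \<in> {..<1}}"
    using openin_continuous_map_preimage[OF c, of "{..<1}"] by simp
  moreover have "0 \<in> {x \<in> V. p x \<in> {..<1}}" using seminorm_zero[OF p] V_zero by auto
  ultimately obtain q r where q: "q \<in> P" and r: "r > 0"
    and sub: "{y\<in>V. q (y - 0) < r} \<subseteq> {x \<in> V. p x \<in> {..<1}}"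
    unfolding openin_lc_iff by blast
  \<comment> \<open>Otherwise \<open>x / p x\<close> lies in the ball of radius \<open>r\<close>, where \<open>p < 1\<close>, although \<open>p\<close> is \<open>1\<close> there.\<close>
  have "p x \<le> (2 / r) * q x" if x: "x \<in> V" for x
  proof (rule ccontr)
    assume "\<not> ?thesis"
    then have *: "(2 / r) * q x < p x" by simp
    have q0: "0 \<le> q x" using seminorm_ge0[OF seminorms[OF q] x] .
    then have px: "p x > 0" using * r by (meson divide_nonneg_pos le_less_trans mult_nonneg_nonneg zero_le_numeral)
    let ?y = "scale (complex_of_real (1 / p x)) x"
    have "q ?y = q x / p x" using seminorm_scale[OF seminorms[OF q] x] px by (simp add: norm_divide)
    also have "\<dots> < r" using * px r q0
      by (simp add: field_simps)
    finally have "p ?y < 1" using sub V_scale[OF x] by auto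
    moreover have "p ?y = 1" using seminorm_scale[OF p x, of "complex_of_real (1 / p x)"] px
      by (simp add: norm_divide)
    ultimately show False by simp
  qed
  then show ?thesis using q r by (intro bexI[of _ q] exI[of _ "2/r"]) auto
qed

end

text \<open>
  If the seminorms of the source are those of the target composed with the injection, the balls of the source
  are the preimages of the balls with centre in the image.
\<close>

lemma embedding_map_lc:
  assumes P: "seminorm_family s V P"
    and inj: "inj_on f W" and into: "f ` W \<subseteq> V"
    and diff: "\<And>x y. x \<in> W \<Longrightarrow> y \<in> W \<Longrightarrow> f (x - y) = f x - f y"
    and W: "\<And>x y. x \<in> W \<Longrightarrow> y \<in> W \<Longrightarrow> x - y \<in> W"
  shows "embedding_map (lc_topology W ((\<lambda>p x. p (f x)) ` P)) (lc_topology V P) f"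
proof -
  interpret P: seminorm_family s V P by fact
  let ?TW = "lc_topology W ((\<lambda>p x. p (f x)) ` P)" and ?T = "lc_topology V P"
  have tW: "topspace ?TW = W"
    unfolding lc_topology_def by (auto simp: topology_generated_by_topspace)
  have ball: "openin ?TW {y\<in>W. p (f y - f x) < r}" if "p \<in> P" "x \<in> W" "r > 0" for p x r
  proof -
    have *: "{y\<in>W. p (f y - f x) < r} = {y\<in>W. (\<lambda>x. p (f x)) (y - x) < r}" using diff that by auto
    show ?thesis unfolding lc_topology_def *
      by (rule topology_generated_by_Basis, rule insertI2, rule CollectI, rule exI[of _ "\<lambda>x. p (f x)"],
          rule exI[of _ x], rule exI[of _ r]) (use that in auto)
  qed
  have cont: "continuous_map ?TW ?T f" unfolding lc_topology_def[of V]
  proof (rule continuous_on_generated_topo, unfold tW)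
    show "f ` W \<subseteq> \<Union>(insert V {{y \<in> V. p (y - x) < r} |p x r. p \<in> P \<and> x \<in> V \<and> 0 < r})"
      using into by auto
    fix U assume "U \<in> insert V {{y \<in> V. p (y - x) < r} |p x r. p \<in> P \<and> x \<in> V \<and> 0 < r}"
    then consider "U = V" | p x r where "U = {y\<in>V. p (y - x) < r}" "p \<in> P" "x \<in> V" "r > 0" by blast
    then show "openin ?TW (f -` U \<inter> W)"
    proof cases
      case 1
      then have "f -` U \<inter> W = topspace ?TW" using into tW by auto
      then show ?thesis by (metis openin_topspace)
    next
      case 2
      have pp: "seminorm_on s V p" using P.seminorms 2 by auto
      show ?thesis
      proof (subst openin_subopen, intro ballI)
        fix z assume z: "z \<in> f -` U \<inter> W"
        let ?B = "{y\<in>W. p (f y - f z) < r - p (f z - x)}"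
        have "?B \<subseteq> f -` U \<inter> W"
        proof
          fix y assume y: "y \<in> ?B"
          then have "p (f y - x) \<le> p (f y - f z) + p (f z - x)"
            using P.seminorm_triangle3[OF pp, of "f y" "f z" x] z 2 into by blast
          then show "y \<in> f -` U \<inter> W" using y 2 into by auto
        qed
        moreover have "z \<in> ?B" using z 2 P.seminorm_zero[OF pp] by auto
        ultimately show "\<exists>S. openin ?TW S \<and> z \<in> S \<and> S \<subseteq> f -` U \<inter> W"
          using ball[of p z "r - p (f z - x)"] 2 z by (intro exI[of _ ?B]) auto
      qed
    qed
  qed
  have opn: "openin (subtopology ?T (f ` W)) (f ` U)" if "openin ?TW U" for U
  proof -
    have "generate_topology_on (insert W {{y\<in>W. p (y - x) < r} | p x r.
        p \<in> (\<lambda>p x. p (f x)) ` P \<and> x \<in> W \<and> r > 0}) U"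
      using that unfolding lc_topology_def[of W] openin_topology_generated_by_iff .
    then have "U \<subseteq> W \<and> openin (subtopology ?T (f ` W)) (f ` U)"
    proof induction
      case (Basis B)
      then consider "B = W" | p x r where "B = {y\<in>W. p (f (y - x)) < r}" "p \<in> P" "x \<in> W" "r > 0"
        by blast
      then show ?case
      proof cases
        case 1
        then show ?thesis using into
          by (simp add: openin_subtopology_refl)
      next
        case 2
        have "f ` B = {y\<in>V. p (y - f x) < r} \<inter> f ` W" using 2 diff into by auto
        then show ?thesis using P.openin_lc_ball[OF 2(2), of "f x" r] 2 into
          by (auto simp: openin_subtopology)
      qed
    next
      case (Int A B)
      then have "f ` (A \<inter> B) = f ` A \<inter> f ` B" using inj by (meson inj_on_image_Int)
      then show ?case using Int by auto
    next
      case (UN K)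
      then show ?case by (auto simp: image_Union intro!: openin_Union)
    qed auto
    then show ?thesis by blast
  qed
  have "homeomorphic_map ?TW (subtopology ?T (f ` W)) f"
  proof (rule bijective_open_imp_homeomorphic_map)
    show "continuous_map ?TW (subtopology ?T (f ` W)) f"
      using cont by (simp add: continuous_map_in_subtopology tW)
    show "open_map ?TW (subtopology ?T (f ` W)) f" using opn by (simp add: open_map_def)
    show "f ` topspace ?TW = topspace (subtopology ?T (f ` W))" using into by (auto simp: tW)
    show "inj_on f (topspace ?TW)" using inj by (simp add: tW)
  qed
  then show ?thesis by (simp add: embedding_map_def tW)
qed

section \<open>Spaces of families of sub-factorial growth\<close>

text \<open>
  Exponential factors are absorbed by arbitrarily small powers of the factorial: if \<open>R \<ge> 1\<close> and \<open>x = R powr (1/\<eta>)\<close>,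
  the left-hand side is \<open>(x ^ k) powr \<eta>\<close>, and \<open>x ^ k / fact k\<close> is a term of the exponential series of \<open>x\<close>.
\<close>

lemma power_le_fact_powr:
  fixes R \<eta> :: real
  assumes "\<eta> > 0"
  obtains C where "C > 0" "\<And>k. R ^ k \<le> C * fact k powr \<eta>"
proof -
  define S where "S = max 1 \<bar>R\<bar>"
  define x where "x = S powr (1 / \<eta>)"
  have S: "S \<ge> 1" by (auto simp: S_def)
  have x: "x > 0" using S by (simp add: x_def)
  have "R ^ k \<le> exp x powr \<eta> * fact k powr \<eta>" for k
  proof -
    have "x ^ k / fact k \<le> exp x"
      using sum_le_suminf[OF summable_exp_generic[of x], of "{k}"] x
      by (simp add: exp_def divide_inverse mult.commute)
    then have *: "x ^ k \<le> exp x * fact k" by (simp add: field_simps)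
    have "R ^ k \<le> \<bar>R\<bar> ^ k" by (metis abs_ge_self power_abs)
    also have "\<dots> \<le> S ^ k" by (intro power_mono) (auto simp: S_def)
    also have "S ^ k = (x ^ k) powr \<eta>"
      using S assms x by (simp add: x_def powr_powr powr_realpow[symmetric] mult.commute)
    also have "\<dots> \<le> (exp x * fact k) powr \<eta>" using * x assms by (intro powr_mono2) auto
    also have "\<dots> = exp x powr \<eta> * fact k powr \<eta>" by (simp add: powr_mult)
    finally show ?thesis .
  qed
  then show ?thesis using that[of "exp x powr \<eta>"] by simp
qed

lemma Suc_power_le_fact_powr:
  assumes "\<eta> > 0"
  obtains C where "C > 0" "\<And>k. (real k + 1) ^ r \<le> C * fact k powr \<eta>"
proof -
  obtain C where C: "C > 0" "\<And>k. (2 ^ r) ^ k \<le> C * fact k powr \<eta>"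
    using power_le_fact_powr[OF assms, of "2 ^ r"] by blast
  have "(real k + 1) ^ r \<le> C * fact k powr \<eta>" for k
  proof -
    have "real k + 1 \<le> 2 ^ k" using less_exp[of k] by (metis Suc_eq_plus1 Suc_leI of_nat_1 of_nat_add of_nat_le_iff of_nat_numeral of_nat_power)
    then have "(real k + 1) ^ r \<le> (2 ^ k) ^ r" by (intro power_mono) auto
    also have "\<dots> = (2 ^ r) ^ k" by (simp flip: power_mult add: mult.commute)
    finally show ?thesis using C(2)[of k] by simp
  qed
  then show ?thesis using that C(1) by blast
qed

definition unit_family :: "'i \<Rightarrow> 'i \<Rightarrow> complex" where
  "unit_family \<alpha> = (\<lambda>\<beta>. if \<beta> = \<alpha> then 1 else 0)"

lemma unit_family_expansion:
  "finite F \<Longrightarrow> (\<Sum>\<alpha>\<in>F. fam_scale (a \<alpha>) (unit_family \<alpha>)) = (\<lambda>\<beta>. if \<beta> \<in> F then a \<beta> else 0)"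
proof -
  have "(\<Sum>\<alpha>\<in>F. fam_scale (a \<alpha>) (unit_family \<alpha>)) \<beta> = (\<Sum>\<alpha>\<in>F. fam_scale (a \<alpha>) (unit_family \<alpha>) \<beta>)" for \<beta>
    by (induction F rule: infinite_finite_induct) auto
  then show "finite F \<Longrightarrow> ?thesis"
    by (auto simp: fun_eq_iff fam_scale_def unit_family_def if_distrib cong: if_cong)
qed

lemma infsum_ennreal_eq:
  assumes "f summable_on A" "\<And>x. x \<in> A \<Longrightarrow> 0 \<le> f x"
  shows "(\<Sum>\<^sub>\<infinity>x\<in>A. ennreal (f x)) = ennreal (\<Sum>\<^sub>\<infinity>x\<in>A. f x)"
proof -
  have "(\<Sum>\<^sub>\<infinity>x\<in>A. ennreal (f x)) = (SUP F\<in>{F. finite F \<and> F \<subseteq> A}. \<Sum>x\<in>F. ennreal (f x))"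
    by (rule nonneg_infsum_complete) auto
  also have "\<dots> = (SUP F\<in>{F. finite F \<and> F \<subseteq> A}. ennreal (sum f F))"
    using assms(2) by (intro SUP_cong refl sum_ennreal) auto
  also have "\<dots> = ennreal (\<Sum>\<^sub>\<infinity>x\<in>A. f x)"
    using infsum_nonneg_is_SUPREMUM_ennreal[OF assms] by simp
  finally show ?thesis .
qed

text \<open>
  Polynomially many indices of each size: this makes every negative power of \<open>fact (sz \<alpha>)\<close> summable, and
  rapidly decreasing along an enumeration by size.
\<close>

locale subfactorial_index =
  fixes sz :: "'i \<Rightarrow> nat" and d :: nat
  assumes finite_level: "finite {\<alpha>. sz \<alpha> \<le> k}"
    and card_level: "card {\<alpha>. sz \<alpha> \<le> k} \<le> (k + 1) ^ d"
begin

abbreviation wt :: "real \<Rightarrow> 'i \<Rightarrow> real" where "wt \<epsilon> \<alpha> \<equiv> fact (sz \<alpha>) powr \<epsilon>"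

lemma wt_ge_1: "\<epsilon> \<ge> 0 \<Longrightarrow> wt \<epsilon> \<alpha> \<ge> 1"
  by (rule ge_one_powr_ge_zero) auto

lemma wt_mono: "\<epsilon> \<le> \<epsilon>' \<Longrightarrow> wt \<epsilon> \<alpha> \<le> wt \<epsilon>' \<alpha>"
  by (rule powr_mono) auto

text \<open>
  Indices are ranked by size, and ties are broken by an arbitrary injection into the natural numbers.
\<close>

lemma enumeration:
  obtains c :: "'i \<Rightarrow> nat" where "inj c" "\<And>\<alpha>. c \<alpha> + 1 \<le> (sz \<alpha> + 1) ^ d"
proof -
  have "UNIV = (\<Union>k. {\<alpha>. sz \<alpha> \<le> k})" by auto
  then have "countable (UNIV :: 'i set)"
    using finite_level by (metis countable_UN countable_finite uncountable_def countableI_type)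
  then obtain e :: "'i \<Rightarrow> nat" where e: "inj e" by (auto simp: countable_def)
  define B where "B \<alpha> = {\<beta>. sz \<beta> < sz \<alpha> \<or> (sz \<beta> = sz \<alpha> \<and> e \<beta> < e \<alpha>)}" for \<alpha>
  have fin: "finite (B \<alpha>)" for \<alpha>
    by (rule finite_subset[OF _ finite_level[of "sz \<alpha>"]]) (auto simp: B_def)
  have less: "card (B \<alpha>) < card (B \<beta>)" if "sz \<alpha> < sz \<beta> \<or> (sz \<alpha> = sz \<beta> \<and> e \<alpha> < e \<beta>)" for \<alpha> \<beta>
    using that by (intro psubset_card_mono[OF fin]) (auto simp: B_def)
  have "inj (\<lambda>\<alpha>. card (B \<alpha>))"
  proof (rule injI, rule ccontr)
    fix \<alpha> \<beta> assume "card (B \<alpha>) = card (B \<beta>)" "\<alpha> \<noteq> \<beta>"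
    then show False using less[of \<alpha> \<beta>] less[of \<beta> \<alpha>] injD[OF e, of \<alpha> \<beta>] by linarith
  qed
  moreover have "card (B \<alpha>) + 1 \<le> (sz \<alpha> + 1) ^ d" for \<alpha>
  proof -
    have "card (B \<alpha>) < card {\<beta>. sz \<beta> \<le> sz \<alpha>}"
      by (intro psubset_card_mono[OF finite_level]) (auto simp: B_def)
    then show ?thesis using card_level[of "sz \<alpha>"] by simp
  qed
  ultimately show ?thesis using that by blast
qed

lemma enumeration_power_le:
  assumes "\<And>\<alpha>. c \<alpha> + 1 \<le> (sz \<alpha> + 1) ^ d" "\<eta> > 0"
  obtains C where "C > 0" "\<And>\<alpha>. (real (c \<alpha>) + 1) ^ r \<le> C * wt \<eta> \<alpha>"
proof -
  obtain C where C: "C > 0" "\<And>k. (real k + 1) ^ (d * r) \<le> C * fact k powr \<eta>"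
    using Suc_power_le_fact_powr[OF assms(2), where r = "d * r"] by blast
  have "(real (c \<alpha>) + 1) ^ r \<le> C * wt \<eta> \<alpha>" for \<alpha>
  proof -
    have "real (c \<alpha> + 1) \<le> real ((sz \<alpha> + 1) ^ d)" using assms(1) by (intro of_nat_mono)
    then have "(real (c \<alpha>) + 1) ^ r \<le> ((real (sz \<alpha>) + 1) ^ d) ^ r"
      by (intro power_mono) (auto simp: add.commute)
    also have "\<dots> = (real (sz \<alpha>) + 1) ^ (d * r)" by (simp add: power_mult)
    finally show ?thesis using C(2)[of "sz \<alpha>"] by simp
  qed
  then show ?thesis using that C(1) by blast
qed

lemma summable_wt:
  assumes "\<eta> > 0" shows "(\<lambda>\<alpha>. wt (-\<eta>) \<alpha>) summable_on UNIV"
proof -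
  obtain c where c: "inj c" "\<And>\<alpha>. c \<alpha> + 1 \<le> (sz \<alpha> + 1) ^ d" using enumeration by blast
  obtain C where C: "C > 0" "\<And>\<alpha>. (real (c \<alpha>) + 1) ^ 2 \<le> C * wt \<eta> \<alpha>"
    using enumeration_power_le[OF c(2) assms] by blast
  have "summable (\<lambda>k. 1 / (real k + 1) ^ 2)"
    using inverse_power_summable[of 2, where 'a=real] summable_Suc_iff[of "\<lambda>n. inverse (real n ^ 2)"]
    by (simp add: divide_inverse add.commute)
  then have "(\<lambda>k. 1 / (real k + 1) ^ 2) summable_on UNIV"
    by (intro summable_nonneg_imp_summable_on) auto
  then have "(\<lambda>k. 1 / (real k + 1) ^ 2) summable_on range c"
    by (rule summable_on_subset_banach) auto
  then have "(\<lambda>\<alpha>. C * (1 / (real (c \<alpha>) + 1) ^ 2)) summable_on UNIV"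
    using c(1) by (intro summable_on_cmult_right) (simp add: summable_on_reindex comp_def)
  then show ?thesis
  proof (rule summable_on_comparison_test)
    fix \<alpha>
    have p: "0 < (real (c \<alpha>) + 1)\<^sup>2" by (intro zero_less_power) auto
    show "wt (-\<eta>) \<alpha> \<le> C * (1 / (real (c \<alpha>) + 1) ^ 2)"
      using C(2)[of \<alpha>] p by (simp add: powr_minus field_simps)
  qed auto
qed

lemma finite_wt_ge: 
  assumes "\<eta> > 0" "r > 0" shows "finite {\<alpha>. r \<le> wt (-\<eta>) \<alpha>}"
proof -
  obtain C where C: "C > 0" "\<And>k. 2 ^ k \<le> C * fact k powr \<eta>"
    using power_le_fact_powr[OF assms(1), of 2] by blast
  obtain k where k: "C / r < 2 ^ k" using real_arch_pow[of 2 "C / r"] by auto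
  have "sz \<alpha> \<le> k" if "r \<le> wt (-\<eta>) \<alpha>" for \<alpha>
  proof (rule ccontr)
    assume "\<not> sz \<alpha> \<le> k"
    then have "(2::real) ^ k \<le> 2 ^ sz \<alpha>" by (intro power_increasing) auto
    also have "\<dots> \<le> C * wt \<eta> \<alpha>" by (rule C)
    also have "\<dots> \<le> C / r" using that C(1) assms(2) by (simp add: powr_minus field_simps)
    finally show False using k by simp
  qed
  then show ?thesis by (intro finite_subset[OF _ finite_level[of k]]) auto
qed

abbreviation V :: "('i \<Rightarrow> complex) set" where "V \<equiv> {a. subfactorial sz a}"
abbreviation kn :: "real \<Rightarrow> ('i \<Rightarrow> complex) \<Rightarrow> real" where "kn \<equiv> kothe_norm sz"
abbreviation KN :: "(('i \<Rightarrow> complex) \<Rightarrow> real) set" where "KN \<equiv> {kn \<epsilon> | \<epsilon>. 0 < \<epsilon> \<and> \<epsilon> < 1}"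

text \<open>
  Small exponents are the strong ones: the estimate for \<open>\<epsilon>\<close> implies those for all larger exponents.
\<close>

lemma subfactorialI:
  assumes "\<And>\<epsilon>. 0 < \<epsilon> \<Longrightarrow> \<epsilon> < 1 \<Longrightarrow> \<exists>c. \<forall>\<alpha>. norm (a \<alpha>) \<le> c * wt \<epsilon> \<alpha>"
  shows "a \<in> V"
proof -
  have "\<exists>c>0. \<forall>\<alpha>. norm (a \<alpha>) \<le> c * wt \<epsilon> \<alpha>" if e: "\<epsilon> > 0" for \<epsilon>
  proof -
    obtain c where c: "\<And>\<alpha>. norm (a \<alpha>) \<le> c * wt (min \<epsilon> (1/2)) \<alpha>"
      using assms[of "min \<epsilon> (1/2)"] e by (auto simp: min_less_iff_disj)
    have "norm (a \<alpha>) \<le> (\<bar>c\<bar> + 1) * wt \<epsilon> \<alpha>" for \<alpha>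
      using c[of \<alpha>] by (rule order_trans) (intro mult_mono wt_mono, auto)
    then show ?thesis by (intro exI[of _ "\<bar>c\<bar> + 1"]) auto
  qed
  then show ?thesis by (simp add: subfactorial_def)
qed

lemma bdd_above_kn:
  assumes "a \<in> V" "\<epsilon> > 0" shows "bdd_above (range (\<lambda>\<alpha>. norm (a \<alpha>) / wt \<epsilon> \<alpha>))"
proof -
  obtain c where "\<And>\<alpha>. norm (a \<alpha>) \<le> c * wt \<epsilon> \<alpha>"
    using assms unfolding subfactorial_def by blast
  then show ?thesis by (intro bdd_aboveI[of _ c]) (auto simp: divide_simps)
qed

lemma norm_le_kn: "a \<in> V \<Longrightarrow> \<epsilon> > 0 \<Longrightarrow> norm (a \<alpha>) \<le> kn \<epsilon> a * wt \<epsilon> \<alpha>"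
  using cSUP_upper[OF UNIV_I bdd_above_kn, of a \<epsilon> \<alpha>] by (simp add: kothe_norm_def divide_simps)

lemma kn_le: "(\<And>\<alpha>. norm (a \<alpha>) \<le> M * wt \<epsilon> \<alpha>) \<Longrightarrow> kn \<epsilon> a \<le> M"
  unfolding kothe_norm_def by (intro cSUP_least) (auto simp: divide_simps)

lemma kn_nonneg: assumes "a \<in> V" "\<epsilon> > 0" shows "0 \<le> kn \<epsilon> a"
  using norm_le_kn[OF assms, of undefined] by (meson norm_ge_zero order_trans powr_gt_zero zero_le_mult_iff
    fact_nonzero not_less order_less_imp_le)

lemma subspace_V: "module.subspace fam_scale V"
proof -
  interpret vector_space "fam_scale :: complex \<Rightarrow> ('i \<Rightarrow> complex) \<Rightarrow> _" by (rule vector_space_fam_scale)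
  show ?thesis
  proof (rule subspaceI)
    show "0 \<in> V" by (rule subfactorialI) (auto intro!: exI[of _ 0])
  next
    fix a b :: "'i \<Rightarrow> complex" assume ab: "a \<in> V" "b \<in> V"
    show "a + b \<in> V"
    proof (rule subfactorialI)
      fix \<epsilon> :: real assume e: "0 < \<epsilon>" "\<epsilon> < 1"
      have "norm (a \<alpha> + b \<alpha>) \<le> (kn \<epsilon> a + kn \<epsilon> b) * wt \<epsilon> \<alpha>" for \<alpha>
        using norm_triangle_ineq[of "a \<alpha>" "b \<alpha>"] norm_le_kn[OF ab(1) e(1), of \<alpha>]
          norm_le_kn[OF ab(2) e(1), of \<alpha>] by (simp add: algebra_simps)
      then show "\<exists>c. \<forall>\<alpha>. norm ((a + b) \<alpha>) \<le> c * wt \<epsilon> \<alpha>" by auto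
    qed
  next
    fix c and a :: "'i \<Rightarrow> complex" assume a: "a \<in> V"
    show "fam_scale c a \<in> V"
    proof (rule subfactorialI)
      fix \<epsilon> :: real assume e: "0 < \<epsilon>" "\<epsilon> < 1"
      have "norm (c * a \<alpha>) \<le> (norm c * kn \<epsilon> a) * wt \<epsilon> \<alpha>" for \<alpha>
        using mult_left_mono[OF norm_le_kn[OF a e(1), of \<alpha>], of "norm c"] by (simp add: norm_mult algebra_simps)
      then show "\<exists>C. \<forall>\<alpha>. norm (fam_scale c a \<alpha>) \<le> C * wt \<epsilon> \<alpha>" by (auto simp: fam_scale_def)
    qed
  qed
qed

lemma V_add: "a \<in> V \<Longrightarrow> b \<in> V \<Longrightarrow> a + b \<in> V" 
  and V_scale: "a \<in> V \<Longrightarrow> fam_scale c a \<in> V"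
  and V_diff: "a \<in> V \<Longrightarrow> b \<in> V \<Longrightarrow> a - b \<in> V"
proof -
  interpret vector_space "fam_scale :: complex \<Rightarrow> ('i \<Rightarrow> complex) \<Rightarrow> _" by (rule vector_space_fam_scale)
  show "a \<in> V \<Longrightarrow> b \<in> V \<Longrightarrow> a + b \<in> V" "a \<in> V \<Longrightarrow> fam_scale c a \<in> V" "a \<in> V \<Longrightarrow> b \<in> V \<Longrightarrow> a - b \<in> V"
    using subspace_add subspace_scale subspace_diff subspace_V by blast+
qed

lemma seminorm_kn:
  assumes "\<epsilon> > 0" shows "seminorm_on fam_scale V (kn \<epsilon>)"
  unfolding seminorm_on_def
proof (intro conjI ballI allI)
  fix a b assume ab: "a \<in> V" "b \<in> V"
  show "0 \<le> kn \<epsilon> a" using kn_nonneg assms ab by blast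
  show "kn \<epsilon> (a + b) \<le> kn \<epsilon> a + kn \<epsilon> b"
  proof (rule kn_le)
    fix \<alpha>
    show "norm ((a + b) \<alpha>) \<le> (kn \<epsilon> a + kn \<epsilon> b) * wt \<epsilon> \<alpha>"
      using norm_triangle_ineq[of "a \<alpha>" "b \<alpha>"] norm_le_kn[OF ab(1) assms, of \<alpha>]
          norm_le_kn[OF ab(2) assms, of \<alpha>] by (simp add: algebra_simps)
  qed
next
  have le: "kn \<epsilon> (fam_scale c a) \<le> norm c * kn \<epsilon> a" if "a \<in> V" for c a
  proof (rule kn_le)
    fix \<alpha>
    show "norm (fam_scale c a \<alpha>) \<le> norm c * kn \<epsilon> a * wt \<epsilon> \<alpha>"
      using mult_left_mono[OF norm_le_kn[OF that assms, of \<alpha>], of "norm c"]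
      by (simp add: norm_mult algebra_simps fam_scale_def)
  qed
  fix c and a assume a: "a \<in> V"
  show "kn \<epsilon> (fam_scale c a) = norm c * kn \<epsilon> a"
  proof (cases "c = 0")
    case True
    then show ?thesis using le[OF a, of 0] kn_nonneg[OF V_scale[OF a] assms, of 0] by simp
  next
    case False
    have "fam_scale (1/c) (fam_scale c a) = a" using False by (auto simp: fam_scale_def)
    then have "kn \<epsilon> a \<le> kn \<epsilon> (fam_scale c a) / norm c"
      using le[OF V_scale[OF a], of "1/c" c] by (simp add: norm_divide)
    then show ?thesis using le[OF a, of c] False by (intro antisym) (auto simp: field_simps)
  qed
qed

lemma kn_antimono:
  assumes "a \<in> V" "0 < \<epsilon>" "\<epsilon> \<le> \<epsilon>'" shows "kn \<epsilon>' a \<le> kn \<epsilon> a"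
proof (rule kn_le)
  fix \<alpha>
  have "norm (a \<alpha>) \<le> kn \<epsilon> a * wt \<epsilon> \<alpha>" using norm_le_kn assms by blast
  also have "\<dots> \<le> kn \<epsilon> a * wt \<epsilon>' \<alpha>" using kn_nonneg assms by (intro mult_left_mono wt_mono) auto
  finally show "norm (a \<alpha>) \<le> kn \<epsilon> a * wt \<epsilon>' \<alpha>" .
qed

sublocale K: directed_seminorms fam_scale V KN
proof -
  interpret vector_space "fam_scale :: complex \<Rightarrow> ('i \<Rightarrow> complex) \<Rightarrow> _" by (rule vector_space_fam_scale)
  show "directed_seminorms fam_scale V KN"
  proof unfold_locales
    show "subspace V" by (rule subspace_V)
    show "\<And>p. p \<in> KN \<Longrightarrow> seminorm_on fam_scale V p" using seminorm_kn by auto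
    show "KN \<noteq> {}" by (auto intro!: exI[of _ "1/2"])
    fix p q assume "p \<in> KN" "q \<in> KN"
    then obtain \<epsilon> \<epsilon>' where e: "p = kn \<epsilon>" "q = kn \<epsilon>'" "0 < \<epsilon>" "\<epsilon> < 1" "0 < \<epsilon>'" "\<epsilon>' < 1" by auto
    then show "\<exists>r\<in>KN. \<forall>x\<in>V. p x \<le> r x \<and> q x \<le> r x"
      by (intro bexI[of _ "kn (min \<epsilon> \<epsilon>')"]) (auto intro!: kn_antimono)
  qed
qed

lemma kothe_topology_eq: "kothe_topology sz = K.T"
  by (simp add: kothe_topology_def)

lemma topspace_K: "topspace K.T = V"
  by (rule K.topspace_lc)

lemma limitin_kothe_iff:
  "limitin K.T f l F \<longleftrightarrow> l \<in> V \<and>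
     (\<forall>\<epsilon> r. 0 < \<epsilon> \<longrightarrow> \<epsilon> < 1 \<longrightarrow> r > 0 \<longrightarrow> (\<forall>\<^sub>F x in F. f x \<in> V \<and> kn \<epsilon> (f x - l) < r))"
  unfolding K.limitin_lc_iff by blast

lemma continuous_seminorm_kothe:
  assumes "continuous_seminorm fam_scale V K.T p"
  obtains \<epsilon> C where "0 < \<epsilon>" "\<epsilon> < 1" "C \<ge> 0" "\<And>x. x \<in> V \<Longrightarrow> p x \<le> C * kn \<epsilon> x"
  using K.continuous_seminorm_dominated[OF assms] by blast

text \<open>
  A sequence that is Cauchy for a single norm converges coordinatewise, but possibly to a family outside \<open>V\<close>.
  The convergence is therefore stated as a weighted uniform estimate.
\<close>

lemma Cauchy_kn_limit:
  assumes X: "range X \<subseteq> V" and C: "seminorm_Cauchy (kn \<epsilon>) X" and e: "\<epsilon> > 0"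
  obtains Y where "\<And>\<alpha>. (\<lambda>n. X n \<alpha>) \<longlonglongrightarrow> Y \<alpha>"
    and "\<And>r. r > 0 \<Longrightarrow> \<exists>N. \<forall>n\<ge>N. \<forall>\<alpha>. norm (X n \<alpha> - Y \<alpha>) \<le> r * wt \<epsilon> \<alpha>"
proof -
  have XV: "X n \<in> V" for n using X by auto
  have diff: "norm (X m \<alpha> - X n \<alpha>) \<le> kn \<epsilon> (X m - X n) * wt \<epsilon> \<alpha>" for m n \<alpha>
    using norm_le_kn[OF V_diff[OF XV XV] e, of m n \<alpha>] by simp
  have small: "\<exists>N. \<forall>m\<ge>N. \<forall>n\<ge>N. \<forall>\<alpha>. norm (X m \<alpha> - X n \<alpha>) \<le> r * wt \<epsilon> \<alpha>" if "r > 0" for r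
  proof -
    obtain N where N: "\<forall>m\<ge>N. \<forall>n\<ge>N. kn \<epsilon> (X m - X n) < r"
      using C \<open>r > 0\<close> unfolding seminorm_Cauchy_def by blast
    have "norm (X m \<alpha> - X n \<alpha>) \<le> r * wt \<epsilon> \<alpha>" if "m \<ge> N" "n \<ge> N" for m n \<alpha>
      using diff[of m \<alpha> n] N that by (smt (verit) mult_right_mono powr_ge_zero)
    then show ?thesis by blast
  qed
  have "Cauchy (\<lambda>n. X n \<alpha>)" for \<alpha>
  proof (rule metric_CauchyI)
    fix r :: real assume "r > 0"
    then obtain N where "\<forall>m\<ge>N. \<forall>n\<ge>N. \<forall>\<beta>. norm (X m \<beta> - X n \<beta>) \<le> r / 2 / wt \<epsilon> \<alpha> * wt \<epsilon> \<beta>"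
      using small[of "r / 2 / wt \<epsilon> \<alpha>"] by auto
    then have N: "norm (X m \<alpha> - X n \<alpha>) \<le> r / 2" if "m \<ge> N" "n \<ge> N" for m n
      using that by (fastforce dest: spec[of _ \<alpha>])
    have "dist (X m \<alpha>) (X n \<alpha>) < r" if "m \<ge> N" "n \<ge> N" for m n
      using N[OF that] \<open>r > 0\<close> by (simp add: dist_norm)
    then show "\<exists>M. \<forall>m\<ge>M. \<forall>n\<ge>M. dist (X m \<alpha>) (X n \<alpha>) < r" by blast
  qed
  then have "\<exists>y. (\<lambda>n. X n \<alpha>) \<longlonglongrightarrow> y" for \<alpha> using Cauchy_convergent convergent_def by blast
  then obtain Y where Y: "\<And>\<alpha>. (\<lambda>n. X n \<alpha>) \<longlonglongrightarrow> Y \<alpha>" by metis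
  have "\<exists>N. \<forall>n\<ge>N. \<forall>\<alpha>. norm (X n \<alpha> - Y \<alpha>) \<le> r * wt \<epsilon> \<alpha>" if r: "r > 0" for r
  proof -
    obtain N where N: "\<And>m n \<alpha>. m \<ge> N \<Longrightarrow> n \<ge> N \<Longrightarrow> norm (X m \<alpha> - X n \<alpha>) \<le> r * wt \<epsilon> \<alpha>"
      using small[OF r] by blast
    have "norm (X n \<alpha> - Y \<alpha>) \<le> r * wt \<epsilon> \<alpha>" if "n \<ge> N" for n \<alpha>
    proof (rule LIMSEQ_le_const2)
      show "(\<lambda>m. norm (X n \<alpha> - X m \<alpha>)) \<longlonglongrightarrow> norm (X n \<alpha> - Y \<alpha>)"
        by (intro tendsto_intros Y)
      show "\<exists>M. \<forall>m\<ge>M. norm (X n \<alpha> - X m \<alpha>) \<le> r * wt \<epsilon> \<alpha>" using N that by blast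
    qed
    then show ?thesis by blast
  qed
  then show ?thesis using that Y by blast
qed

lemma kothe_topology_countable: "K.T = lc_topology V (range (\<lambda>k. kn (1 / (real k + 2))))"
proof (rule lc_topology_eqI)
  show "seminorm_family fam_scale V KN" by unfold_locales
  show "seminorm_family fam_scale V (range (\<lambda>k. kn (1 / (real k + 2))))"
    by unfold_locales (use subspace_V seminorm_kn in auto)
next
  fix p assume "p \<in> KN"
  then obtain \<epsilon> where e: "p = kn \<epsilon>" "0 < \<epsilon>" by auto
  obtain k where "1 / \<epsilon> < real k" using reals_Archimedean2 by blast
  then have k: "1 / (real k + 2) \<le> \<epsilon>" using e by (simp add: field_simps)
  then show "\<exists>q\<in>range (\<lambda>k. kn (1 / (real k + 2))). \<exists>C. \<forall>x\<in>V. p x \<le> C * q x"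
    using e kn_antimono[of _ "1 / (real k + 2)" \<epsilon>]
    by (intro bexI[of _ "kn (1 / (real k + 2))"] exI[of _ 1]) auto
next
  fix p assume "p \<in> range (\<lambda>k. kn (1 / (real k + 2)))"
  then obtain k where "p = kn (1 / (real k + 2))" by auto
  then show "\<exists>q\<in>KN. \<exists>C. \<forall>x\<in>V. p x \<le> C * q x"
    by (intro bexI[of _ p] exI[of _ 1]) auto
qed

lemma frechet_space_kothe: "frechet_space fam_scale V K.T"
  unfolding frechet_space_def
proof (intro conjI exI[of _ "range (\<lambda>k. kn (1 / (real k + 2)))"] ballI impI allI)
  show "vector_space (fam_scale :: complex \<Rightarrow> ('i \<Rightarrow> complex) \<Rightarrow> _)" by (rule vector_space_fam_scale)
  show "module.subspace fam_scale V" by (rule subspace_V)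
  show "countable (range (\<lambda>k. kn (1 / (real k + 2))))" by simp
  show "\<And>p. p \<in> range (\<lambda>k. kn (1 / (real k + 2))) \<Longrightarrow> seminorm_on fam_scale V p"
    using seminorm_kn by auto
  show "K.T = lc_topology V (range (\<lambda>k. kn (1 / (real k + 2))))" by (rule kothe_topology_countable)
next
  fix x assume x: "x \<in> V" "\<forall>p\<in>range (\<lambda>k. kn (1 / (real k + 2))). p x = 0"
  then have "kn (1/2) x = 0" by (metis add_0 of_nat_0 rangeI)
  then show "x = 0" using norm_le_kn[OF x(1), of "1/2"] by (auto simp: fun_eq_iff)
next
  fix X assume "range X \<subseteq> V \<and> (\<forall>p\<in>range (\<lambda>k. kn (1 / (real k + 2))). seminorm_Cauchy p X)"
  then have X: "range X \<subseteq> V" and Ck: "\<And>k. seminorm_Cauchy (kn (1 / (real k + 2))) X" by auto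
  have XV: "X n \<in> V" for n using X by auto
  have C: "seminorm_Cauchy (kn \<epsilon>) X" if "\<epsilon> > 0" for \<epsilon>
  proof -
    obtain k where "1 / \<epsilon> < real k" using reals_Archimedean2 by blast
    then have k: "1 / (real k + 2) \<le> \<epsilon>" using that by (simp add: field_simps)
    have "kn \<epsilon> (X m - X n) \<le> kn (1 / (real k + 2)) (X m - X n)" for m n
      using k by (intro kn_antimono V_diff XV) auto
    then show ?thesis using Ck[of k] unfolding seminorm_Cauchy_def by (meson le_less_trans)
  qed
  have half: "(1/2 :: real) > 0" by simp
  obtain Y where Y: "\<And>\<alpha>. (\<lambda>n. X n \<alpha>) \<longlonglongrightarrow> Y \<alpha>"
    by (rule Cauchy_kn_limit[OF X C[OF half] half]) (rule that)
  have lim: "\<exists>N. \<forall>n\<ge>N. \<forall>\<alpha>. norm (X n \<alpha> - Y \<alpha>) \<le> r * wt \<epsilon> \<alpha>" if "\<epsilon> > 0" "r > 0" for \<epsilon> r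
  proof -
    obtain Y' where Y': "\<And>\<alpha>. (\<lambda>n. X n \<alpha>) \<longlonglongrightarrow> Y' \<alpha>"
      and l: "\<exists>N. \<forall>n\<ge>N. \<forall>\<alpha>. norm (X n \<alpha> - Y' \<alpha>) \<le> r * wt \<epsilon> \<alpha>"
      using Cauchy_kn_limit[OF X C[OF \<open>\<epsilon> > 0\<close>] \<open>\<epsilon> > 0\<close>] \<open>r > 0\<close> by metis
    have "Y' = Y" using LIMSEQ_unique[OF Y Y'] by auto
    then show ?thesis using l by simp
  qed
  have YV: "Y \<in> V"
  proof (rule subfactorialI)
    fix \<epsilon> :: real assume e: "0 < \<epsilon>" "\<epsilon> < 1"
    obtain N where N: "\<forall>n\<ge>N. \<forall>\<alpha>. norm (X n \<alpha> - Y \<alpha>) \<le> 1 * wt \<epsilon> \<alpha>" using lim[OF e(1), of 1] by auto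
    have "norm (Y \<alpha>) \<le> (1 + kn \<epsilon> (X N)) * wt \<epsilon> \<alpha>" for \<alpha>
    proof -
      have "norm (Y \<alpha>) \<le> norm (X N \<alpha> - Y \<alpha>) + norm (X N \<alpha>)"
        by (metis add.commute norm_minus_commute norm_triangle_sub)
      then show ?thesis using N norm_le_kn[OF XV e(1), of N \<alpha>] by (simp add: algebra_simps) (smt (verit) order_refl)
    qed
    then show "\<exists>c. \<forall>\<alpha>. norm (Y \<alpha>) \<le> c * wt \<epsilon> \<alpha>" by blast
  qed
  have "limitin K.T X Y sequentially" unfolding limitin_kothe_iff
  proof (intro conjI allI impI YV)
    fix \<epsilon> r :: real assume e: "0 < \<epsilon>" "\<epsilon> < 1" "0 < r"
    obtain N where N: "\<And>n \<alpha>. n \<ge> N \<Longrightarrow> norm (X n \<alpha> - Y \<alpha>) \<le> r / 2 * wt \<epsilon> \<alpha>"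
      using lim[OF e(1), of "r/2"] e by auto
    have "kn \<epsilon> (X n - Y) \<le> r / 2" if "n \<ge> N" for n by (rule kn_le) (use N that in auto)
    then show "\<forall>\<^sub>F n in sequentially. X n \<in> V \<and> kn \<epsilon> (X n - Y) < r"
      using XV e(3) unfolding eventually_sequentially by (intro exI[of _ N]) force
  qed
  then show "\<exists>x\<in>V. limitin K.T X x sequentially" using YV by blast
qed

lemma finite_support_in_V: assumes "finite {\<alpha>. a \<alpha> \<noteq> 0}" shows "a \<in> V"
proof (rule subfactorialI)
  fix \<epsilon> :: real assume e: "0 < \<epsilon>" "\<epsilon> < 1"
  let ?c = "\<Sum>\<alpha> | a \<alpha> \<noteq> 0. norm (a \<alpha>)"
  have "norm (a \<alpha>) \<le> ?c * wt \<epsilon> \<alpha>" for \<alpha>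
  proof (cases "a \<alpha> = 0")
    case False
    then have "norm (a \<alpha>) \<le> ?c" using assms by (intro member_le_sum) auto
    also have "\<dots> \<le> ?c * wt \<epsilon> \<alpha>"
      using mult_left_mono[OF wt_ge_1[of \<epsilon> \<alpha>], of ?c] e by (simp add: sum_nonneg)
    finally show ?thesis .
  qed (auto simp: sum_nonneg)
  then show "\<exists>c. \<forall>\<alpha>. norm (a \<alpha>) \<le> c * wt \<epsilon> \<alpha>" by blast
qed

lemma unit_in_V: "unit_family \<alpha> \<in> V"
  by (rule finite_support_in_V) (simp add: unit_family_def)

lemma kn_unit_le: "kn \<epsilon> (unit_family \<alpha>) \<le> wt (-\<epsilon>) \<alpha>"
  by (rule kn_le) (auto simp: unit_family_def simp flip: powr_add)

lemma truncation_in_V: "finite F \<Longrightarrow> (\<lambda>\<beta>. if \<beta> \<in> F then a \<beta> else 0) \<in> V"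
  by (rule finite_support_in_V) (auto intro: finite_subset)

text \<open>
  Estimating the tail by the norm with exponent \<open>\<epsilon>/2\<close> gains the factor \<open>wt (-(\<epsilon>/2))\<close>, which is small outside
  a finite set.
\<close>

lemma truncation_converges:
  assumes a: "a \<in> V" and e: "\<epsilon> > 0" "r > 0"
  shows "\<forall>\<^sub>F F in finite_subsets_at_top UNIV.
    kn \<epsilon> ((\<lambda>\<beta>. if \<beta> \<in> F then a \<beta> else 0) - a) < r"
proof -
  define M where "M = kn (\<epsilon>/2) a"
  have M: "M \<ge> 0" using kn_nonneg a e by (simp add: M_def)
  define t where "t = r / 2 / (M + 1)"
  have t: "t > 0" using M e by (simp add: t_def)
  define F0 where "F0 = {\<alpha>. t \<le> wt (-(\<epsilon>/2)) \<alpha>}"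
  have F0: "finite F0" unfolding F0_def using e t by (intro finite_wt_ge) auto
  have "kn \<epsilon> ((\<lambda>\<beta>. if \<beta> \<in> F then a \<beta> else 0) - a) < r" if F: "F0 \<subseteq> F" for F
  proof -
    have "kn \<epsilon> ((\<lambda>\<beta>. if \<beta> \<in> F then a \<beta> else 0) - a) \<le> r / 2"
    proof (rule kn_le)
      fix \<alpha>
      show "norm (((\<lambda>\<beta>. if \<beta> \<in> F then a \<beta> else 0) - a) \<alpha>) \<le> r / 2 * wt \<epsilon> \<alpha>"
      proof (cases "\<alpha> \<in> F")
        case False
        then have "\<alpha> \<notin> F0" using F by blast
        then have w: "wt (-(\<epsilon>/2)) \<alpha> < t" unfolding F0_def by simp
        have "norm (a \<alpha>) \<le> M * wt (\<epsilon>/2) \<alpha>" using norm_le_kn[OF a, of "\<epsilon>/2"] e by (simp add: M_def)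
        also have "wt (\<epsilon>/2) \<alpha> = wt (-(\<epsilon>/2)) \<alpha> * wt \<epsilon> \<alpha>" by (simp flip: powr_add)
        also have "M * \<dots> \<le> (M + 1) * (t * wt \<epsilon> \<alpha>)"
          using w M t by (intro mult_mono) auto
        also have "\<dots> = (M + 1) * t * wt \<epsilon> \<alpha>" by simp
        also have "(M + 1) * t = r / 2" using M by (simp add: t_def field_simps)
        finally show ?thesis using False by simp
      qed (use e in auto)
    qed
    then show ?thesis using e by simp
  qed
  then show ?thesis unfolding eventually_finite_subsets_at_top using F0 by blast
qed

lemma expansion_converges:
  assumes a: "a \<in> V"
  shows "limitin K.T (\<lambda>F. \<Sum>\<alpha>\<in>F. fam_scale (a \<alpha>) (unit_family \<alpha>)) a (finite_subsets_at_top UNIV)"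
  unfolding limitin_kothe_iff
proof (intro conjI allI impI a)
  fix \<epsilon> r :: real assume "0 < \<epsilon>" "\<epsilon> < 1" "0 < r"
  then have "\<forall>\<^sub>F F in finite_subsets_at_top UNIV. kn \<epsilon> ((\<lambda>\<beta>. if \<beta> \<in> F then a \<beta> else 0) - a) < r"
    using truncation_converges[OF a] by blast
  then show "\<forall>\<^sub>F F in finite_subsets_at_top UNIV. (\<Sum>\<alpha>\<in>F. fam_scale (a \<alpha>) (unit_family \<alpha>)) \<in> V \<and>
        kn \<epsilon> ((\<Sum>\<alpha>\<in>F. fam_scale (a \<alpha>) (unit_family \<alpha>)) - a) < r"
    unfolding eventually_finite_subsets_at_top
  proof (elim ex_forward, intro conjI allI impI)
    fix X Y :: "'i set"
    assume X: "finite X \<and> X \<subseteq> UNIV \<and> (\<forall>Y. finite Y \<and> X \<subseteq> Y \<and> Y \<subseteq> UNIV \<longrightarrow>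
      kn \<epsilon> ((\<lambda>\<beta>. if \<beta> \<in> Y then a \<beta> else 0) - a) < r)"
    then show "finite X" "X \<subseteq> UNIV" by auto
    assume Y: "finite Y \<and> X \<subseteq> Y \<and> Y \<subseteq> UNIV"
    then have *: "(\<Sum>\<alpha>\<in>Y. fam_scale (a \<alpha>) (unit_family \<alpha>)) = (\<lambda>\<beta>. if \<beta> \<in> Y then a \<beta> else 0)"
      by (simp only: unit_family_expansion)
    show "(\<Sum>\<alpha>\<in>Y. fam_scale (a \<alpha>) (unit_family \<alpha>)) \<in> V"
      unfolding * using Y truncation_in_V by blast
    show "kn \<epsilon> ((\<Sum>\<alpha>\<in>Y. fam_scale (a \<alpha>) (unit_family \<alpha>)) - a) < r"
      unfolding * using X Y by blast
  qed
qed

lemma limitin_coordinate: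
  assumes "limitin K.T f l F" shows "((\<lambda>x. f x \<alpha>) \<longlongrightarrow> l \<alpha>) F"
proof (rule tendstoI)
  fix r :: real assume r: "r > 0"
  have l: "l \<in> V" using assms by (simp add: limitin_kothe_iff)
  have "\<forall>\<^sub>F x in F. f x \<in> V \<and> kn (1/2) (f x - l) < r / wt (1/2) \<alpha>"
    using assms r unfolding limitin_kothe_iff by simp
  then show "\<forall>\<^sub>F x in F. dist (f x \<alpha>) (l \<alpha>) < r"
  proof eventually_elim
    case (elim x)
    have "norm (f x \<alpha> - l \<alpha>) \<le> kn (1/2) (f x - l) * wt (1/2) \<alpha>"
      using norm_le_kn[of "f x - l" "1/2" \<alpha>] V_diff elim l by simp
    also have "\<dots> < r" using elim by (simp add: field_simps)
    finally show ?case by (simp add: dist_norm)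
  qed
qed

lemma basis_expansion_iff:
  assumes a: "a \<in> V"
  shows "basis_expansion fam_scale K.T unit_family c a \<longleftrightarrow> c = a"
proof
  assume "basis_expansion fam_scale K.T unit_family c a"
  then have l: "limitin K.T (\<lambda>F. \<Sum>\<alpha>\<in>F. fam_scale (c \<alpha>) (unit_family \<alpha>)) a (finite_subsets_at_top UNIV)"
    by (simp add: basis_expansion_def)
  have "c \<beta> = a \<beta>" for \<beta>
  proof (rule tendsto_unique[OF _ _ limitin_coordinate[OF l, of \<beta>]])
    have "\<forall>\<^sub>F F in finite_subsets_at_top UNIV. (\<Sum>\<alpha>\<in>F. fam_scale (c \<alpha>) (unit_family \<alpha>)) \<beta> = c \<beta>"
      unfolding eventually_finite_subsets_at_top
      by (intro exI[of _ "{\<beta>}"]) (auto simp: unit_family_expansion)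
    then show "((\<lambda>F. (\<Sum>\<alpha>\<in>F. fam_scale (c \<alpha>) (unit_family \<alpha>)) \<beta>) \<longlongrightarrow> c \<beta>) (finite_subsets_at_top UNIV)"
      by (rule tendsto_eventually)
  qed simp
  then show "c = a" by auto
next
  assume "c = a"
  then show "basis_expansion fam_scale K.T unit_family c a"
    using expansion_converges[OF a] by (simp add: basis_expansion_def)
qed

lemma basis_coeff_eq: "a \<in> V \<Longrightarrow> basis_coeff fam_scale K.T unit_family a = a"
  unfolding basis_coeff_def by (simp add: basis_expansion_iff)

lemma continuous_coordinate: "continuous_map K.T euclidean (\<lambda>a. a \<alpha>)"
proof -
  have "openin K.T {a \<in> V. a \<alpha> \<in> U}" if U: "open U" for U :: "complex set"
  proof (rule K.openin_lcI)
    fix a assume a: "a \<in> {a \<in> V. a \<alpha> \<in> U}"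
    then obtain r where r: "r > 0" "ball (a \<alpha>) r \<subseteq> U" using U open_contains_ball by blast
    have "b \<alpha> \<in> U" if b: "b \<in> V" "kn (1/2) (b - a) < r / wt (1/2) \<alpha>" for b
    proof -
      have "norm (b \<alpha> - a \<alpha>) \<le> kn (1/2) (b - a) * wt (1/2) \<alpha>"
        using norm_le_kn[of "b - a" "1/2" \<alpha>] V_diff a b by simp
      also have "\<dots> < r" using b by (simp add: field_simps)
      finally show ?thesis using r by (auto simp: dist_norm norm_minus_commute subset_iff)
    qed
    then have "{b\<in>V. kn (1/2) (b - a) < r / wt (1/2) \<alpha>} \<subseteq> {a \<in> V. a \<alpha> \<in> U}" by blast
    moreover have "r / wt (1/2) \<alpha> > 0" using r by simp
    moreover have "kn (1/2) \<in> KN" by (auto intro!: exI[of _ "1/2"])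
    ultimately show "\<exists>p\<in>KN. \<exists>r>0. {y \<in> V. p (y - a) < r} \<subseteq> {a \<in> V. a \<alpha> \<in> U}" by blast
  qed auto
  then show ?thesis unfolding continuous_map_def topspace_K by auto
qed

lemma schauder_basis_kothe: "schauder_basis fam_scale V K.T unit_family"
  unfolding schauder_basis_def
proof (intro conjI ballI allI)
  show "range unit_family \<subseteq> V" using unit_in_V by blast
  show "\<And>a. a \<in> V \<Longrightarrow> \<exists>!c. basis_expansion fam_scale K.T unit_family c a"
    by (simp add: basis_expansion_iff)
  fix \<alpha>
  show "continuous_map K.T euclidean (\<lambda>a. basis_coeff fam_scale K.T unit_family a \<alpha>)"
    by (rule continuous_map_eq[OF continuous_coordinate[of \<alpha>]]) (auto simp: topspace_K basis_coeff_eq)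
qed

lemma absolute_schauder_basis_kothe: "absolute_schauder_basis fam_scale V K.T unit_family"
  unfolding absolute_schauder_basis_def
proof (intro conjI allI impI schauder_basis_kothe)
  fix p assume p: "continuous_seminorm fam_scale V K.T p"
  obtain \<epsilon> C where e: "0 < \<epsilon>" "\<epsilon> < 1" "C \<ge> 0" and dom: "\<And>x. x \<in> V \<Longrightarrow> p x \<le> C * kn \<epsilon> x"
    using continuous_seminorm_kothe[OF p] by metis
  define S where "S = (\<Sum>\<^sub>\<infinity>\<alpha>. wt (-(\<epsilon>/2)) \<alpha>)"
  have sum: "(\<lambda>\<alpha>. wt (-(\<epsilon>/2)) \<alpha>) summable_on UNIV" using e by (intro summable_wt) auto
  have S: "S \<ge> 0" unfolding S_def by (intro infsum_nonneg) auto
  \<comment> \<open>\<open>|a\<^sub>\<alpha>| p(e\<^sub>\<alpha>)\<close> is at most \<open>kn (\<epsilon>/2) a * wt (\<epsilon>/2) \<alpha>\<close> times \<open>C * wt (-\<epsilon>) \<alpha>\<close>, and \<open>S\<close> sums the weights that remain.\<close>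
  define q where "q a = (C * S) * kn (\<epsilon>/2) a" for a
  have q_sn: "seminorm_on fam_scale V q"
    using seminorm_kn[of "\<epsilon>/2"] e S unfolding seminorm_on_def q_def
    by (auto intro!: mult_nonneg_nonneg mult_left_mono simp flip: distrib_left)
  have q: "continuous_seminorm fam_scale V K.T q"
    by (rule K.continuous_seminorm_if_dominated[OF q_sn, of "kn (\<epsilon>/2)" "C * S"])
      (use e in \<open>auto simp: q_def intro!: exI[of _ "\<epsilon>/2"]\<close>)
  have "(\<Sum>\<^sub>\<infinity>\<alpha>. ennreal (norm (basis_coeff fam_scale K.T unit_family a \<alpha>) * p (unit_family \<alpha>))) \<le> ennreal (q a)"
    if a: "a \<in> V" for a
  proof -
    have le: "norm (a \<alpha>) * p (unit_family \<alpha>) \<le> C * kn (\<epsilon>/2) a * wt (-(\<epsilon>/2)) \<alpha>" for \<alpha>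
    proof -
      have "p (unit_family \<alpha>) \<le> C * wt (-\<epsilon>) \<alpha>"
        using dom[OF unit_in_V, of \<alpha>] mult_left_mono[OF kn_unit_le e(3), of \<epsilon> \<alpha>] by linarith
      then have "norm (a \<alpha>) * p (unit_family \<alpha>) \<le> (kn (\<epsilon>/2) a * wt (\<epsilon>/2) \<alpha>) * (C * wt (-\<epsilon>) \<alpha>)"
        using norm_le_kn[OF a, of "\<epsilon>/2" \<alpha>] e kn_nonneg[OF a, of "\<epsilon>/2"] p
          K.seminorm_ge0[OF _ unit_in_V]
        by (intro mult_mono) (auto simp: continuous_seminorm_def)
      also have "\<dots> = C * kn (\<epsilon>/2) a * (wt (\<epsilon>/2) \<alpha> * wt (-\<epsilon>) \<alpha>)" by (simp add: algebra_simps)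
      also have "wt (\<epsilon>/2) \<alpha> * wt (-\<epsilon>) \<alpha> = wt (-(\<epsilon>/2)) \<alpha>" by (simp flip: powr_add)
      finally show ?thesis .
    qed
    have "(\<Sum>\<^sub>\<infinity>\<alpha>. ennreal (norm (a \<alpha>) * p (unit_family \<alpha>))) \<le>
        (\<Sum>\<^sub>\<infinity>\<alpha>. ennreal (C * kn (\<epsilon>/2) a * wt (-(\<epsilon>/2)) \<alpha>))"
      by (intro infsum_mono nonneg_summable_on_complete) (auto intro: le ennreal_leI)
    also have "\<dots> = ennreal (\<Sum>\<^sub>\<infinity>\<alpha>. C * kn (\<epsilon>/2) a * wt (-(\<epsilon>/2)) \<alpha>)"
      using kn_nonneg[OF a, of "\<epsilon>/2"] e sum
      by (intro infsum_ennreal_eq summable_on_cmult_right) auto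
    also have "\<dots> = ennreal (q a)" by (simp add: infsum_cmult_right' q_def S_def algebra_simps)
    finally show ?thesis using a by (simp add: basis_coeff_eq)
  qed
  then show "\<exists>q. continuous_seminorm fam_scale V K.T q \<and> (\<forall>a\<in>V. (\<Sum>\<^sub>\<infinity>\<alpha>. ennreal
      (norm (basis_coeff fam_scale K.T unit_family a \<alpha>) * p (unit_family \<alpha>))) \<le> ennreal (q a))"
    using q by blast
qed

text \<open>
  Finitely supported families are dense, and a functional that is bounded for a single norm is continuous.
\<close>

lemma functional_zero:
  assumes L: "lin_on fam_scale V (*) L" and e: "\<epsilon> > 0" and dom: "\<And>x. x \<in> V \<Longrightarrow> norm (L x) \<le> C * kn \<epsilon> x"
    and unit: "\<And>\<alpha>. L (unit_family \<alpha>) = 0" and a: "a \<in> V"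
  shows "L a = 0"
proof -
  have add: "L (x + y) = L x + L y" and scale: "L (fam_scale c x) = c * L x"
    if "x \<in> V" "y \<in> V" for x y c using L that by (auto simp: lin_on_def)
  have fin: "L (\<Sum>\<alpha>\<in>F. fam_scale (a \<alpha>) (unit_family \<alpha>)) = 0" if "finite F" for F
    using that
  proof induction
    case empty
    have "L (fam_scale 0 0) = 0" using scale[of 0 0 0] K.V_zero by auto
    then show ?case by (simp add: fam_scale_def zero_fun_def)
  next
    case (insert x F)
    have "(\<Sum>\<alpha>\<in>F. fam_scale (a \<alpha>) (unit_family \<alpha>)) \<in> V" by (intro K.V_sum V_scale unit_in_V)
    then show ?case using add[OF V_scale[OF unit_in_V]] scale[OF unit_in_V unit_in_V] unit
        insert(3) by (simp only: sum.insert[OF insert(1,2)] add_0 mult_zero_right)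
  qed
  have "norm (L a) \<le> \<bar>C\<bar> * r" if r: "r > 0" for r
  proof -
    obtain F where F: "finite F" "kn \<epsilon> ((\<lambda>\<beta>. if \<beta> \<in> F then a \<beta> else 0) - a) < r"
      using truncation_converges[OF a e r] unfolding eventually_finite_subsets_at_top by blast
    let ?t = "\<lambda>\<beta>. if \<beta> \<in> F then a \<beta> else 0"
    have tV: "?t \<in> V" using truncation_in_V[OF F(1)] .
    have "?t = (?t - a) + a" by simp
    then have "L (?t - a) = - L a"
      using add[OF V_diff[OF tV a] a] fin[OF F(1)] unit_family_expansion[OF F(1), of a]
      by (simp add: eq_neg_iff_add_eq_0 del: fun_diff_def)
    then have "norm (L a) \<le> C * kn \<epsilon> (?t - a)" using dom[OF V_diff[OF tV a]] by simp
    also have "\<dots> \<le> \<bar>C\<bar> * r" using F(2) kn_nonneg[OF V_diff[OF tV a] e]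
      by (intro mult_mono) auto
    finally show ?thesis .
  qed
  then have bound: "norm (L a) \<le> \<bar>C\<bar> * r" if "r > 0" for r using that by blast
  have "norm (L a) \<le> 0 + t" if "t > 0" for t
  proof -
    have "norm (L a) \<le> \<bar>C\<bar> * (t / (\<bar>C\<bar> + 1))" using that by (intro bound) auto
    also have "\<dots> \<le> t" using that by (simp add: field_simps)
    finally show ?thesis by simp
  qed
  then have "norm (L a) \<le> 0" by (rule field_le_epsilon)
  then show ?thesis by simp
qed


text \<open>
  If \<open>p\<close> is bounded by the norm with exponent \<open>\<epsilon> = 2 \<delta>\<close>, let \<open>q\<close> be a multiple of the norm with exponent \<open>\<delta>\<close>. The
  expansion \<open>x = \<Sum>\<alpha>. x\<^sub>\<alpha> e\<^sub>\<alpha>\<close> is then diagonal: the term is the product of the eigenvalue \<open>wt (-\<delta>) \<alpha>\<close>, the functional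
  \<open>x\<^sub>\<alpha> * wt (-\<delta>) \<alpha>\<close>, which is bounded for \<open>q\<close>, and the vector \<open>wt \<epsilon> \<alpha> * e\<^sub>\<alpha>\<close>, which is bounded for \<open>p\<close>. Along the
  enumeration \<open>c\<close> of the indices by size the eigenvalues decrease rapidly, because \<open>c \<alpha>\<close> is bounded by a polynomial in
  the size. Elements of the Banach space of \<open>q\<close> are Cauchy sequences of families, whose coordinates converge.
\<close>

lemma strongly_nuclear_kothe: "strongly_nuclear fam_scale V K.T"
  unfolding strongly_nuclear_def
proof (intro allI impI)
  fix p assume p: "continuous_seminorm fam_scale V K.T p"
  then have p_sn: "seminorm_on fam_scale V p" by (simp add: continuous_seminorm_def)
  obtain \<epsilon> C where e: "0 < \<epsilon>" "\<epsilon> < 1" "C \<ge> 0" and dom: "\<And>x. x \<in> V \<Longrightarrow> p x \<le> C * kn \<epsilon> x"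
    using continuous_seminorm_kothe[OF p] by metis
  define \<delta> where "\<delta> = \<epsilon> / 2"
  have d: "0 < \<delta>" "\<delta> < 1" "\<delta> < \<epsilon>" "\<delta> + \<delta> = \<epsilon>" using e by (auto simp: \<delta>_def)
  obtain c where c: "inj c" "\<And>\<alpha>. c \<alpha> + 1 \<le> (sz \<alpha> + 1) ^ d" using enumeration by blast
  have inv_c: "inv c (c \<alpha>) = \<alpha>" for \<alpha> using c(1) by simp

  define q where "q x = (C + 1) * kn \<delta> x" for x
  have q_sn: "seminorm_on fam_scale V q"
    using seminorm_kn[OF d(1)] e unfolding seminorm_on_def q_def
    by (auto intro!: mult_nonneg_nonneg mult_left_mono simp flip: distrib_left)
  have q: "continuous_seminorm fam_scale V K.T q"
    by (rule K.continuous_seminorm_if_dominated[OF q_sn, of "kn \<delta>" "C + 1"])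
      (use d in \<open>auto simp: q_def\<close>)
  have pq: "p x \<le> q x" if x: "x \<in> V" for x
  proof -
    have "p x \<le> C * kn \<delta> x"
      using dom[OF x] mult_left_mono[OF kn_antimono[OF x d(1), of \<epsilon>] e(3)] d by linarith
    then show ?thesis using kn_nonneg[OF x d(1)] by (simp add: q_def algebra_simps)
  qed
  have kn_q: "kn \<delta> x \<le> q x" if x: "x \<in> V" for x
    using kn_nonneg[OF x d(1)] e by (simp add: q_def algebra_simps)

  \<comment> \<open>The enumeration may skip numbers; these contribute terms with eigenvalue zero.\<close>
  define lam :: "nat \<Rightarrow> complex" where
    "lam k = (if k \<in> range c then of_real (wt (-\<delta>) (inv c k)) else 0)" for k
  define \<phi> :: "nat \<Rightarrow> (nat \<Rightarrow> 'i \<Rightarrow> complex) \<Rightarrow> complex" where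
    "\<phi> k x = (if k \<in> range c then lim (\<lambda>j. x j (inv c k)) / of_real (wt \<delta> (inv c k)) else 0)" for k x
  define y :: "nat \<Rightarrow> nat \<Rightarrow> 'i \<Rightarrow> complex" where
    "y k j = fam_scale (of_real (wt \<epsilon> (inv c k))) (unit_family (inv c k))" for k j

  have CauchyD: "range x \<subseteq> V" "seminorm_Cauchy (kn \<delta>) x" "seminorm_Cauchy q x"
    if "x \<in> assoc_banach V q" for x
  proof -
    show x: "range x \<subseteq> V" "seminorm_Cauchy q x" using that by (auto simp: assoc_banach_def)
    have "kn \<delta> (x m - x n) \<le> q (x m - x n)" for m n using x(1) by (intro kn_q V_diff) auto
    then show "seminorm_Cauchy (kn \<delta>) x"
      using x(2) unfolding seminorm_Cauchy_def by (meson le_less_trans)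
  qed
  have conv: "(\<lambda>j. x j \<alpha>) \<longlonglongrightarrow> lim (\<lambda>j. x j \<alpha>)" if "x \<in> assoc_banach V q" for x \<alpha>
    by (rule Cauchy_kn_limit[OF CauchyD(1,2)[OF that] d(1)]) (metis limI)
  have convergent_sn: "convergent (\<lambda>j. r (x j))"
    if "seminorm_on fam_scale V r" "range x \<subseteq> V" "seminorm_Cauchy r x" for r and x :: "nat \<Rightarrow> 'i \<Rightarrow> complex"
  proof -
    note sn = that
    have "Cauchy (\<lambda>j. r (x j))" unfolding Cauchy_def dist_real_def
    proof (intro allI impI)
      fix t :: real assume "t > 0"
      then obtain M where "\<forall>m\<ge>M. \<forall>n\<ge>M. r (x m - x n) < t"
        using sn(3) unfolding seminorm_Cauchy_def by blast
      moreover have "\<bar>r (x m) - r (x n)\<bar> \<le> r (x m - x n)" for m n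
        using sn by (intro K.seminorm_reverse_triangle) auto
      ultimately show "\<exists>M. \<forall>m\<ge>M. \<forall>n\<ge>M. \<bar>r (x m) - r (x n)\<bar> < t" by (meson le_less_trans)
    qed
    then show ?thesis by (simp add: Cauchy_convergent)
  qed
  have conv_q: "(\<lambda>j. q (x j)) \<longlonglongrightarrow> assoc_norm q x" if "x \<in> assoc_banach V q" for x
    using convergent_sn[OF q_sn CauchyD(1,3)[OF that]] unfolding assoc_norm_def
    by (simp add: convergent_LIMSEQ_iff)
  have coord_le: "norm (lim (\<lambda>j. x j \<alpha>)) \<le> assoc_norm q x * wt \<delta> \<alpha>" if x: "x \<in> assoc_banach V q" for x \<alpha>
  proof (rule LIMSEQ_le)
    show "(\<lambda>j. norm (x j \<alpha>)) \<longlonglongrightarrow> norm (lim (\<lambda>j. x j \<alpha>))" by (intro tendsto_norm conv x)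
    show "(\<lambda>j. q (x j) * wt \<delta> \<alpha>) \<longlonglongrightarrow> assoc_norm q x * wt \<delta> \<alpha>" by (intro tendsto_intros conv_q x)
    have "norm (x j \<alpha>) \<le> q (x j) * wt \<delta> \<alpha>" for j
    proof -
      have "x j \<in> V" using CauchyD(1)[OF x] by auto
      from norm_le_kn[OF this d(1)] mult_right_mono[OF kn_q[OF this], of "wt \<delta> \<alpha>"]
      show ?thesis by (rule order_trans) simp
    qed
    then show "\<exists>N. \<forall>n\<ge>N. norm (x n \<alpha>) \<le> q (x n) * wt \<delta> \<alpha>" by blast
  qed

  have rapid: "rapidly_decreasing lam"
    unfolding rapidly_decreasing_def
  proof
    fix r :: nat
    obtain D where D: "D > 0" "\<And>\<alpha>. (real (c \<alpha>) + 1) ^ r \<le> D * wt \<delta> \<alpha>"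
      using enumeration_power_le[OF c(2) d(1)] by blast
    have "norm (of_nat (k + 1) ^ r * lam k) \<le> D" for k
    proof (cases "k \<in> range c")
      case True
      then obtain \<alpha> where k: "k = c \<alpha>" by blast
      have "norm (of_nat (k + 1) ^ r * lam k) = (real (c \<alpha>) + 1) ^ r * wt (-\<delta>) \<alpha>"
        using norm_of_nat[of "k + 1", where 'a=complex] by (simp add: k lam_def inv_c norm_mult norm_power add.commute)
      also have "\<dots> \<le> D * wt \<delta> \<alpha> * wt (-\<delta>) \<alpha>" using D by (intro mult_right_mono) auto
      also have "\<dots> = D" by (simp add: mult.assoc flip: powr_add)
      finally show ?thesis .
    qed (use D in \<open>auto simp: lam_def\<close>)
    then show "Bseq (\<lambda>k. of_nat (k + 1) ^ r * lam k)" by (rule BseqI')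
  qed

  have phi_lin: "lin_on (seq_scale fam_scale) (assoc_banach V q) (*) (\<phi> k)" for k
    unfolding lin_on_def
  proof (intro conjI ballI allI)
    fix x x' assume x: "x \<in> assoc_banach V q" "x' \<in> assoc_banach V q"
    have "lim (\<lambda>j. (x + x') j \<alpha>) = lim (\<lambda>j. x j \<alpha>) + lim (\<lambda>j. x' j \<alpha>)" for \<alpha>
      using tendsto_add[OF conv[OF x(1)] conv[OF x(2)]] by (intro limI) simp
    then show "\<phi> k (x + x') = \<phi> k x + \<phi> k x'" by (simp add: \<phi>_def add_divide_distrib)
    fix b
    have "lim (\<lambda>j. seq_scale fam_scale b x j \<alpha>) = b * lim (\<lambda>j. x j \<alpha>)" for \<alpha>
      using tendsto_mult_left[OF conv[OF x(1)], of b] by (intro limI) (simp add: seq_scale_def fam_scale_def)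
    then show "\<phi> k (seq_scale fam_scale b x) = b * \<phi> k x" by (simp add: \<phi>_def)
  qed
  have norm_q_nonneg: "0 \<le> assoc_norm q x" if x: "x \<in> assoc_banach V q" for x
    by (rule LIMSEQ_le_const[OF conv_q[OF x]])
      (use CauchyD(1)[OF x] K.seminorm_ge0[OF q_sn] in \<open>auto simp: image_subset_iff\<close>)
  have phi_bound: "norm (\<phi> k x) \<le> 1 * assoc_norm q x" if x: "x \<in> assoc_banach V q" for k x
    using coord_le[OF x, of "inv c k"] norm_q_nonneg[OF x]
    by (simp add: \<phi>_def norm_divide divide_simps)

  have y_in: "y k j \<in> V" for k j unfolding y_def by (intro V_scale unit_in_V)
  have y_banach: "y k \<in> assoc_banach V p" for k
    using y_in K.seminorm_zero[OF p_sn] unfolding assoc_banach_def seminorm_Cauchy_def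
    by (auto simp: y_def)
  have y_bound: "assoc_norm p (y k) \<le> C" for k
  proof -
    have "kn \<epsilon> (y k 0) \<le> 1" by (rule kn_le) (auto simp: y_def fam_scale_def unit_family_def)
    then have "p (y k 0) \<le> C" using dom[OF y_in, of k 0] mult_left_mono[of _ 1 C] e(3) by fastforce
    moreover have "assoc_norm p (y k) = p (y k 0)" unfolding assoc_norm_def by (simp add: y_def)
    ultimately show ?thesis by simp
  qed

  have expand: "(\<lambda>K. assoc_norm p (x - (\<Sum>k<K. seq_scale fam_scale (lam k * \<phi> k x) (y k)))) \<longlonglongrightarrow> 0"
    if x: "x \<in> assoc_banach V q" for x
  proof -
    have xV: "x j \<in> V" for j using CauchyD(1)[OF x] by auto
    obtain Y where Y: "\<And>\<alpha>. (\<lambda>n. x n \<alpha>) \<longlonglongrightarrow> Y \<alpha>"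
      and unif: "\<And>r. r > 0 \<Longrightarrow> \<exists>N. \<forall>n\<ge>N. \<forall>\<alpha>. norm (x n \<alpha> - Y \<alpha>) \<le> r * wt \<delta> \<alpha>"
      using Cauchy_kn_limit[OF CauchyD(1,2)[OF x] d(1)] by blast
    have limY: "lim (\<lambda>j. x j \<alpha>) = Y \<alpha>" for \<alpha> using Y by (rule limI)
    define s where "s K = (\<lambda>\<alpha>. if c \<alpha> < K then Y \<alpha> else 0)" for K
    have sum_eq: "(\<Sum>k<K. seq_scale fam_scale (lam k * \<phi> k x) (y k)) j = s K" for K j
    proof -
      have "(\<Sum>k<K. seq_scale fam_scale (lam k * \<phi> k x) (y k)) j =
          (\<Sum>k<K. seq_scale fam_scale (lam k * \<phi> k x) (y k) j)"
        by (induction K) auto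
      also have "\<dots> = s K"
      proof
        fix \<beta>
        have "(\<Sum>k<K. seq_scale fam_scale (lam k * \<phi> k x) (y k) j) \<beta> =
            (\<Sum>k<K. seq_scale fam_scale (lam k * \<phi> k x) (y k) j \<beta>)"
          by (induction K) auto
        also have "\<dots> = (\<Sum>k<K. if k = c \<beta> then Y \<beta> else 0)"
        proof (intro sum.cong refl)
          fix k
          show "seq_scale fam_scale (lam k * \<phi> k x) (y k) j \<beta> = (if k = c \<beta> then Y \<beta> else 0)"
          proof (cases "k \<in> range c")
            case True
            then obtain \<alpha> where k: "k = c \<alpha>" by blast
            have "wt (-\<delta>) \<alpha> / wt \<delta> \<alpha> * wt \<epsilon> \<alpha> = 1"
              using powr_add[of "fact (sz \<alpha>) :: real" \<delta> \<delta>]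
              unfolding d(4) by (simp add: powr_minus field_simps)
            then have "complex_of_real (wt (-\<delta>) \<alpha>) / of_real (wt \<delta> \<alpha>) * of_real (wt \<epsilon> \<alpha>) = 1"
              by (simp flip: of_real_divide of_real_mult)
            then have "of_real (wt (-\<delta>) \<alpha>) * (Y \<alpha> / of_real (wt \<delta> \<alpha>)) * of_real (wt \<epsilon> \<alpha>) = Y \<alpha>"
              by (metis (no_types, opaque_lifting) mult.commute mult.left_commute mult.right_neutral times_divide_eq_right)
            then show ?thesis using injD[OF c(1), of \<alpha> \<beta>]
              by (auto simp: k seq_scale_def fam_scale_def lam_def \<phi>_def y_def inv_c limY unit_family_def mult.assoc)
          qed (auto simp: seq_scale_def fam_scale_def lam_def)
        qed
        also have "\<dots> = s K \<beta>" by (simp add: s_def)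
        finally show "(\<Sum>k<K. seq_scale fam_scale (lam k * \<phi> k x) (y k) j) \<beta> = s K \<beta>" .
      qed
      finally show ?thesis .
    qed
    have sV: "s K \<in> V" for K
    proof -
      have "(\<Sum>k<K. seq_scale fam_scale (lam k * \<phi> k x) (y k)) 0 = (\<Sum>k<K. seq_scale fam_scale (lam k * \<phi> k x) (y k) 0)"
        by (induction K) auto
      also have "\<dots> \<in> V" unfolding seq_scale_def by (intro K.V_sum V_scale y_in)
      finally show ?thesis by (simp only: sum_eq)
    qed
    obtain M where M: "M > 0" "\<And>j. norm (q (x j)) \<le> M"
      using convergent_imp_Bseq[OF convergentI[OF conv_q[OF x]]] unfolding Bseq_def by blast
    show ?thesis
    proof (rule LIMSEQ_I)
      fix r :: real assume r: "r > 0"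
      \<comment> \<open>Indices enumerated before \<open>K\<close> contribute the distance of \<open>x j\<close> to its limit, all others the tail of \<open>x j\<close>; both are at most \<open>t\<close>.\<close>
      define t where "t = r / 2 / (C + 1)"
      have t: "t > 0" using r e by (simp add: t_def)
      have "finite {\<alpha>. t / M \<le> wt (-\<delta>) \<alpha>}" using t M d by (intro finite_wt_ge) auto
      then have "finite (c ` {\<alpha>. t / M \<le> wt (-\<delta>) \<alpha>})" by simp
      then obtain K0 where K0: "\<And>\<alpha>. t / M \<le> wt (-\<delta>) \<alpha> \<Longrightarrow> c \<alpha> < K0"
        unfolding finite_nat_set_iff_bounded by blast
      obtain N where N: "\<And>n \<alpha>. n \<ge> N \<Longrightarrow> norm (x n \<alpha> - Y \<alpha>) \<le> t * wt \<delta> \<alpha>"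
        using unif[OF t] by blast
      have main: "p (x j - s K) \<le> r / 2" if K: "K \<ge> K0" and j: "j \<ge> N" for K j
      proof -
        have "kn \<epsilon> (x j - s K) \<le> t"
        proof (rule kn_le)
          fix \<alpha>
          show "norm ((x j - s K) \<alpha>) \<le> t * wt \<epsilon> \<alpha>"
          proof (cases "c \<alpha> < K")
            case True
            then have "norm ((x j - s K) \<alpha>) \<le> t * wt \<delta> \<alpha>" using N[OF j] by (simp add: s_def)
            also have "\<dots> \<le> t * wt \<epsilon> \<alpha>" using t d by (intro mult_left_mono wt_mono) auto
            finally show ?thesis .
          next
            case False
            then have w: "wt (-\<delta>) \<alpha> \<le> t / M" using K0[of \<alpha>] K by linarith
            have "norm ((x j - s K) \<alpha>) = norm (x j \<alpha>)" using False by (simp add: s_def)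
            also have "\<dots> \<le> kn \<delta> (x j) * wt \<delta> \<alpha>" using norm_le_kn[OF xV d(1)] .
            also have "\<dots> \<le> M * wt \<delta> \<alpha>" using kn_q[OF xV, of j] M(2)[of j] by (intro mult_right_mono) auto
            also have "\<delta> = -\<delta> + \<epsilon>" using d(4) by linarith
            also have "wt (-\<delta> + \<epsilon>) \<alpha> = wt (-\<delta>) \<alpha> * wt \<epsilon> \<alpha>" by (rule powr_add)
            also have "M * \<dots> \<le> M * (t / M * wt \<epsilon> \<alpha>)" using w M by (intro mult_left_mono mult_right_mono) auto
            also have "\<dots> = t * wt \<epsilon> \<alpha>" using M by simp
            finally show ?thesis .
          qed
        qed
        then have "p (x j - s K) \<le> C * t"
          using dom[OF V_diff[OF xV sV], of j K] mult_left_mono[OF _ e(3)] by (meson order_trans)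
        also have "\<dots> \<le> (C + 1) * t" using t by (simp add: algebra_simps)
        also have "\<dots> = r / 2" using e(3) by (simp add: t_def field_simps)
        finally show ?thesis .
      qed
      have "norm (assoc_norm p (x - (\<Sum>k<K. seq_scale fam_scale (lam k * \<phi> k x) (y k))) - 0) < r"
        if K: "K \<ge> K0" for K
      proof -
        have eq: "(x - (\<Sum>k<K. seq_scale fam_scale (lam k * \<phi> k x) (y k))) = (\<lambda>j. x j - s K)"
          by (simp add: fun_eq_iff sum_eq[unfolded fun_eq_iff])
        have "seminorm_Cauchy p (\<lambda>j. x j - s K)"
        proof -
          have "p ((x m - s K) - (x n - s K)) \<le> q (x m - x n)" for m n
            using pq[OF V_diff[OF xV xV], of m n] by (simp del: fun_diff_def)
          then show ?thesis using CauchyD(3)[OF x] unfolding seminorm_Cauchy_def by (meson le_less_trans)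
        qed
        then have "convergent (\<lambda>j. p (x j - s K))"
          using V_diff[OF xV sV] by (intro convergent_sn[OF p_sn]) auto
        then have l: "(\<lambda>j. p (x j - s K)) \<longlonglongrightarrow> assoc_norm p (\<lambda>j. x j - s K)"
          unfolding assoc_norm_def by (simp add: convergent_LIMSEQ_iff)
        have "assoc_norm p (\<lambda>j. x j - s K) \<le> r / 2"
          by (rule LIMSEQ_le_const2[OF l]) (use main[OF K] in blast)
        moreover have "0 \<le> assoc_norm p (\<lambda>j. x j - s K)"
          by (rule LIMSEQ_le_const[OF l]) (use K.seminorm_ge0[OF p_sn V_diff[OF xV sV]] in blast)
        ultimately show ?thesis using r by (simp only: eq) simp
      qed
      then show "\<exists>no. \<forall>K\<ge>no. norm (assoc_norm p (x - (\<Sum>k<K. seq_scale fam_scale (lam k * \<phi> k x) (y k))) - 0) < r"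
        by blast
    qed
  qed
  show "\<exists>q. continuous_seminorm fam_scale V K.T q \<and> (\<forall>x\<in>V. p x \<le> q x) \<and>
     (\<exists>lam \<phi> y. rapidly_decreasing lam \<and>
        (\<forall>k. lin_on (seq_scale fam_scale) (assoc_banach V q) (*) (\<phi> k)) \<and>
        (\<exists>C. \<forall>k. \<forall>x\<in>assoc_banach V q. norm (\<phi> k x) \<le> C * assoc_norm q x) \<and>
        (\<forall>k. y k \<in> assoc_banach V p) \<and> (\<exists>C. \<forall>k. assoc_norm p (y k) \<le> C) \<and>
        (\<forall>x\<in>assoc_banach V q.
           (\<lambda>K. assoc_norm p (x - (\<Sum>k<K. seq_scale fam_scale (lam k * \<phi> k x) (y k)))) \<longlonglongrightarrow> 0))"
  proof (rule exI[of _ q], intro conjI ballI q pq)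
    show "\<exists>lam \<phi> y. rapidly_decreasing lam \<and>
        (\<forall>k. lin_on (seq_scale fam_scale) (assoc_banach V q) (*) (\<phi> k)) \<and>
        (\<exists>C. \<forall>k. \<forall>x\<in>assoc_banach V q. norm (\<phi> k x) \<le> C * assoc_norm q x) \<and>
        (\<forall>k. y k \<in> assoc_banach V p) \<and> (\<exists>C. \<forall>k. assoc_norm p (y k) \<le> C) \<and>
        (\<forall>x\<in>assoc_banach V q.
           (\<lambda>K. assoc_norm p (x - (\<Sum>k<K. seq_scale fam_scale (lam k * \<phi> k x) (y k)))) \<longlonglongrightarrow> 0)"
      using rapid phi_lin phi_bound y_banach y_bound expand by blast
  qed
qed

end

section \<open>The seminorms of a star product\<close>

lemma summable_on_ennreal: "(f :: 'a \<Rightarrow> ennreal) summable_on A"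
  by (rule nonneg_summable_on_complete) simp

lemma infsum_ennreal_le:
  fixes f :: "'a \<Rightarrow> ennreal"
  assumes "\<And>F. finite F \<Longrightarrow> F \<subseteq> A \<Longrightarrow> sum f F \<le> B" shows "infsum f A \<le> B"
  using assms by (subst nonneg_infsum_complete) (auto intro: SUP_least)

lemma member_le_infsum_ennreal: "x \<in> A \<Longrightarrow> f x \<le> infsum f A" for f :: "'a \<Rightarrow> ennreal"
  by (subst nonneg_infsum_complete) (auto intro!: SUP_upper2[of "{x}"])

lemma infsum_cmult_ennreal: "infsum (\<lambda>x. c * f x) A = c * infsum f A" for f :: "'a \<Rightarrow> ennreal"
proof -
  have "(SUP F\<in>{F. finite F \<and> F \<subseteq> A}. \<Sum>x\<in>F. c * f x) = c * (SUP F\<in>{F. finite F \<and> F \<subseteq> A}. sum f F)"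
    unfolding SUP_mult_left_ennreal by (simp add: sum_distrib_left)
  then show ?thesis by (simp add: nonneg_infsum_complete)
qed

lemma infsum_infsum_ennreal_le:
  fixes f :: "'a \<Rightarrow> 'b \<Rightarrow> ennreal"
  assumes "\<And>F G. finite F \<Longrightarrow> finite G \<Longrightarrow> (\<Sum>x\<in>F. \<Sum>y\<in>G. f x y) \<le> B"
  shows "(\<Sum>\<^sub>\<infinity>x. \<Sum>\<^sub>\<infinity>y. f x y) \<le> B"
proof (rule infsum_ennreal_le)
  fix F :: "'a set" assume F: "finite F"
  have "(\<Sum>x\<in>F. \<Sum>\<^sub>\<infinity>y. f x y) = (\<Sum>\<^sub>\<infinity>y. \<Sum>x\<in>F. f x y)"
    using F
  proof induction
    case (insert x F)
    have "(\<Sum>\<^sub>\<infinity>y. f x y + (\<Sum>x\<in>F. f x y)) = infsum (f x) UNIV + (\<Sum>\<^sub>\<infinity>y. \<Sum>x\<in>F. f x y)"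
      by (intro infsum_add summable_on_ennreal)
    then show ?case using insert by simp
  qed simp
  also have "\<dots> \<le> B"
  proof (rule infsum_ennreal_le)
    fix G :: "'b set" assume "finite G"
    then show "(\<Sum>y\<in>G. \<Sum>x\<in>F. f x y) \<le> B" using assms[OF F] by (subst sum.swap)
  qed
  finally show "(\<Sum>x\<in>F. \<Sum>\<^sub>\<infinity>y. f x y) \<le> B" .
qed

lemma hnorm_scale: "hnorm C m l \<gamma> (fam_scale c a) = ennreal (norm c) ^ (2 ^ m) * hnorm C m l \<gamma> a"
proof (induction m arbitrary: l \<gamma>)
  case 0
  show ?case by (simp add: fam_scale_def norm_mult ennreal_mult)
next
  case (Suc m)
  have "(ennreal (norm c) ^ (2 ^ m) * x)\<^sup>2 * s = ennreal (norm c) ^ (2 ^ Suc m) * (x\<^sup>2 * s)" for x s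
    by (simp add: power_mult_distrib mult.assoc mult.commute[of 2] power_mult)
  then show ?case by (simp add: Suc infsum_cmult_ennreal)
qed

lemma convex_square_ennreal:
  fixes u v x :: ennreal
  assumes t: "0 < t" "t < 1" and x: "x \<le> ennreal t * u + ennreal (1 - t) * v"
  shows "x\<^sup>2 \<le> ennreal t * u\<^sup>2 + ennreal (1 - t) * v\<^sup>2"
proof (cases "u = top \<or> v = top")
  case True
  then have "ennreal t * u\<^sup>2 + ennreal (1 - t) * v\<^sup>2 = top"
    using t by (auto simp: ennreal_mult_top power2_eq_square ennreal_mult_eq_top_iff)
  then show ?thesis by (metis top_greatest)
next
  case False
  then obtain r s where r: "u = ennreal r" "0 \<le> r" and s: "v = ennreal s" "0 \<le> s"
    by (metis ennreal_cases)
  have "x\<^sup>2 \<le> (ennreal t * u + ennreal (1 - t) * v)\<^sup>2" using x by (rule power_mono) simp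
  also have "\<dots> = ennreal ((t * r + (1 - t) * s)\<^sup>2)"
    using r s t by (simp add: ennreal_mult[symmetric] ennreal_plus[symmetric] ennreal_power del: ennreal_plus)
  also have "(t * r + (1 - t) * s)\<^sup>2 = t * r\<^sup>2 + (1 - t) * s\<^sup>2 - t * (1 - t) * (r - s)\<^sup>2"
    by (simp add: power2_eq_square algebra_simps)
  also have "\<dots> \<le> t * r\<^sup>2 + (1 - t) * s\<^sup>2" using t by simp
  also have "ennreal \<dots> = ennreal t * u\<^sup>2 + ennreal (1 - t) * v\<^sup>2"
    using r s t by (simp add: ennreal_mult ennreal_plus ennreal_power)
  finally show ?thesis by (simp add: ennreal_leI)
qed

text \<open>
  Squares of convex functions with nonnegative values are convex, so the recursion preserves convexity. As \<open>h\<^sub>m\<close> is also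
  homogeneous of degree \<open>2 ^ m\<close>, its root of that order is a seminorm.
\<close>

lemma hnorm_convex:
  assumes t: "0 < t" "t < 1"
  shows "hnorm C m l \<gamma> (fam_scale (of_real t) a + fam_scale (of_real (1 - t)) b) \<le>
    ennreal t * hnorm C m l \<gamma> a + ennreal (1 - t) * hnorm C m l \<gamma> b"
proof (induction m arbitrary: l \<gamma>)
  case 0
  have "norm (of_real t * a \<gamma> + of_real (1 - t) * b \<gamma>) \<le> t * norm (a \<gamma>) + (1 - t) * norm (b \<gamma>)"
    using norm_triangle_ineq[of "of_real t * a \<gamma>" "of_real (1 - t) * b \<gamma>"] t
    by (simp add: norm_mult del: of_real_diff)
  then show ?case using t
    by (simp add: fam_scale_def ennreal_mult[symmetric] ennreal_plus[symmetric] ennreal_leI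
        del: ennreal_plus of_real_diff)
next
  case (Suc m)
  let ?c = "fam_scale (of_real t) a + fam_scale (of_real (1 - t)) b"
  have *: "(\<Sum>\<^sub>\<infinity>\<alpha>. (hnorm C m k \<alpha> ?c)\<^sup>2 * S \<alpha>) \<le> ennreal t * (\<Sum>\<^sub>\<infinity>\<alpha>. (hnorm C m k \<alpha> a)\<^sup>2 * S \<alpha>) +
      ennreal (1 - t) * (\<Sum>\<^sub>\<infinity>\<alpha>. (hnorm C m k \<alpha> b)\<^sup>2 * S \<alpha>)" for k S
  proof -
    have "(hnorm C m k \<alpha> ?c)\<^sup>2 * S \<alpha> \<le>
       ennreal t * ((hnorm C m k \<alpha> a)\<^sup>2 * S \<alpha>) + ennreal (1 - t) * ((hnorm C m k \<alpha> b)\<^sup>2 * S \<alpha>)" for \<alpha>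
    proof -
      have "(hnorm C m k \<alpha> ?c)\<^sup>2 \<le> ennreal t * (hnorm C m k \<alpha> a)\<^sup>2 + ennreal (1 - t) * (hnorm C m k \<alpha> b)\<^sup>2"
        by (rule convex_square_ennreal[OF t Suc])
      then have "(hnorm C m k \<alpha> ?c)\<^sup>2 * S \<alpha> \<le>
          (ennreal t * (hnorm C m k \<alpha> a)\<^sup>2 + ennreal (1 - t) * (hnorm C m k \<alpha> b)\<^sup>2) * S \<alpha>"
        by (rule mult_right_mono) simp
      then show ?thesis by (simp only: distrib_right mult.assoc)
    qed
    then have "(\<Sum>\<^sub>\<infinity>\<alpha>. (hnorm C m k \<alpha> ?c)\<^sup>2 * S \<alpha>) \<le> (\<Sum>\<^sub>\<infinity>\<alpha>. ennreal t * ((hnorm C m k \<alpha> a)\<^sup>2 * S \<alpha>) +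
       ennreal (1 - t) * ((hnorm C m k \<alpha> b)\<^sup>2 * S \<alpha>))"
      by (intro infsum_mono summable_on_ennreal) auto
    then show ?thesis by (simp add: infsum_add[OF summable_on_ennreal summable_on_ennreal] infsum_cmult_ennreal)
  qed
  show ?case
  proof (cases "even l")
    case True then show ?thesis unfolding hnorm.simps by (simp only: if_True) (rule *)
  next
    case False then show ?thesis unfolding hnorm.simps by (simp only: if_False) (rule *)
  qed
qed

lemma snorm_le_iff:
  assumes "hnorm C m l \<gamma> a < \<infinity>" "0 \<le> r"
  shows "snorm C m l \<gamma> a \<le> r \<longleftrightarrow> hnorm C m l \<gamma> a \<le> ennreal (r ^ (2 ^ m))"
proof -
  have "snorm C m l \<gamma> a \<le> r \<longleftrightarrow> root (2 ^ m) (enn2real (hnorm C m l \<gamma> a)) \<le> root (2 ^ m) (r ^ (2 ^ m))"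
    using assms(2) by (simp add: snorm_def real_root_power_cancel)
  also have "\<dots> \<longleftrightarrow> enn2real (hnorm C m l \<gamma> a) \<le> r ^ (2 ^ m)" by (subst real_root_le_iff) auto
  also have "\<dots> \<longleftrightarrow> hnorm C m l \<gamma> a \<le> ennreal (r ^ (2 ^ m))"
    using assms by (cases "hnorm C m l \<gamma> a") (auto simp: ennreal_le_iff)
  finally show ?thesis .
qed

lemma snorm_nonneg: "0 \<le> snorm C m l \<gamma> a"
  by (simp add: snorm_def)

lemma snorm_scale:
  "snorm C m l \<gamma> (fam_scale c a) = norm c * snorm C m l \<gamma> a"
  by (simp add: snorm_def hnorm_scale enn2real_mult real_root_mult ennreal_power real_root_power_cancel)

text \<open>
  \<open>a + b\<close> is \<open>A + B\<close> times a convex combination of \<open>a / A\<close> and \<open>b / B\<close>, at which \<open>hnorm\<close> is at most 1.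
\<close>

lemma hnorm_add_scaled:
  assumes "A > 0" "B > 0" "hnorm C m l \<gamma> a \<le> ennreal (A ^ (2 ^ m))" "hnorm C m l \<gamma> b \<le> ennreal (B ^ (2 ^ m))"
  shows "hnorm C m l \<gamma> (a + b) \<le> ennreal ((A + B) ^ (2 ^ m))"
proof -
  define t where "t = A / (A + B)"
  have t: "0 < t" "t < 1" "1 - t = B / (A + B)" using assms by (auto simp: t_def field_simps)
  have unit: "hnorm C m l \<gamma> (fam_scale (of_real (1 / X)) x) \<le> 1"
    if "X > 0" "hnorm C m l \<gamma> x \<le> ennreal (X ^ (2 ^ m))" for X x
  proof -
    have "hnorm C m l \<gamma> (fam_scale (of_real (1 / X)) x) \<le> ennreal ((1 / X) ^ (2 ^ m)) * ennreal (X ^ (2 ^ m))"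
      using that by (simp add: hnorm_scale norm_divide ennreal_power mult_left_mono)
    also have "\<dots> = 1" using that by (simp add: ennreal_mult[symmetric] power_one_over)
    finally show ?thesis .
  qed
  have eq: "a + b = fam_scale (of_real (A + B))
     (fam_scale (of_real t) (fam_scale (of_real (1 / A)) a) + fam_scale (of_real (1 - t)) (fam_scale (of_real (1 / B)) b))"
    using assms(1,2) t(3) by (auto simp: fam_scale_def fun_eq_iff t_def field_simps simp flip: of_real_add)
  have "hnorm C m l \<gamma> (fam_scale (of_real t) (fam_scale (of_real (1 / A)) a) + fam_scale (of_real (1 - t)) (fam_scale (of_real (1 / B)) b))
      \<le> ennreal t * 1 + ennreal (1 - t) * 1"
    using t(1,2) unit[OF assms(1,3)] unit[OF assms(2,4)]
    by (intro order_trans[OF hnorm_convex] add_mono mult_left_mono) auto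
  also have "\<dots> = 1" using t by (simp add: ennreal_plus[symmetric] del: ennreal_plus)
  finally have "hnorm C m l \<gamma> (a + b) \<le> ennreal ((A + B) ^ (2 ^ m)) * 1"
    unfolding eq hnorm_scale[of _ _ _ _ "of_real (A + B)"] using assms(1,2)
    by (intro mult_mono) (auto simp: ennreal_power simp del: ennreal_plus simp flip: of_real_add)
  then show ?thesis by simp
qed

lemma snorm_triangle:
  assumes fin: "hnorm C m l \<gamma> a < \<infinity>" "hnorm C m l \<gamma> b < \<infinity>"
  shows "hnorm C m l \<gamma> (a + b) < \<infinity>" "snorm C m l \<gamma> (a + b) \<le> snorm C m l \<gamma> a + snorm C m l \<gamma> b"
proof -
  have le: "hnorm C m l \<gamma> (a + b) \<le> ennreal ((snorm C m l \<gamma> a + e + (snorm C m l \<gamma> b + e)) ^ (2 ^ m))"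
    if "e > 0" for e
    using that snorm_nonneg[of C m l \<gamma>] snorm_le_iff[OF fin(1), of "snorm C m l \<gamma> a + e"]
      snorm_le_iff[OF fin(2), of "snorm C m l \<gamma> b + e"]
    by (intro hnorm_add_scaled) (auto simp: add_nonneg_pos)
  show f: "hnorm C m l \<gamma> (a + b) < \<infinity>" using le[of 1] by (simp add: le_less_trans ennreal_less_top)
  show "snorm C m l \<gamma> (a + b) \<le> snorm C m l \<gamma> a + snorm C m l \<gamma> b"
  proof (rule field_le_epsilon)
    \<comment> \<open>The summand \<open>e/2\<close> keeps both scaling factors positive when a seminorm vanishes.\<close>
    fix e :: real assume "e > 0"
    then show "snorm C m l \<gamma> (a + b) \<le> snorm C m l \<gamma> a + snorm C m l \<gamma> b + e"
      using le[of "e/2"] snorm_nonneg[of C m l \<gamma>] by (subst snorm_le_iff[OF f]) (auto simp: algebra_simps)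
  qed
qed

lemma seminorm_snorm:
  assumes "l < 2 ^ m" shows "seminorm_on fam_scale (hat_space C) (snorm C m l \<gamma>)"
  using assms snorm_triangle[of C m l \<gamma>]
  by (auto simp: seminorm_on_def snorm_nonneg snorm_scale hat_space_def)

lemma hnorm_ge_even:
  assumes "even l" shows "(hnorm C m (l div 2) \<alpha> a)\<^sup>2 * ennreal (norm (C \<alpha> \<beta> \<gamma>)) \<le> hnorm C (Suc m) l \<gamma> a"
proof -
  have "(hnorm C m (l div 2) \<alpha> a)\<^sup>2 * ennreal (norm (C \<alpha> \<beta> \<gamma>)) \<le>
      (hnorm C m (l div 2) \<alpha> a)\<^sup>2 * (\<Sum>\<^sub>\<infinity>\<beta>. ennreal (norm (C \<alpha> \<beta> \<gamma>)))"
    by (intro mult_left_mono member_le_infsum_ennreal[where f = "\<lambda>\<beta>. ennreal (norm (C \<alpha> \<beta> \<gamma>))"]) auto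
  also have "\<dots> \<le> hnorm C (Suc m) l \<gamma> a" unfolding hnorm.simps if_P[OF assms]
    by (rule member_le_infsum_ennreal[where f = "\<lambda>\<alpha>. (hnorm C m (l div 2) \<alpha> a)\<^sup>2 *
        (\<Sum>\<^sub>\<infinity>\<beta>. ennreal (norm (C \<alpha> \<beta> \<gamma>)))"]) simp
  finally show ?thesis .
qed

lemma hnorm_ge_odd:
  assumes "odd l" shows "(hnorm C m (l div 2) \<beta> a)\<^sup>2 * ennreal (norm (C \<alpha> \<beta> \<gamma>)) \<le> hnorm C (Suc m) l \<gamma> a"
proof -
  have "(hnorm C m (l div 2) \<beta> a)\<^sup>2 * ennreal (norm (C \<alpha> \<beta> \<gamma>)) \<le>
      (hnorm C m (l div 2) \<beta> a)\<^sup>2 * (\<Sum>\<^sub>\<infinity>\<alpha>. ennreal (norm (C \<alpha> \<beta> \<gamma>)))"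
    by (intro mult_left_mono member_le_infsum_ennreal[where f = "\<lambda>\<alpha>. ennreal (norm (C \<alpha> \<beta> \<gamma>))"]) auto
  also have "\<dots> \<le> hnorm C (Suc m) l \<gamma> a" unfolding hnorm.simps if_not_P[OF assms]
    by (rule member_le_infsum_ennreal[where f = "\<lambda>\<beta>. (hnorm C m (l div 2) \<beta> a)\<^sup>2 *
        (\<Sum>\<^sub>\<infinity>\<alpha>. ennreal (norm (C \<alpha> \<beta> \<gamma>)))"]) simp
  finally show ?thesis .
qed

text \<open>
  The growth conditions on structure constants that connect their seminorms with sub-factorial growth. In
  the first two, squaring the weight \<open>wt \<delta>\<close> gives \<open>wt (2 * \<delta>)\<close>, and the sums over factors of the product
  \<open>\<gamma>\<close> may cost the same power again. In the third the power of the factorial stays fixed while the order of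
  the root grows with \<open>m\<close>.
\<close>

locale star_product_index = subfactorial_index sz d for sz :: "'i \<Rightarrow> nat" and d +
  fixes C :: "'i \<Rightarrow> 'i \<Rightarrow> 'i \<Rightarrow> complex"
  assumes left_sum_le: "0 < \<delta> \<Longrightarrow> \<delta> < 1/4 \<Longrightarrow> \<exists>B. \<forall>\<gamma> F G. finite F \<longrightarrow> finite G \<longrightarrow>
      (\<Sum>\<alpha>\<in>F. \<Sum>\<beta>\<in>G. wt (2 * \<delta>) \<alpha> * norm (C \<alpha> \<beta> \<gamma>)) \<le> B * wt (4 * \<delta>) \<gamma>"
    and right_sum_le: "0 < \<delta> \<Longrightarrow> \<delta> < 1/4 \<Longrightarrow> \<exists>B. \<forall>\<gamma> F G. finite F \<longrightarrow> finite G \<longrightarrow>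
      (\<Sum>\<alpha>\<in>F. \<Sum>\<beta>\<in>G. wt (2 * \<delta>) \<beta> * norm (C \<alpha> \<beta> \<gamma>)) \<le> B * wt (4 * \<delta>) \<gamma>"
    and hnorm_lower: "\<exists>\<gamma> D. \<forall>m \<alpha> a. ennreal (norm (a \<alpha>) ^ (2 ^ (m + 2))) \<le>
      ennreal (D * wt 3 \<alpha>) * hnorm C (m + 2) 2 \<gamma> a"
begin

lemma sums_le:
  assumes "0 < \<delta>" "\<delta> < 1/4"
  shows "\<exists>B>0. \<forall>\<gamma> F G. finite F \<longrightarrow> finite G \<longrightarrow>
    (\<Sum>\<alpha>\<in>F. \<Sum>\<beta>\<in>G. wt (2 * \<delta>) \<alpha> * norm (C \<alpha> \<beta> \<gamma>)) \<le> B * wt (4 * \<delta>) \<gamma> \<and>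
    (\<Sum>\<alpha>\<in>F. \<Sum>\<beta>\<in>G. wt (2 * \<delta>) \<beta> * norm (C \<alpha> \<beta> \<gamma>)) \<le> B * wt (4 * \<delta>) \<gamma>"
proof -
  from left_sum_le[OF assms] obtain B1 where B1: "\<forall>\<gamma> F G. finite F \<longrightarrow> finite G \<longrightarrow>
      (\<Sum>\<alpha>\<in>F. \<Sum>\<beta>\<in>G. wt (2 * \<delta>) \<alpha> * norm (C \<alpha> \<beta> \<gamma>)) \<le> B1 * wt (4 * \<delta>) \<gamma>" ..
  from right_sum_le[OF assms] obtain B2 where B2: "\<forall>\<gamma> F G. finite F \<longrightarrow> finite G \<longrightarrow>
      (\<Sum>\<alpha>\<in>F. \<Sum>\<beta>\<in>G. wt (2 * \<delta>) \<beta> * norm (C \<alpha> \<beta> \<gamma>)) \<le> B2 * wt (4 * \<delta>) \<gamma>" ..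
  define B where "B = \<bar>B1\<bar> + \<bar>B2\<bar> + 1"
  have le: "B1 * wt (4 * \<delta>) \<gamma> \<le> B * wt (4 * \<delta>) \<gamma>" "B2 * wt (4 * \<delta>) \<gamma> \<le> B * wt (4 * \<delta>) \<gamma>" for \<gamma>
    by (intro mult_right_mono; simp add: B_def)+
  show ?thesis
  proof (rule exI[of _ B], intro conjI allI impI)
    show "B > 0" by (simp add: B_def)
    fix \<gamma> and F G :: "'i set" assume "finite F" "finite G"
    then show "(\<Sum>\<alpha>\<in>F. \<Sum>\<beta>\<in>G. wt (2 * \<delta>) \<alpha> * norm (C \<alpha> \<beta> \<gamma>)) \<le> B * wt (4 * \<delta>) \<gamma>"
      "(\<Sum>\<alpha>\<in>F. \<Sum>\<beta>\<in>G. wt (2 * \<delta>) \<beta> * norm (C \<alpha> \<beta> \<gamma>)) \<le> B * wt (4 * \<delta>) \<gamma>"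
      using B1[rule_format, of F G \<gamma>] B2[rule_format, of F G \<gamma>] le[of \<gamma>] by linarith+
  qed
qed

text \<open>
  Every step of the recursion multiplies the exponent by four, so any number of steps can be taken from a sufficiently
  small exponent.
\<close>

lemma hnorm_le:
  assumes "0 < \<epsilon>" "4 ^ m * \<epsilon> < 1"
  shows "\<exists>B\<ge>0. \<forall>l \<gamma> a M. (\<forall>\<alpha>. norm (a \<alpha>) \<le> M * wt \<epsilon> \<alpha>) \<longrightarrow>
    hnorm C m l \<gamma> a \<le> ennreal (B * M ^ (2 ^ m) * wt (4 ^ m * \<epsilon>) \<gamma>)"
  using assms(2)
proof (induction m)
  case 0
  show ?case by (intro exI[of _ 1]) (auto intro: ennreal_leI)
next
  case (Suc m)
  define \<delta> where "\<delta> = 4 ^ m * \<epsilon>"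
  have d: "0 < \<delta>" "\<delta> < 1/4" "4 ^ Suc m * \<epsilon> = 4 * \<delta>" using Suc.prems assms(1) by (auto simp: \<delta>_def)
  then obtain B where B: "B \<ge> 0" and IH: "\<And>l \<gamma> a M. (\<forall>\<alpha>. norm (a \<alpha>) \<le> M * wt \<epsilon> \<alpha>) \<Longrightarrow>
    hnorm C m l \<gamma> a \<le> ennreal (B * M ^ (2 ^ m) * wt \<delta> \<gamma>)"
    using Suc.IH unfolding \<delta>_def by auto
  obtain B' where B'0: "B' > 0" and bound: "\<forall>\<gamma> F G. finite F \<longrightarrow> finite G \<longrightarrow>
    (\<Sum>\<alpha>\<in>F. \<Sum>\<beta>\<in>G. wt (2 * \<delta>) \<alpha> * norm (C \<alpha> \<beta> \<gamma>)) \<le> B' * wt (4 * \<delta>) \<gamma> \<and>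
    (\<Sum>\<alpha>\<in>F. \<Sum>\<beta>\<in>G. wt (2 * \<delta>) \<beta> * norm (C \<alpha> \<beta> \<gamma>)) \<le> B' * wt (4 * \<delta>) \<gamma>"
    using sums_le[OF d(1,2)] by blast
  then have B': "(\<Sum>\<alpha>\<in>F. \<Sum>\<beta>\<in>G. wt (2 * \<delta>) \<alpha> * norm (C \<alpha> \<beta> \<gamma>)) \<le> B' * wt (4 * \<delta>) \<gamma>"
    "(\<Sum>\<alpha>\<in>F. \<Sum>\<beta>\<in>G. wt (2 * \<delta>) \<beta> * norm (C \<alpha> \<beta> \<gamma>)) \<le> B' * wt (4 * \<delta>) \<gamma>"
    if "finite F" "finite G" for F G \<gamma> using that by blast+
  have "hnorm C (Suc m) l \<gamma> a \<le> ennreal (B\<^sup>2 * B' * M ^ (2 ^ Suc m) * wt (4 ^ Suc m * \<epsilon>) \<gamma>)"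
    if a: "\<forall>\<alpha>. norm (a \<alpha>) \<le> M * wt \<epsilon> \<alpha>" for l \<gamma> a M
  proof -
    have "0 \<le> norm (a undefined)" by simp
    also have "\<dots> \<le> M * wt \<epsilon> undefined" using a by blast
    finally have M: "M \<ge> 0" by (simp add: zero_le_mult_iff)
    let ?K = "B\<^sup>2 * M ^ (2 ^ Suc m)"
    have K: "?K \<ge> 0" using B M by simp
    have sq: "(hnorm C m k \<alpha> a)\<^sup>2 \<le> ennreal (?K * wt (2 * \<delta>) \<alpha>)" for k \<alpha>
    proof -
      have "(hnorm C m k \<alpha> a)\<^sup>2 \<le> (ennreal (B * M ^ (2 ^ m) * wt \<delta> \<alpha>))\<^sup>2" by (intro power_mono IH a) simp
      also have "\<dots> = ennreal ((B * M ^ (2 ^ m) * wt \<delta> \<alpha>)\<^sup>2)" using B M by (simp add: ennreal_power)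
      also have "(B * M ^ (2 ^ m) * wt \<delta> \<alpha>)\<^sup>2 = ?K * wt (2 * \<delta>) \<alpha>"
      proof -
        have "(wt \<delta> \<alpha>)\<^sup>2 = wt (2 * \<delta>) \<alpha>" by (simp only: power2_eq_square mult_2 powr_add)
        moreover have "(M ^ (2 ^ m))\<^sup>2 = M ^ (2 ^ Suc m)"
          unfolding power_mult[symmetric] by (simp only: power_Suc mult.commute)
        ultimately show ?thesis by (simp only: power_mult_distrib)
      qed
      finally show ?thesis .
    qed
    have half: "(\<Sum>\<^sub>\<infinity>x. (hnorm C m k x a)\<^sup>2 * (\<Sum>\<^sub>\<infinity>y. ennreal (c x y))) \<le> ennreal (?K * (B' * wt (4 * \<delta>) \<gamma>))"
      if c: "\<And>x y. 0 \<le> c x y" and sums: "\<And>F G. finite F \<Longrightarrow> finite G \<Longrightarrow>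
        (\<Sum>x\<in>F. \<Sum>y\<in>G. wt (2 * \<delta>) x * c x y) \<le> B' * wt (4 * \<delta>) \<gamma>" for c :: "'i \<Rightarrow> 'i \<Rightarrow> real" and k
    proof -
      have "(\<Sum>\<^sub>\<infinity>x. (hnorm C m k x a)\<^sup>2 * (\<Sum>\<^sub>\<infinity>y. ennreal (c x y))) \<le>
          (\<Sum>\<^sub>\<infinity>x. ennreal (?K * wt (2 * \<delta>) x) * (\<Sum>\<^sub>\<infinity>y. ennreal (c x y)))"
        by (intro infsum_mono mult_right_mono sq summable_on_ennreal) auto
      also have "\<dots> = (\<Sum>\<^sub>\<infinity>x. \<Sum>\<^sub>\<infinity>y. ennreal (?K * wt (2 * \<delta>) x * c x y))"
        using K c by (simp add: infsum_cmult_ennreal[symmetric] ennreal_mult)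
      also have "\<dots> \<le> ennreal (?K * (B' * wt (4 * \<delta>) \<gamma>))"
      proof (rule infsum_infsum_ennreal_le)
        fix F G :: "'i set" assume "finite F" "finite G"
        then have "?K * (\<Sum>x\<in>F. \<Sum>y\<in>G. wt (2 * \<delta>) x * c x y) \<le> ?K * (B' * wt (4 * \<delta>) \<gamma>)"
          using K by (intro mult_left_mono sums) auto
        moreover have "(\<Sum>x\<in>F. \<Sum>y\<in>G. ennreal (?K * wt (2 * \<delta>) x * c x y)) =
            ennreal (?K * (\<Sum>x\<in>F. \<Sum>y\<in>G. wt (2 * \<delta>) x * c x y))"
          using K c by (simp add: sum_ennreal sum_nonneg sum_distrib_left mult.assoc)
        ultimately show "(\<Sum>x\<in>F. \<Sum>y\<in>G. ennreal (?K * wt (2 * \<delta>) x * c x y)) \<le> ennreal (?K * (B' * wt (4 * \<delta>) \<gamma>))"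
          by (simp add: ennreal_leI)
      qed
      finally show ?thesis .
    qed
    have "hnorm C (Suc m) l \<gamma> a \<le> ennreal (?K * (B' * wt (4 * \<delta>) \<gamma>))"
    proof (cases "even l")
      case True
      show ?thesis unfolding hnorm.simps if_P[OF True]
        by (rule half[of "\<lambda>\<alpha> \<beta>. norm (C \<alpha> \<beta> \<gamma>)"]) (auto intro: B'(1))
    next
      case False
      have "(\<Sum>\<beta>\<in>F. \<Sum>\<alpha>\<in>G. wt (2 * \<delta>) \<beta> * norm (C \<alpha> \<beta> \<gamma>)) \<le> B' * wt (4 * \<delta>) \<gamma>"
        if "finite F" "finite G" for F G
        using B'(2)[of G F \<gamma>] that sum.swap[of "\<lambda>\<beta> \<alpha>. wt (2 * \<delta>) \<beta> * norm (C \<alpha> \<beta> \<gamma>)" G F] by simp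
      then show ?thesis unfolding hnorm.simps if_not_P[OF False]
        by (intro half[of "\<lambda>\<beta> \<alpha>. norm (C \<alpha> \<beta> \<gamma>)"]) auto
    qed
    also have "?K * (B' * wt (4 * \<delta>) \<gamma>) = B\<^sup>2 * B' * M ^ (2 ^ Suc m) * wt (4 ^ Suc m * \<epsilon>) \<gamma>"
      unfolding d(3) by (simp only: mult_ac)
    finally show ?thesis .
  qed
  moreover have "B\<^sup>2 * B' \<ge> 0" using B'0 by simp
  ultimately show ?case by blast
qed

lemma snorm_le_kn:
  obtains \<epsilon> B where "0 < \<epsilon>" "\<epsilon> < 1" "B \<ge> 0"
    "\<And>a. a \<in> V \<Longrightarrow> hnorm C m l \<gamma> a < \<infinity>" "\<And>a. a \<in> V \<Longrightarrow> snorm C m l \<gamma> a \<le> B * kn \<epsilon> a"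
proof -
  define \<epsilon> :: real where "\<epsilon> = 1 / (2 * 4 ^ m)"
  have e: "0 < \<epsilon>" "4 ^ m * \<epsilon> < 1" by (auto simp: \<epsilon>_def)
  have "(1::real) \<le> 4 ^ m" by simp
  then have "(1::real) < 2 * 4 ^ m" by linarith
  then have e1: "\<epsilon> < 1" by (simp add: \<epsilon>_def)
  obtain B where B: "B \<ge> 0" "\<And>l \<gamma> a M. (\<forall>\<alpha>. norm (a \<alpha>) \<le> M * wt \<epsilon> \<alpha>) \<Longrightarrow>
    hnorm C m l \<gamma> a \<le> ennreal (B * M ^ (2 ^ m) * wt (4 ^ m * \<epsilon>) \<gamma>)"
    using hnorm_le[OF e] by blast
  define D where "D = root (2 ^ m) (B * wt (4 ^ m * \<epsilon>) \<gamma>)"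
  have D: "D \<ge> 0" "D ^ (2 ^ m) = B * wt (4 ^ m * \<epsilon>) \<gamma>" using B by (auto simp: D_def)
  have h: "hnorm C m l \<gamma> a \<le> ennreal ((D * kn \<epsilon> a) ^ (2 ^ m))" if "a \<in> V" for a
  proof -
    have "hnorm C m l \<gamma> a \<le> ennreal (B * kn \<epsilon> a ^ (2 ^ m) * wt (4 ^ m * \<epsilon>) \<gamma>)"
      using norm_le_kn[OF that e(1)] by (intro B) auto
    then show ?thesis using D by (simp add: power_mult_distrib mult_ac)
  qed
  then have fin: "hnorm C m l \<gamma> a < \<infinity>" if "a \<in> V" for a
    using that by (metis ennreal_less_top infinity_ennreal_def le_less_trans)
  moreover have "snorm C m l \<gamma> a \<le> D * kn \<epsilon> a" if "a \<in> V" for a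
    using snorm_le_iff[OF fin[OF that], of "D * kn \<epsilon> a"] h[OF that] D(1) kn_nonneg[OF that e(1)] by simp
  ultimately show ?thesis using that e(1) e1 D(1) by blast
qed

text \<open>
  The root of order \<open>2 ^ (m + 2)\<close> turns the loss \<open>wt 3\<close> into \<open>wt (3 / 2 ^ (m + 2))\<close>.
\<close>

lemma norm_le_snorm:
  assumes "\<epsilon> > 0"
  obtains m \<gamma> D where "D \<ge> 0"
    "\<And>a \<alpha>. hnorm C (m + 2) 2 \<gamma> a < \<infinity> \<Longrightarrow> norm (a \<alpha>) \<le> D * snorm C (m + 2) 2 \<gamma> a * wt \<epsilon> \<alpha>"
proof -
  obtain \<gamma> D where lower: "\<And>m \<alpha> a. ennreal (norm (a \<alpha>) ^ (2 ^ (m + 2))) \<le>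
      ennreal (D * wt 3 \<alpha>) * hnorm C (m + 2) 2 \<gamma> a" using hnorm_lower by blast
  define E where "E = \<bar>D\<bar> + 1"
  have E: "E \<ge> 1" "D \<le> E" by (auto simp: E_def)
  obtain m where m: "3 / \<epsilon> < 2 ^ m" using real_arch_pow[of 2 "3 / \<epsilon>"] by auto
  define k where "k = (2::nat) ^ (m + 2)"
  have k: "k > 0" "3 \<le> \<epsilon> * real k"
  proof -
    show "k > 0" by (simp add: k_def)
    have "(2::real) ^ m \<le> 2 ^ (m + 2)" by (intro power_increasing) auto
    then show "3 \<le> \<epsilon> * real k" using m assms by (simp add: k_def field_simps)
  qed
  have "norm (a \<alpha>) \<le> E * snorm C (m + 2) 2 \<gamma> a * wt \<epsilon> \<alpha>" if fin: "hnorm C (m + 2) 2 \<gamma> a < \<infinity>" for a \<alpha>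
  proof (rule power_le_imp_le_base)
    have s: "enn2real (hnorm C (m + 2) 2 \<gamma> a) = snorm C (m + 2) 2 \<gamma> a ^ k"
      by (simp add: snorm_def k_def del: hnorm.simps)
    have "ennreal (norm (a \<alpha>) ^ k) \<le> ennreal (E * wt 3 \<alpha>) * hnorm C (m + 2) 2 \<gamma> a"
      using lower[of a \<alpha> m] unfolding k_def
      by (rule order_trans) (intro mult_right_mono ennreal_leI, use E in auto)
    also have "hnorm C (m + 2) 2 \<gamma> a = ennreal (snorm C (m + 2) 2 \<gamma> a ^ k)"
      using fin s by (metis ennreal_enn2real infinity_ennreal_def)
    finally have "norm (a \<alpha>) ^ k \<le> E * wt 3 \<alpha> * snorm C (m + 2) 2 \<gamma> a ^ k"
      using E by (simp add: ennreal_mult[symmetric] snorm_nonneg ennreal_le_iff)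
    also have "\<dots> \<le> E ^ k * wt \<epsilon> \<alpha> ^ k * snorm C (m + 2) 2 \<gamma> a ^ k"
    proof (intro mult_right_mono mult_mono)
      show "E \<le> E ^ k" using E k by (intro self_le_power) auto
      have "wt 3 \<alpha> \<le> wt (\<epsilon> * real k) \<alpha>" by (rule wt_mono) (rule k)
      also have "\<dots> = wt \<epsilon> \<alpha> ^ k" by (simp add: powr_powr[symmetric] powr_realpow)
      finally show "wt 3 \<alpha> \<le> wt \<epsilon> \<alpha> ^ k" .
    qed (use E in \<open>auto simp: snorm_nonneg\<close>)
    also have "\<dots> = (E * snorm C (m + 2) 2 \<gamma> a * wt \<epsilon> \<alpha>) ^ k" by (simp add: power_mult_distrib mult_ac)
    finally show "norm (a \<alpha>) ^ Suc (k - 1) \<le> (E * snorm C (m + 2) 2 \<gamma> a * wt \<epsilon> \<alpha>) ^ Suc (k - 1)"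
      using k by simp
    show "0 \<le> E * snorm C (m + 2) 2 \<gamma> a * wt \<epsilon> \<alpha>"
      using E(1) snorm_nonneg[of C "m + 2" 2 \<gamma> a] by (intro mult_nonneg_nonneg) auto
  qed
  then show ?thesis using that[of E m \<gamma>] E by auto
qed

lemma hat_space_eq: "hat_space C = V"
proof (intro equalityI subsetI)
  fix a assume "a \<in> V"
  then have "hnorm C m l \<gamma> a < \<infinity>" for m l \<gamma> using snorm_le_kn[of m l \<gamma>] by metis
  then show "a \<in> hat_space C" unfolding hat_space_def by blast
next
  fix a assume a: "a \<in> hat_space C"
  show "a \<in> V"
  proof (rule subfactorialI)
    fix \<epsilon> :: real assume "0 < \<epsilon>"
    then obtain m \<gamma> D where *: "\<And>a \<alpha>. hnorm C (m + 2) 2 \<gamma> a < \<infinity> \<Longrightarrow> norm (a \<alpha>) \<le> D * snorm C (m + 2) 2 \<gamma> a * wt \<epsilon> \<alpha>"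
      using norm_le_snorm by metis
    have "(2::nat) < 2 ^ (m + 2)" by (induction m) auto
    then have "hnorm C (m + 2) 2 \<gamma> a < \<infinity>" using a unfolding hat_space_def by blast
    then show "\<exists>c. \<forall>\<alpha>. norm (a \<alpha>) \<le> c * wt \<epsilon> \<alpha>" using * by blast
  qed
qed

lemma hat_topology_eq: "hat_topology C = K.T"
  unfolding hat_topology_def hat_space_eq
proof (rule lc_topology_eqI)
  show "seminorm_family fam_scale V (snorms C)"
  proof unfold_locales
    show "module.subspace fam_scale V" by (rule subspace_V)
    show "\<And>p. p \<in> snorms C \<Longrightarrow> seminorm_on fam_scale V p"
      using seminorm_snorm[of _ _ C] unfolding snorms_def hat_space_eq by blast
    show "snorms C \<noteq> {}" unfolding snorms_def by (blast intro: zero_less_power[of "2::nat"] zero_less_numeral)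
  qed
  show "seminorm_family fam_scale V KN" by unfold_locales
next
  fix p assume "p \<in> snorms C"
  then obtain m l \<gamma> where p: "p = snorm C m l \<gamma>" unfolding snorms_def by blast
  obtain \<epsilon> B where "0 < \<epsilon>" "\<epsilon> < 1" "\<And>a. a \<in> V \<Longrightarrow> p a \<le> B * kn \<epsilon> a"
    using snorm_le_kn[of m l \<gamma>] unfolding p by metis
  then show "\<exists>q\<in>KN. \<exists>C. \<forall>x\<in>V. p x \<le> C * q x" by (intro bexI[of _ "kn \<epsilon>"]) auto
next
  fix q assume "q \<in> KN"
  then obtain \<epsilon> where q: "q = kn \<epsilon>" "0 < \<epsilon>" by blast
  obtain m \<gamma> D where *: "\<And>a \<alpha>. hnorm C (m + 2) 2 \<gamma> a < \<infinity> \<Longrightarrow> norm (a \<alpha>) \<le> D * snorm C (m + 2) 2 \<gamma> a * wt \<epsilon> \<alpha>"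
    using norm_le_snorm[OF q(2)] by metis
  have l: "(2::nat) < 2 ^ (m + 2)" by (induction m) auto
  have "q a \<le> D * snorm C (m + 2) 2 \<gamma> a" if "a \<in> V" for a
  proof -
    have "a \<in> hat_space C" using that hat_space_eq by simp
    then have "hnorm C (m + 2) 2 \<gamma> a < \<infinity>" using l unfolding hat_space_def by blast
    then show ?thesis unfolding q by (intro kn_le *)
  qed
  moreover have "snorm C (m + 2) 2 \<gamma> \<in> snorms C" using l unfolding snorms_def by blast
  ultimately show "\<exists>p\<in>snorms C. \<exists>C. \<forall>x\<in>V. q x \<le> C * p x" by blast
qed

subsection \<open>Continuity of the product\<close>

text \<open>
  By \<open>x * y \<le> (x\<^sup>2 + y\<^sup>2) / 2\<close> the double series of the product is dominated by the two one-sided sums that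
  already control \<open>hnorm\<close>.
\<close>

lemma hat_mult_partial_sum_le:
  assumes "0 < \<delta>" "\<delta> < 1/4"
  shows "\<exists>B>0. \<forall>a\<in>V. \<forall>b\<in>V. \<forall>\<gamma> X. finite X \<longrightarrow>
    (\<Sum>(\<alpha>, \<beta>)\<in>X. norm (C \<alpha> \<beta> \<gamma> * a \<alpha> * b \<beta>)) \<le> B * kn \<delta> a * kn \<delta> b * wt (4 * \<delta>) \<gamma>"
proof -
  obtain B where B0: "B > 0" and bound: "\<forall>\<gamma> F G. finite F \<longrightarrow> finite G \<longrightarrow>
    (\<Sum>\<alpha>\<in>F. \<Sum>\<beta>\<in>G. wt (2 * \<delta>) \<alpha> * norm (C \<alpha> \<beta> \<gamma>)) \<le> B * wt (4 * \<delta>) \<gamma> \<and>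
    (\<Sum>\<alpha>\<in>F. \<Sum>\<beta>\<in>G. wt (2 * \<delta>) \<beta> * norm (C \<alpha> \<beta> \<gamma>)) \<le> B * wt (4 * \<delta>) \<gamma>"
    using sums_le[OF assms] by blast
  then have B: "(\<Sum>\<alpha>\<in>F. \<Sum>\<beta>\<in>G. wt (2 * \<delta>) \<alpha> * norm (C \<alpha> \<beta> \<gamma>)) \<le> B * wt (4 * \<delta>) \<gamma>"
    "(\<Sum>\<alpha>\<in>F. \<Sum>\<beta>\<in>G. wt (2 * \<delta>) \<beta> * norm (C \<alpha> \<beta> \<gamma>)) \<le> B * wt (4 * \<delta>) \<gamma>"
    if "finite F" "finite G" for F G \<gamma> using that by blast+
  have "(\<Sum>(\<alpha>, \<beta>)\<in>X. norm (C \<alpha> \<beta> \<gamma> * a \<alpha> * b \<beta>)) \<le> B * kn \<delta> a * kn \<delta> b * wt (4 * \<delta>) \<gamma>"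
    if ab: "a \<in> V" "b \<in> V" and X: "finite X" for a b \<gamma> X
  proof -
    define F where "F = fst ` X"
    define G where "G = snd ` X"
    have FG: "finite F" "finite G" "X \<subseteq> F \<times> G" using X by (auto simp: F_def G_def image_iff) force+
    let ?K = "kn \<delta> a * kn \<delta> b"
    have K: "?K \<ge> 0" using kn_nonneg ab assms by simp
    have term_le: "norm (C \<alpha> \<beta> \<gamma> * a \<alpha> * b \<beta>) \<le>
        ?K / 2 * (wt (2 * \<delta>) \<alpha> * norm (C \<alpha> \<beta> \<gamma>)) + ?K / 2 * (wt (2 * \<delta>) \<beta> * norm (C \<alpha> \<beta> \<gamma>))" for \<alpha> \<beta>
    proof -
      have w2: "wt (2 * \<delta>) \<alpha> = wt \<delta> \<alpha> * wt \<delta> \<alpha>" for \<alpha>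
        by (simp only: mult_2 powr_add)
      have "norm (a \<alpha>) * norm (b \<beta>) \<le> (kn \<delta> a * wt \<delta> \<alpha>) * (kn \<delta> b * wt \<delta> \<beta>)"
        using ab assms kn_nonneg by (intro mult_mono norm_le_kn) auto
      also have "\<dots> = ?K * (wt \<delta> \<alpha> * wt \<delta> \<beta>)" by (simp add: mult_ac)
      also have "wt \<delta> \<alpha> * wt \<delta> \<beta> \<le> (wt (2 * \<delta>) \<alpha> + wt (2 * \<delta>) \<beta>) / 2"
        using sum_squares_bound[of "wt \<delta> \<alpha>" "wt \<delta> \<beta>"] unfolding w2 by (simp add: power2_eq_square)
      finally have "norm (a \<alpha>) * norm (b \<beta>) \<le> ?K * ((wt (2 * \<delta>) \<alpha> + wt (2 * \<delta>) \<beta>) / 2)"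
        using K by (simp add: mult_left_mono)
      then have "norm (C \<alpha> \<beta> \<gamma>) * (norm (a \<alpha>) * norm (b \<beta>)) \<le> norm (C \<alpha> \<beta> \<gamma>) * (?K * ((wt (2 * \<delta>) \<alpha> + wt (2 * \<delta>) \<beta>) / 2))"
        by (intro mult_left_mono) auto
      then show ?thesis by (simp add: norm_mult algebra_simps add_divide_distrib)
    qed
    have "(\<Sum>(\<alpha>, \<beta>)\<in>X. norm (C \<alpha> \<beta> \<gamma> * a \<alpha> * b \<beta>)) \<le> (\<Sum>(\<alpha>, \<beta>)\<in>F\<times>G. norm (C \<alpha> \<beta> \<gamma> * a \<alpha> * b \<beta>))"
      using FG by (intro sum_mono2) auto
    also have "\<dots> \<le> (\<Sum>(\<alpha>, \<beta>)\<in>F\<times>G. ?K / 2 * (wt (2 * \<delta>) \<alpha> * norm (C \<alpha> \<beta> \<gamma>)) + ?K / 2 * (wt (2 * \<delta>) \<beta> * norm (C \<alpha> \<beta> \<gamma>)))"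
      by (intro sum_mono) (simp only: case_prod_unfold term_le)
    also have "\<dots> = ?K / 2 * (\<Sum>\<alpha>\<in>F. \<Sum>\<beta>\<in>G. wt (2 * \<delta>) \<alpha> * norm (C \<alpha> \<beta> \<gamma>)) +
        ?K / 2 * (\<Sum>\<alpha>\<in>F. \<Sum>\<beta>\<in>G. wt (2 * \<delta>) \<beta> * norm (C \<alpha> \<beta> \<gamma>))"
      by (simp add: sum.cartesian_product[symmetric] sum.distrib sum_distrib_left)
    also have "\<dots> \<le> ?K / 2 * (B * wt (4 * \<delta>) \<gamma>) + ?K / 2 * (B * wt (4 * \<delta>) \<gamma>)"
      using K FG by (intro add_mono mult_left_mono B) auto
    also have "\<dots> = B * kn \<delta> a * kn \<delta> b * wt (4 * \<delta>) \<gamma>" by (simp add: mult_ac)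
    finally show ?thesis .
  qed
  then show ?thesis using B0 by blast
qed

lemma hat_mult_summable:
  assumes "a \<in> V" "b \<in> V" shows "(\<lambda>x. norm (case x of (\<alpha>, \<beta>) \<Rightarrow> C \<alpha> \<beta> \<gamma> * a \<alpha> * b \<beta>)) summable_on UNIV"
proof -
  obtain B where "\<forall>a\<in>V. \<forall>b\<in>V. \<forall>\<gamma> X. finite X \<longrightarrow>
    (\<Sum>(\<alpha>, \<beta>)\<in>X. norm (C \<alpha> \<beta> \<gamma> * a \<alpha> * b \<beta>)) \<le> B * kn (1/8) a * kn (1/8) b * wt (4 * (1/8)) \<gamma>"
    using hat_mult_partial_sum_le[of "1/8"] by auto
  then have B: "finite X \<Longrightarrow> (\<Sum>(\<alpha>, \<beta>)\<in>X. norm (C \<alpha> \<beta> \<gamma> * a \<alpha> * b \<beta>)) \<le>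
      B * kn (1/8) a * kn (1/8) b * wt (4 * (1/8)) \<gamma>" for X using assms by blast
  show ?thesis
    by (rule nonneg_bdd_above_summable_on)
      (use B in \<open>auto simp: case_prod_unfold bdd_above_def\<close>)
qed

lemma hat_mult_has_sum:
  assumes "a \<in> V" "b \<in> V"
  shows "((\<lambda>(\<alpha>, \<beta>). C \<alpha> \<beta> \<gamma> * a \<alpha> * b \<beta>) has_sum hat_mult C a b \<gamma>) UNIV"
  unfolding hat_mult_def
  using abs_summable_summable[OF hat_mult_summable[OF assms, of \<gamma>]] by (rule has_sum_infsum)

lemma norm_hat_mult_le:
  assumes "0 < \<delta>" "\<delta> < 1/4"
  shows "\<exists>B>0. \<forall>a\<in>V. \<forall>b\<in>V. \<forall>\<gamma>.
    norm (hat_mult C a b \<gamma>) \<le> B * kn \<delta> a * kn \<delta> b * wt (4 * \<delta>) \<gamma>"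
proof -
  obtain B where B0: "B > 0" and bound: "\<forall>a\<in>V. \<forall>b\<in>V. \<forall>\<gamma> X. finite X \<longrightarrow>
    (\<Sum>(\<alpha>, \<beta>)\<in>X. norm (C \<alpha> \<beta> \<gamma> * a \<alpha> * b \<beta>)) \<le> B * kn \<delta> a * kn \<delta> b * wt (4 * \<delta>) \<gamma>"
    using hat_mult_partial_sum_le[OF assms] by blast
  have "norm (hat_mult C a b \<gamma>) \<le> B * kn \<delta> a * kn \<delta> b * wt (4 * \<delta>) \<gamma>" if ab: "a \<in> V" "b \<in> V" for a b \<gamma>
  proof -
    have "norm (hat_mult C a b \<gamma>) \<le> (\<Sum>\<^sub>\<infinity>(\<alpha>, \<beta>). norm (C \<alpha> \<beta> \<gamma> * a \<alpha> * b \<beta>))"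
      unfolding hat_mult_def using norm_infsum_bound[OF hat_mult_summable[OF ab, of \<gamma>]]
      by (simp add: case_prod_unfold)
    also have "\<dots> \<le> B * kn \<delta> a * kn \<delta> b * wt (4 * \<delta>) \<gamma>"
      by (rule infsum_le_finite_sums) (use hat_mult_summable[OF ab, of \<gamma>] bound ab in \<open>auto simp: case_prod_unfold\<close>)
    finally show ?thesis .
  qed
  then show ?thesis using B0 by blast
qed

lemma hat_mult_closed: assumes "a \<in> V" "b \<in> V" shows "hat_mult C a b \<in> V"
proof (rule subfactorialI)
  fix \<epsilon> :: real assume e: "0 < \<epsilon>" "\<epsilon> < 1"
  then have "0 < \<epsilon>/4" "\<epsilon>/4 < 1/4" by auto
  then obtain B where "\<forall>\<gamma>. norm (hat_mult C a b \<gamma>) \<le> B * kn (\<epsilon>/4) a * kn (\<epsilon>/4) b * wt (4 * (\<epsilon>/4)) \<gamma>"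
    using norm_hat_mult_le assms by blast
  then show "\<exists>c. \<forall>\<gamma>. norm (hat_mult C a b \<gamma>) \<le> c * wt \<epsilon> \<gamma>" by auto
qed

lemma kn_hat_mult_le:
  assumes "0 < \<epsilon>" "\<epsilon> < 1"
  obtains B where "B > 0" "\<And>a b. a \<in> V \<Longrightarrow> b \<in> V \<Longrightarrow>
    kn \<epsilon> (hat_mult C a b) \<le> B * kn (\<epsilon>/4) a * kn (\<epsilon>/4) b"
proof -
  have e: "0 < \<epsilon>/4" "\<epsilon>/4 < 1/4" using assms by auto
  obtain B where B: "B > 0" "\<forall>a\<in>V. \<forall>b\<in>V. \<forall>\<gamma>.
      norm (hat_mult C a b \<gamma>) \<le> B * kn (\<epsilon>/4) a * kn (\<epsilon>/4) b * wt (4 * (\<epsilon>/4)) \<gamma>"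
    using norm_hat_mult_le[OF e] by blast
  show ?thesis by (rule that[OF B(1)], rule kn_le) (use B(2) in simp)
qed

lemma hat_mult_add_left: "a \<in> V \<Longrightarrow> a' \<in> V \<Longrightarrow> b \<in> V \<Longrightarrow>
    hat_mult C (a + a') b = hat_mult C a b + hat_mult C a' b"
  and hat_mult_add_right: "a \<in> V \<Longrightarrow> b \<in> V \<Longrightarrow> b' \<in> V \<Longrightarrow>
    hat_mult C a (b + b') = hat_mult C a b + hat_mult C a b'"
proof -
  show "hat_mult C (a + a') b = hat_mult C a b + hat_mult C a' b" if "a \<in> V" "a' \<in> V" "b \<in> V"
  proof
    fix \<gamma>
    have "((\<lambda>(\<alpha>, \<beta>). C \<alpha> \<beta> \<gamma> * (a + a') \<alpha> * b \<beta>) has_sum hat_mult C a b \<gamma> + hat_mult C a' b \<gamma>) UNIV"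
      using has_sum_add[OF hat_mult_has_sum[OF that(1,3), of \<gamma>] hat_mult_has_sum[OF that(2,3), of \<gamma>]]
      by (simp add: case_prod_unfold ring_distribs)
    then show "hat_mult C (a + a') b \<gamma> = (hat_mult C a b + hat_mult C a' b) \<gamma>"
      unfolding hat_mult_def[of _ "a + a'"] by (simp add: infsumI)
  qed
  show "hat_mult C a (b + b') = hat_mult C a b + hat_mult C a b'" if "a \<in> V" "b \<in> V" "b' \<in> V"
  proof
    fix \<gamma>
    have "((\<lambda>(\<alpha>, \<beta>). C \<alpha> \<beta> \<gamma> * a \<alpha> * (b + b') \<beta>) has_sum hat_mult C a b \<gamma> + hat_mult C a b' \<gamma>) UNIV"
      using has_sum_add[OF hat_mult_has_sum[OF that(1,2), of \<gamma>] hat_mult_has_sum[OF that(1,3), of \<gamma>]]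
      by (simp add: case_prod_unfold ring_distribs)
    then show "hat_mult C a (b + b') \<gamma> = (hat_mult C a b + hat_mult C a b') \<gamma>"
      unfolding hat_mult_def[of _ _ "b + b'"] by (simp add: infsumI)
  qed
qed

lemma hat_mult_scale_left: "hat_mult C (fam_scale c a) b = fam_scale c (hat_mult C a b)"
  and hat_mult_scale_right: "hat_mult C a (fam_scale c b) = fam_scale c (hat_mult C a b)"
proof -
  have "(\<Sum>\<^sub>\<infinity>(\<alpha>, \<beta>). C \<alpha> \<beta> \<gamma> * fam_scale c a \<alpha> * b \<beta>) = (\<Sum>\<^sub>\<infinity>x. c * (case x of (\<alpha>, \<beta>) \<Rightarrow> C \<alpha> \<beta> \<gamma> * a \<alpha> * b \<beta>))"
    "(\<Sum>\<^sub>\<infinity>(\<alpha>, \<beta>). C \<alpha> \<beta> \<gamma> * a \<alpha> * fam_scale c b \<beta>) = (\<Sum>\<^sub>\<infinity>x. c * (case x of (\<alpha>, \<beta>) \<Rightarrow> C \<alpha> \<beta> \<gamma> * a \<alpha> * b \<beta>))" for \<gamma>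
    by (intro infsum_cong; auto simp: fam_scale_def)+
  then show "hat_mult C (fam_scale c a) b = fam_scale c (hat_mult C a b)"
    "hat_mult C a (fam_scale c b) = fam_scale c (hat_mult C a b)"
    by (auto simp: hat_mult_def fam_scale_def infsum_cmult_right' fun_eq_iff)
qed

lemma hat_mult_diff_left: assumes "a \<in> V" "a' \<in> V" "b \<in> V"
  shows "hat_mult C (a - a') b = hat_mult C a b - hat_mult C a' b"
  using hat_mult_add_left[OF V_diff[OF assms(1,2)] assms(2,3)] by (simp add: algebra_simps)

lemma hat_mult_diff_right: assumes "a \<in> V" "b \<in> V" "b' \<in> V"
  shows "hat_mult C a (b - b') = hat_mult C a b - hat_mult C a b'"
  using hat_mult_add_right[OF assms(1) V_diff[OF assms(2,3)] assms(3)] by (simp add: algebra_simps)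

lemma hat_mult_bilinear:
  "a \<in> V \<Longrightarrow> lin_on fam_scale V fam_scale (hat_mult C a)"
  "b \<in> V \<Longrightarrow> lin_on fam_scale V fam_scale (\<lambda>a. hat_mult C a b)"
  unfolding lin_on_def
  by (auto intro: hat_mult_add_left[simplified] hat_mult_add_right[simplified] hat_mult_scale_left hat_mult_scale_right)

lemma continuous_hat_mult: "continuous_map (prod_topology K.T K.T) K.T (\<lambda>(x, y). hat_mult C x y)"
proof -
  have "openin (prod_topology K.T K.T) {z \<in> V \<times> V. (\<lambda>(x, y). hat_mult C x y) z \<in> U}" if U: "openin K.T U" for U
    unfolding openin_prod_topology_alt
  proof (intro allI impI)
    fix x y assume "(x, y) \<in> {z \<in> V \<times> V. (\<lambda>(x, y). hat_mult C x y) z \<in> U}"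
    then have xy: "x \<in> V" "y \<in> V" "hat_mult C x y \<in> U" by auto
    then obtain \<epsilon> r where e: "0 < \<epsilon>" "\<epsilon> < 1" "r > 0" and sub: "{z\<in>V. kn \<epsilon> (z - hat_mult C x y) < r} \<subseteq> U"
      using U unfolding K.openin_lc_iff by blast
    obtain B where B: "B > 0" "\<And>a b. a \<in> V \<Longrightarrow> b \<in> V \<Longrightarrow> kn \<epsilon> (hat_mult C a b) \<le> B * kn (\<epsilon>/4) a * kn (\<epsilon>/4) b"
      using kn_hat_mult_le[OF e(1,2)] by metis
    have d: "0 < \<epsilon>/4" "\<epsilon>/4 < 1" using e by auto
    define M where "M = 1 + kn (\<epsilon>/4) x + kn (\<epsilon>/4) y"
    have M: "M \<ge> 1" "kn (\<epsilon>/4) x \<le> M" "kn (\<epsilon>/4) y \<le> M - 1"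
      using kn_nonneg[OF xy(1) d(1)] kn_nonneg[OF xy(2) d(1)] by (auto simp: M_def)
    \<comment> \<open>Close to \<open>x\<close> and \<open>y\<close> the second factor has norm at most \<open>M\<close>, so both differences contribute at most \<open>B * M * t \<le> r / 2\<close>.\<close>
    define t where "t = min 1 (r / (2 * B * M))"
    have t: "0 < t" "t \<le> 1" using e B M by (auto simp: t_def)
    have "t \<le> r / (2 * B * M)" by (simp add: t_def)
    then have tB: "2 * B * M * t \<le> r" using B M by (simp add: field_simps)
    have into: "hat_mult C x' y' \<in> U" if x': "x' \<in> V" "kn (\<epsilon>/4) (x' - x) < t" and y': "y' \<in> V" "kn (\<epsilon>/4) (y' - y) < t" for x' y'
    proof -
      have dV: "x' - x \<in> V" "y' - y \<in> V" using V_diff x' y' xy by blast+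
      have mV: "hat_mult C (x' - x) y' \<in> V" "hat_mult C x (y' - y) \<in> V" using hat_mult_closed dV xy y' by blast+
      have y'M: "kn (\<epsilon>/4) y' \<le> M"
        using K.seminorm_reverse_triangle[OF seminorm_kn[OF d(1)] y'(1) xy(2)] y'(2) t(2) M(3) by linarith
      have "hat_mult C x' y' - hat_mult C x y = hat_mult C (x' - x) y' + hat_mult C x (y' - y)"
        using hat_mult_diff_left[OF x'(1) xy(1) y'(1)] hat_mult_diff_right[OF xy(1) y'(1) xy(2)] by simp
      then have "kn \<epsilon> (hat_mult C x' y' - hat_mult C x y) \<le> kn \<epsilon> (hat_mult C (x' - x) y') + kn \<epsilon> (hat_mult C x (y' - y))"
        using K.seminorm_triangle[OF seminorm_kn[OF e(1)] mV] by simp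
      also have "\<dots> \<le> B * kn (\<epsilon>/4) (x' - x) * kn (\<epsilon>/4) y' + B * kn (\<epsilon>/4) x * kn (\<epsilon>/4) (y' - y)"
        by (intro add_mono B(2) dV xy y')
      also have "\<dots> < B * t * M + B * M * t"
      proof (rule add_less_le_mono)
        have "B * kn (\<epsilon>/4) (x' - x) * kn (\<epsilon>/4) y' \<le> B * kn (\<epsilon>/4) (x' - x) * M"
          using y'M B(1) kn_nonneg[OF dV(1) d(1)] by (intro mult_left_mono) auto
        also have "\<dots> < B * t * M" using x'(2) B(1) M(1) by simp
        finally show "B * kn (\<epsilon>/4) (x' - x) * kn (\<epsilon>/4) y' < B * t * M" .
        show "B * kn (\<epsilon>/4) x * kn (\<epsilon>/4) (y' - y) \<le> B * M * t"
          using B(1) M y'(2) kn_nonneg[OF dV(2) d(1)] kn_nonneg[OF xy(1) d(1)] by (intro mult_mono) auto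
      qed
      also have "\<dots> \<le> r" using tB by (simp add: mult_ac)
      finally show ?thesis using sub hat_mult_closed[OF x'(1) y'(1)] by blast
    qed
    have ball: "openin K.T {z\<in>V. kn (\<epsilon>/4) (z - w) < t}" if "w \<in> V" for w
      by (rule K.openin_lc_ball) (use d t that in auto)
    show "\<exists>U' V'. openin K.T U' \<and> openin K.T V' \<and> x \<in> U' \<and> y \<in> V' \<and>
        U' \<times> V' \<subseteq> {z \<in> V \<times> V. (\<lambda>(x, y). hat_mult C x y) z \<in> U}"
      using ball[OF xy(1)] ball[OF xy(2)] into xy t K.seminorm_zero[OF seminorm_kn[OF d(1)]]
      by (intro exI[of _ "{z\<in>V. kn (\<epsilon>/4) (z - x) < t}"] exI[of _ "{z\<in>V. kn (\<epsilon>/4) (z - y) < t}"])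
        (auto simp del: fun_diff_def)
  qed
  then show ?thesis
    by (auto simp: continuous_map_def topspace_K intro: hat_mult_closed[simplified])
qed

text \<open>The associator is a continuous trilinear map, so it vanishes once it vanishes on the basis.\<close>

lemma hat_mult_assoc:
  assumes basis: "\<And>\<alpha> \<beta> \<gamma>. hat_mult C (hat_mult C (unit_family \<alpha>) (unit_family \<beta>)) (unit_family \<gamma>) =
      hat_mult C (unit_family \<alpha>) (hat_mult C (unit_family \<beta>) (unit_family \<gamma>))"
    and xyz: "x \<in> V" "y \<in> V" "z \<in> V"
  shows "hat_mult C (hat_mult C x y) z = hat_mult C x (hat_mult C y z)"
proof -
  define A where "A \<kappa> x y z = hat_mult C (hat_mult C x y) z \<kappa> - hat_mult C x (hat_mult C y z) \<kappa>" for \<kappa> x y z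
  obtain B1 where B1: "B1 > 0" "\<And>a b. a \<in> V \<Longrightarrow> b \<in> V \<Longrightarrow>
      kn (1/2) (hat_mult C a b) \<le> B1 * kn (1/2/4) a * kn (1/2/4) b"
    using kn_hat_mult_le[of "1/2"] by auto
  obtain B2 where B2: "B2 > 0" "\<And>a b. a \<in> V \<Longrightarrow> b \<in> V \<Longrightarrow>
      kn (1/2/4) (hat_mult C a b) \<le> B2 * kn (1/2/4/4) a * kn (1/2/4/4) b"
    using kn_hat_mult_le[of "1/2/4"] by auto
  define n where "n = kn (1/2/4/4)"
  have n0: "0 \<le> n a" if "a \<in> V" for a using kn_nonneg[OF that] by (simp add: n_def)
  have kn_n: "kn (1/2/4) a \<le> n a" if "a \<in> V" for a unfolding n_def by (rule kn_antimono[OF that]) auto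
  have bound: "norm (A \<kappa> x y z) \<le> (2 * B1 * B2 * wt (1/2) \<kappa>) * n x * n y * n z"
    if V: "x \<in> V" "y \<in> V" "z \<in> V" for \<kappa> x y z
  proof -
    have m: "hat_mult C x y \<in> V" "hat_mult C y z \<in> V" "hat_mult C (hat_mult C x y) z \<in> V" "hat_mult C x (hat_mult C y z) \<in> V"
      using hat_mult_closed V by blast+
    have "kn (1/2) (hat_mult C (hat_mult C x y) z) \<le> B1 * (B2 * n x * n y) * n z"
      using B1(2)[OF m(1) V(3)] B1(1) B2(1) B2(2)[OF V(1,2)] kn_n[OF V(3)] kn_nonneg[OF m(1), of "1/2/4"] kn_nonneg[OF V(3), of "1/2/4"] n0 V
      unfolding n_def[symmetric]
      by (elim order_trans) (intro mult_mono mult_nonneg_nonneg, auto)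
    then have 1: "norm (hat_mult C (hat_mult C x y) z \<kappa>) \<le> B1 * (B2 * n x * n y) * n z * wt (1/2) \<kappa>"
      using norm_le_kn[OF m(3), of "1/2" \<kappa>] by (meson mult_right_mono order_trans powr_ge_zero half_gt_zero zero_less_one)
    have "kn (1/2) (hat_mult C x (hat_mult C y z)) \<le> B1 * n x * (B2 * n y * n z)"
      using B1(2)[OF V(1) m(2)] B1(1) B2(1) B2(2)[OF V(2,3)] kn_n[OF V(1)] kn_nonneg[OF m(2), of "1/2/4"] kn_nonneg[OF V(1), of "1/2/4"] n0 V
      unfolding n_def[symmetric]
      by (elim order_trans) (intro mult_mono mult_nonneg_nonneg, auto)
    then have 2: "norm (hat_mult C x (hat_mult C y z) \<kappa>) \<le> B1 * n x * (B2 * n y * n z) * wt (1/2) \<kappa>"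
      using norm_le_kn[OF m(4), of "1/2" \<kappa>] by (meson mult_right_mono order_trans powr_ge_zero half_gt_zero zero_less_one)
    show ?thesis using norm_triangle_ineq4[of "hat_mult C (hat_mult C x y) z \<kappa>" "hat_mult C x (hat_mult C y z) \<kappa>"] 1 2
      unfolding A_def by (simp add: mult_ac)
  qed
  have lin1: "lin_on fam_scale V (*) (\<lambda>x. A \<kappa> x y z)" if "y \<in> V" "z \<in> V" for \<kappa> y z
    unfolding lin_on_def A_def
  proof (intro conjI ballI allI)
    fix a b assume ab: "a \<in> V" "b \<in> V"
    show "hat_mult C (hat_mult C (a + b) y) z \<kappa> - hat_mult C (a + b) (hat_mult C y z) \<kappa> =
       hat_mult C (hat_mult C a y) z \<kappa> - hat_mult C a (hat_mult C y z) \<kappa> + (hat_mult C (hat_mult C b y) z \<kappa> - hat_mult C b (hat_mult C y z) \<kappa>)"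
      using ab that by (simp only: hat_mult_add_left hat_mult_closed) (simp add: plus_fun_def)
    fix c show "hat_mult C (hat_mult C (fam_scale c a) y) z \<kappa> - hat_mult C (fam_scale c a) (hat_mult C y z) \<kappa> =
       c * (hat_mult C (hat_mult C a y) z \<kappa> - hat_mult C a (hat_mult C y z) \<kappa>)"
      by (simp only: hat_mult_scale_left) (simp add: fam_scale_def algebra_simps)
  qed
  have lin2: "lin_on fam_scale V (*) (\<lambda>y. A \<kappa> x y z)" if "x \<in> V" "z \<in> V" for \<kappa> x z
    unfolding lin_on_def A_def
  proof (intro conjI ballI allI)
    fix a b assume ab: "a \<in> V" "b \<in> V"
    show "hat_mult C (hat_mult C x (a + b)) z \<kappa> - hat_mult C x (hat_mult C (a + b) z) \<kappa> =
       hat_mult C (hat_mult C x a) z \<kappa> - hat_mult C x (hat_mult C a z) \<kappa> + (hat_mult C (hat_mult C x b) z \<kappa> - hat_mult C x (hat_mult C b z) \<kappa>)"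
      using ab that by (simp only: hat_mult_add_left hat_mult_add_right hat_mult_closed) (simp add: plus_fun_def)
    fix c show "hat_mult C (hat_mult C x (fam_scale c a)) z \<kappa> - hat_mult C x (hat_mult C (fam_scale c a) z) \<kappa> =
       c * (hat_mult C (hat_mult C x a) z \<kappa> - hat_mult C x (hat_mult C a z) \<kappa>)"
      by (simp only: hat_mult_scale_left hat_mult_scale_right) (simp add: fam_scale_def algebra_simps)
  qed
  have lin3: "lin_on fam_scale V (*) (\<lambda>z. A \<kappa> x y z)" if "x \<in> V" "y \<in> V" for \<kappa> x y
    unfolding lin_on_def A_def
  proof (intro conjI ballI allI)
    fix a b assume ab: "a \<in> V" "b \<in> V"
    show "hat_mult C (hat_mult C x y) (a + b) \<kappa> - hat_mult C x (hat_mult C y (a + b)) \<kappa> =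
       hat_mult C (hat_mult C x y) a \<kappa> - hat_mult C x (hat_mult C y a) \<kappa> + (hat_mult C (hat_mult C x y) b \<kappa> - hat_mult C x (hat_mult C y b) \<kappa>)"
      using ab that by (simp only: hat_mult_add_right hat_mult_closed) (simp add: plus_fun_def)
    fix c show "hat_mult C (hat_mult C x y) (fam_scale c a) \<kappa> - hat_mult C x (hat_mult C y (fam_scale c a)) \<kappa> =
       c * (hat_mult C (hat_mult C x y) a \<kappa> - hat_mult C x (hat_mult C y a) \<kappa>)"
      by (simp only: hat_mult_scale_right) (simp add: fam_scale_def algebra_simps)
  qed
  have e: "(1/2/4/4 :: real) > 0" by simp
  note U = unit_in_V
  have A0: "A \<kappa> (unit_family \<alpha>) (unit_family \<beta>) (unit_family \<gamma>) = 0" for \<kappa> \<alpha> \<beta> \<gamma>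
    by (simp add: A_def basis)
  have A1: "A \<kappa> x (unit_family \<beta>) (unit_family \<gamma>) = 0" if "x \<in> V" for \<kappa> \<beta> \<gamma> x
    by (rule functional_zero[OF lin1[OF U U] e _ A0 that,
          where C = "2 * B1 * B2 * wt (1/2) \<kappa> * n (unit_family \<beta>) * n (unit_family \<gamma>)"])
      (use bound[OF _ U U] in \<open>simp add: n_def mult_ac\<close>)
  have A2: "A \<kappa> x y (unit_family \<gamma>) = 0" if "x \<in> V" "y \<in> V" for \<kappa> \<gamma> x y
    by (rule functional_zero[OF lin2[OF that(1) U] e _ A1[OF that(1)] that(2),
          where C = "2 * B1 * B2 * wt (1/2) \<kappa> * n x * n (unit_family \<gamma>)"])
      (use bound[OF that(1) _ U] in \<open>simp add: n_def mult_ac\<close>)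
  have "A \<kappa> x y z = 0" for \<kappa>
    by (rule functional_zero[OF lin3[OF xyz(1,2)] e _ A2[OF xyz(1,2)] xyz(3),
          where C = "2 * B1 * B2 * wt (1/2) \<kappa> * n x * n y"])
      (use bound[OF xyz(1,2)] in \<open>simp add: n_def mult_ac\<close>)
  then show ?thesis by (auto simp: A_def fun_eq_iff)
qed

lemma frechet_algebra_hat:
  assumes "\<And>\<alpha> \<beta> \<gamma>. hat_mult C (hat_mult C (unit_family \<alpha>) (unit_family \<beta>)) (unit_family \<gamma>) =
      hat_mult C (unit_family \<alpha>) (hat_mult C (unit_family \<beta>) (unit_family \<gamma>))"
  shows "frechet_algebra fam_scale V K.T (hat_mult C)"
  unfolding frechet_algebra_def
  using frechet_space_kothe hat_mult_closed hat_mult_bilinear hat_mult_assoc[OF assms] continuous_hat_mult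
  by blast

end

section \<open>Multiindices\<close>

lemma mdeg_add [simp]: "mdeg (I + J) = mdeg I + mdeg J"
  and mdeg_zero [simp]: "mdeg 0 = 0"
  by (simp_all add: mdeg_def sum.distrib)

lemma mdeg_mono: "I \<le> J \<Longrightarrow> mdeg I \<le> mdeg J"
  unfolding mdeg_def by (intro sum_mono) (simp add: less_eq_vec_def)

lemma bideg_Pair [simp]: "bideg (I, J) = mdeg I + mdeg J"
  by (simp add: bideg_def)

lemma mfact_zero [simp]: "mfact 0 = 1"
  by (simp add: mfact_def)

lemma le_vec_addE:
  fixes K P :: "nat ^ 'n"
  assumes "K \<le> P" obtains K' where "P = K' + K"
  using that[of "P - K"] assms by (auto simp: vec_eq_iff less_eq_vec_def)

lemma le_vec_add [simp]: "K \<le> K' + K" "K \<le> K + K'" for K K' :: "nat ^ 'n"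
  by (auto simp: less_eq_vec_def)

lemma finite_mdeg_le: "finite {I :: nat ^ 'n::finite. mdeg I \<le> k}"
  and card_mdeg_le: "card {I :: nat ^ 'n::finite. mdeg I \<le> k} \<le> (k + 1) ^ CARD('n)"
proof -
  let ?S = "{I :: nat ^ 'n. mdeg I \<le> k}" and ?T = "(UNIV :: 'n set) \<rightarrow>\<^sub>E {..k}"
  have inj: "inj_on (\<lambda>I i. I $ i) ?S" by (auto simp: inj_on_def vec_eq_iff fun_eq_iff)
  have "I $ i \<le> mdeg I" for I :: "nat ^ 'n" and i
    unfolding mdeg_def by (rule member_le_sum) auto
  then have sub: "(\<lambda>I i. I $ i) ` ?S \<subseteq> ?T" by (fastforce intro: order_trans)
  have fin: "finite ?T" by (intro finite_PiE) auto
  show "finite ?S" using finite_subset[OF sub fin] inj by (rule finite_imageD)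
  have "card ?S = card ((\<lambda>I i. I $ i) ` ?S)" using inj by (simp add: card_image)
  also have "\<dots> \<le> card ?T" by (rule card_mono[OF fin sub])
  also have "\<dots> = (k + 1) ^ CARD('n)" by (simp add: card_PiE)
  finally show "card ?S \<le> (k + 1) ^ CARD('n)" .
qed

lemma mdeg_index: "subfactorial_index (mdeg :: nat ^ 'n::finite \<Rightarrow> nat) CARD('n)"
  by unfold_locales (rule finite_mdeg_le card_mdeg_le)+

lemma bideg_index: "subfactorial_index (bideg :: 'n::finite bidx \<Rightarrow> nat) (2 * CARD('n))"
proof
  fix k
  let ?S = "{I :: nat ^ 'n. mdeg I \<le> k}"
  have sub: "{\<alpha> :: 'n bidx. bideg \<alpha> \<le> k} \<subseteq> ?S \<times> ?S" by (auto simp: bideg_def)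
  have fin: "finite (?S \<times> ?S)" using finite_mdeg_le by blast
  show "finite {\<alpha> :: 'n bidx. bideg \<alpha> \<le> k}" by (rule finite_subset[OF sub fin])
  have "card {\<alpha> :: 'n bidx. bideg \<alpha> \<le> k} \<le> card ?S * card ?S"
    using card_mono[OF fin sub] by (simp add: card_cartesian_product)
  also have "\<dots> \<le> (k + 1) ^ CARD('n) * (k + 1) ^ CARD('n)" by (intro mult_mono card_mdeg_le) auto
  finally show "card {\<alpha> :: 'n bidx. bideg \<alpha> \<le> k} \<le> (k + 1) ^ (2 * CARD('n))"
    by (simp add: mult_2 power_add)
qed

lemma finite_le_multiindex: "finite {K. K \<le> (P :: nat ^ 'n::finite)}"
  by (rule finite_subset[OF _ finite_mdeg_le[of "mdeg P"]]) (auto intro: mdeg_mono)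

lemma card_le_multiindex: "card {K. K \<le> (P :: nat ^ 'n::finite)} \<le> (2 ^ CARD('n)) ^ mdeg P"
proof -
  have "card {K. K \<le> P} \<le> card {K :: nat ^ 'n. mdeg K \<le> mdeg P}"
    by (intro card_mono finite_mdeg_le) (auto intro: mdeg_mono)
  also have "\<dots> \<le> (mdeg P + 1) ^ CARD('n)" by (rule card_mdeg_le)
  also have "\<dots> \<le> (2 ^ mdeg P) ^ CARD('n)" by (intro power_mono) (simp_all add: Suc_leI)
  finally show ?thesis by (simp add: power_mult[symmetric] mult.commute)
qed

lemma fact_add_ge: "(fact a :: real) * fact b \<le> fact (a + b)"
proof -
  have "(fact a * fact b :: nat) \<le> fact (a + b)" by (intro dvd_imp_le fact_fact_dvd_fact) auto
  then have "real (fact a * fact b) \<le> real (fact (a + b))" by (rule of_nat_mono)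
  then show ?thesis by simp
qed

lemma fact_add_le: "(fact (a + b) :: real) \<le> 2 ^ (a + b) * fact a * fact b"
proof -
  have "(fact (a + b) :: real) = fact a * fact b * real ((a + b) choose a)"
    using binomial_fact_lemma[of a "a + b"] by (metis add_diff_cancel_left' le_add1 of_nat_fact of_nat_mult)
  also have "\<dots> \<le> fact a * fact b * 2 ^ (a + b)"
  proof (intro mult_left_mono)
    have "real ((a + b) choose a) \<le> real (2 ^ (a + b))" by (intro of_nat_mono binomial_le_pow2)
    then show "real ((a + b) choose a) \<le> 2 ^ (a + b)" by simp
  qed auto
  finally show ?thesis by (simp add: mult_ac)
qed

lemma mfact_le_fact: "real (mfact I) \<le> fact (mdeg I)"
proof -
  have "real (\<Prod>k\<in>A. fact (I $ k)) \<le> fact (\<Sum>k\<in>A. I $ k)" if "finite A" for A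
    using that
  proof induction
    case (insert x F)
    have "real (\<Prod>k\<in>insert x F. fact (I $ k)) = fact (I $ x) * real (\<Prod>k\<in>F. fact (I $ k))"
      using insert.hyps by simp
    also have "\<dots> \<le> fact (I $ x) * fact (\<Sum>k\<in>F. I $ k)"
      using insert.IH by (intro mult_left_mono) auto
    also have "\<dots> \<le> fact (I $ x + (\<Sum>k\<in>F. I $ k))" by (rule fact_add_ge)
    finally show ?case using insert.hyps by simp
  qed simp
  from this[of UNIV] show ?thesis by (simp add: mfact_def mdeg_def)
qed

text \<open>
  In a fixed number of variables multinomial coefficients grow at most exponentially.
\<close>

lemma fact_le_mfact: "(fact (mdeg I) :: real) \<le> (2 ^ CARD('n)) ^ mdeg I * real (mfact I)" for I :: "nat ^ 'n::finite"
proof -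
  have "(fact (\<Sum>k\<in>A. I $ k) :: real) \<le> (2 ^ card A) ^ (\<Sum>k\<in>A. I $ k) * real (\<Prod>k\<in>A. fact (I $ k))"
    if "finite A" for A
    using that
  proof induction
    case (insert x F)
    let ?s = "\<Sum>k\<in>F. I $ k"
    have "(fact (I $ x + ?s) :: real) \<le> 2 ^ (I $ x + ?s) * fact (I $ x) * fact ?s" by (rule fact_add_le)
    also have "\<dots> \<le> 2 ^ (I $ x + ?s) * fact (I $ x) * ((2 ^ card F) ^ ?s * real (\<Prod>k\<in>F. fact (I $ k)))"
      using insert.IH by (intro mult_left_mono) auto
    also have "\<dots> \<le> 2 ^ (I $ x + ?s) * fact (I $ x) * ((2 ^ card F) ^ (I $ x + ?s) * real (\<Prod>k\<in>F. fact (I $ k)))"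
      by (intro mult_left_mono mult_right_mono power_increasing) (auto intro: prod_nonneg)
    also have "\<dots> = (2 ^ Suc (card F)) ^ (I $ x + ?s) * (fact (I $ x) * real (\<Prod>k\<in>F. fact (I $ k)))"
      by (simp only: power_Suc power_mult_distrib mult_ac)
    finally show ?case using insert.hyps by simp
  qed simp
  from this[of UNIV] show ?thesis by (simp add: mfact_def mdeg_def)
qed

text \<open>
  The product of the binomial coefficients \<open>binom(K' + K, K)\<close>; the sum in the first argument avoids truncated
  subtraction.
\<close>

definition mchoose :: "nat ^ 'n::finite \<Rightarrow> nat ^ 'n \<Rightarrow> nat" where
  "mchoose K' K = (\<Prod>k\<in>UNIV. (K' $ k + K $ k) choose (K $ k))"

lemma mfact_add: "mfact (K' + K) = mchoose K' K * mfact K' * mfact K"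
proof -
  have "fact (a + b) = ((a + b) choose b) * fact a * fact b" for a b :: nat
    using binomial_fact_lemma[of b "a + b"] by (simp add: mult_ac)
  then show ?thesis by (simp add: mfact_def mchoose_def prod.distrib)
qed

lemma mchoose_le: "real (mchoose K' K) \<le> 2 ^ (mdeg (K' + K))"
proof -
  have "mchoose K' K \<le> (\<Prod>k\<in>UNIV. 2 ^ (K' $ k + K $ k))"
    unfolding mchoose_def by (intro prod_mono) (auto intro: binomial_le_pow2)
  also have "\<dots> = 2 ^ (mdeg (K' + K))" by (simp add: mdeg_def power_sum)
  finally have "real (mchoose K' K) \<le> real (2 ^ (mdeg (K' + K)))" by (rule of_nat_mono)
  then show ?thesis by simp
qed

section \<open>Structure constants of the Wick product\<close>

lemma lookup_pd_z:
  "Poly_Mapping.lookup (pd_z N f) (I, J) = of_nat (mfact (I + N)) / of_nat (mfact I) * Poly_Mapping.lookup f (I + N, J)"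
proof -
  have "Poly_Mapping.lookup (pd_z N f) (I, J) = (\<Sum>x\<in>Poly_Mapping.keys f. if x = (I + N, J)
      then of_nat (mfact (I + N)) / of_nat (mfact I) * Poly_Mapping.lookup f (I + N, J) else 0)"
    unfolding pd_z_def lookup_sum
  proof (intro sum.cong refl)
    fix x assume "x \<in> Poly_Mapping.keys f"
    obtain I' J' where x: "x = (I', J')" by (cases x)
    have "N \<le> I' \<and> I' - N = I \<longleftrightarrow> I' = I + N"
      by (auto simp: vec_eq_iff less_eq_vec_def) (metis le_add_diff_inverse2)
    then show "Poly_Mapping.lookup (case x of (I, J) \<Rightarrow> if N \<le> I then Poly_Mapping.single (I - N, J)
          (of_nat (mfact I) / of_nat (mfact (I - N)) * Poly_Mapping.lookup f (I, J)) else 0) (I, J) =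
        (if x = (I + N, J) then of_nat (mfact (I + N)) / of_nat (mfact I) * Poly_Mapping.lookup f (I + N, J) else 0)"
      by (auto simp: x lookup_single when_def)
  qed
  also have "\<dots> = of_nat (mfact (I + N)) / of_nat (mfact I) * Poly_Mapping.lookup f (I + N, J)"
    by (simp add: in_keys_iff)
  finally show ?thesis .
qed

lemma lookup_pd_zbar:
  "Poly_Mapping.lookup (pd_zbar N f) (I, J) = of_nat (mfact (J + N)) / of_nat (mfact J) * Poly_Mapping.lookup f (I, J + N)"
proof -
  have "Poly_Mapping.lookup (pd_zbar N f) (I, J) = (\<Sum>x\<in>Poly_Mapping.keys f. if x = (I, J + N)
      then of_nat (mfact (J + N)) / of_nat (mfact J) * Poly_Mapping.lookup f (I, J + N) else 0)"
    unfolding pd_zbar_def lookup_sum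
  proof (intro sum.cong refl)
    fix x assume "x \<in> Poly_Mapping.keys f"
    obtain I' J' where x: "x = (I', J')" by (cases x)
    have "N \<le> J' \<and> J' - N = J \<longleftrightarrow> J' = J + N"
      by (auto simp: vec_eq_iff less_eq_vec_def) (metis le_add_diff_inverse2)
    then show "Poly_Mapping.lookup (case x of (I, J) \<Rightarrow> if N \<le> J then Poly_Mapping.single (I, J - N)
          (of_nat (mfact J) / of_nat (mfact (J - N)) * Poly_Mapping.lookup f (I, J)) else 0) (I, J) =
        (if x = (I, J + N) then of_nat (mfact (J + N)) / of_nat (mfact J) * Poly_Mapping.lookup f (I, J + N) else 0)"
      by (auto simp: x lookup_single when_def)
  qed
  also have "\<dots> = of_nat (mfact (J + N)) / of_nat (mfact J) * Poly_Mapping.lookup f (I, J + N)"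
    by (simp add: in_keys_iff)
  finally show ?thesis .
qed

lemma pd_z_single:
  "pd_z N (Poly_Mapping.single (I, J) c) = (if N \<le> I
    then Poly_Mapping.single (I - N, J) (of_nat (mfact I) / of_nat (mfact (I - N)) * c) else 0)"
  by (cases "c = 0") (auto simp: pd_z_def)

lemma pd_zbar_single:
  "pd_zbar N (Poly_Mapping.single (I, J) c) = (if N \<le> J
    then Poly_Mapping.single (I, J - N) (of_nat (mfact J) / of_nat (mfact (J - N)) * c) else 0)"
  by (cases "c = 0") (auto simp: pd_zbar_def)

lemma pd_z_zero_outside:
  assumes "\<And>I J. (I, J) \<in> Poly_Mapping.keys f \<Longrightarrow> \<not> N \<le> I" shows "pd_z N f = 0"
  unfolding pd_z_def using assms by (intro sum.neutral) auto

lemma finite_pd_z_nonzero: "finite {N. pd_z N f \<noteq> 0}"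
proof (rule finite_subset)
  show "{N. pd_z N f \<noteq> 0} \<subseteq> (\<Union>x\<in>Poly_Mapping.keys f. {N. N \<le> fst x})"
    using pd_z_zero_outside[of f] by fastforce
qed (auto intro: finite_le_multiindex)

lemma poly_scale_zero [simp]: "poly_scale c 0 = 0"
  by (simp add: poly_mapping_eq_iff fun_eq_iff lookup_poly_scale)

lemma poly_scale_single: "poly_scale c (Poly_Mapping.single \<alpha> d) = Poly_Mapping.single \<alpha> (c * d)"
  by (simp add: poly_mapping_eq_iff fun_eq_iff lookup_poly_scale lookup_single when_def)

lemma wick_mult_eq_sum:
  assumes "finite S" "{N. pd_z N f \<noteq> 0} \<subseteq> S"
  shows "wick_mult hbar f g = (\<Sum>N\<in>S. poly_scale
     (of_real ((2 * hbar) ^ mdeg N / of_nat (mfact N))) (pd_z N f * pd_zbar N g))"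
  unfolding wick_mult_def by (rule Sum_any.expand_superset) (use assms in auto)

text \<open>
  Only \<open>N \<le> I\<close> and \<open>N \<le> L\<close> leave nonzero derivatives of the two monomials.
\<close>

lemma lookup_wick_mult_single:
  assumes "S = {N. N \<le> I \<and> N \<le> L}"
  shows "Poly_Mapping.lookup (wick_mult hbar (Poly_Mapping.single (I, J) c) (Poly_Mapping.single (K, L) d)) \<gamma> =
    (\<Sum>N\<in>S. of_real ((2 * hbar) ^ mdeg N / of_nat (mfact N)) *
      (of_nat (mfact I) / of_nat (mfact (I - N)) * c * (of_nat (mfact L) / of_nat (mfact (L - N)) * d))
      when (I - N + K, J + (L - N)) = \<gamma>)"
proof -
  have "wick_mult hbar (Poly_Mapping.single (I, J) c) (Poly_Mapping.single (K, L) d) =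
     (\<Sum>N\<in>{N. N \<le> I}. poly_scale (of_real ((2 * hbar) ^ mdeg N / of_nat (mfact N)))
       (pd_z N (Poly_Mapping.single (I, J) c) * pd_zbar N (Poly_Mapping.single (K, L) d)))"
    by (rule wick_mult_eq_sum) (auto simp: pd_z_single finite_le_multiindex)
  also have "\<dots> = (\<Sum>N\<in>S. Poly_Mapping.single (I - N + K, J + (L - N)) (of_real ((2 * hbar) ^ mdeg N / of_nat (mfact N)) *
      (of_nat (mfact I) / of_nat (mfact (I - N)) * c * (of_nat (mfact L) / of_nat (mfact (L - N)) * d))))"
    unfolding assms
    by (rule sum.mono_neutral_cong_right)
      (auto simp: finite_le_multiindex pd_z_single pd_zbar_single poly_scale_single mult_single)
  finally show ?thesis by (simp add: lookup_sum lookup_single)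
qed

text \<open>
  \<open>N\<close> is the order of the derivatives, \<open>K'\<close> and \<open>J'\<close> are the exponents that they leave in the two factors. Since the
  exponents of the result determine \<open>N\<close>, a single term of the product contributes.
\<close>

lemma wick_struct_eq:
  assumes "hbar > 0"
  shows "wick_struct hbar (K' + N, J) (K, J' + N) (K' + K, J + J') =
    of_real (real (mchoose K' K) * real (mchoose J J') / ((2 * hbar) ^ mdeg N * real (mfact N)))"
proof -
  let ?S = "{M. M \<le> K' + N \<and> M \<le> J' + N}"
  have fin: "finite ?S" by (rule finite_subset[OF _ finite_le_multiindex[of "K' + N"]]) auto
  have uniq: "(K' + N - M + K, J + (J' + N - M)) = (K' + K, J + J') \<longleftrightarrow> M = N" if "M \<in> ?S" for M
  proof -
    have M: "M $ i \<le> K' $ i + N $ i" for i using that by (auto simp: less_eq_vec_def)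
    show ?thesis
    proof
      assume "(K' + N - M + K, J + (J' + N - M)) = (K' + K, J + J')"
      then have "K' + N - M = K'" by simp
      then have "K' $ i + N $ i - M $ i = K' $ i" for i by (metis vector_add_component vector_minus_component)
      then have "M $ i = N $ i" for i using M[of i] by (metis add_diff_cancel_left' diff_diff_cancel)
      then show "M = N" by (simp add: vec_eq_iff)
    qed simp
  qed
  have N: "N \<in> ?S" by simp
  have "Poly_Mapping.lookup (wick_mult hbar (wick_basis hbar (K' + N, J)) (wick_basis hbar (K, J' + N))) (K' + K, J + J') =
    (\<Sum>M\<in>?S. if M = N then of_real ((2 * hbar) ^ mdeg N / of_nat (mfact N)) *
      (of_nat (mfact (K' + N)) / of_nat (mfact K') *
        of_real (1 / (of_nat (mfact (K' + N)) * of_nat (mfact J) * (2 * hbar) ^ (mdeg (K' + N) + mdeg J))) *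
      (of_nat (mfact (J' + N)) / of_nat (mfact J') *
        of_real (1 / (of_nat (mfact K) * of_nat (mfact (J' + N)) * (2 * hbar) ^ (mdeg K + mdeg (J' + N)))))) else 0)"
    unfolding wick_basis_def prod.case lookup_wick_mult_single[OF refl]
    by (intro sum.cong refl) (simp only: uniq when_def, auto)
  also have "\<dots> = of_real ((2 * hbar) ^ mdeg N / of_nat (mfact N)) *
      (of_nat (mfact (K' + N)) / of_nat (mfact K') *
        of_real (1 / (of_nat (mfact (K' + N)) * of_nat (mfact J) * (2 * hbar) ^ (mdeg (K' + N) + mdeg J))) *
      (of_nat (mfact (J' + N)) / of_nat (mfact J') *
        of_real (1 / (of_nat (mfact K) * of_nat (mfact (J' + N)) * (2 * hbar) ^ (mdeg K + mdeg (J' + N))))))"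
    using fin N by simp
  finally have *: "Poly_Mapping.lookup (wick_mult hbar (wick_basis hbar (K' + N, J)) (wick_basis hbar (K, J' + N))) (K' + K, J + J') = \<dots>" .
  show ?thesis unfolding wick_struct_def wick_coords_eq[OF less_imp_neq[OF assms, symmetric]] * fst_conv snd_conv bideg_Pair
      mfact_add[of K' K] mfact_add[of J J']
    using assms by (simp add: power_add field_simps)
qed

lemma wick_struct_nonzeroE:
  assumes "wick_struct hbar \<alpha> \<beta> \<gamma> \<noteq> 0" "hbar > 0"
  obtains K' N J K J' where "\<alpha> = (K' + N, J)" "\<beta> = (K, J' + N)" "\<gamma> = (K' + K, J + J')"
proof -
  obtain I J where \<alpha>: "\<alpha> = (I, J)" by (cases \<alpha>)
  obtain K L where \<beta>: "\<beta> = (K, L)" by (cases \<beta>)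
  have "Poly_Mapping.lookup (wick_mult hbar (wick_basis hbar \<alpha>) (wick_basis hbar \<beta>)) \<gamma> \<noteq> 0"
    using assms by (auto simp: wick_struct_def wick_coords_eq)
  then obtain N where N: "N \<le> I" "N \<le> L" "(I - N + K, J + (L - N)) = \<gamma>"
    unfolding \<alpha> \<beta> wick_basis_def prod.case lookup_wick_mult_single[OF refl]
    by (elim sum.not_neutral_contains_not_neutral) (auto simp: when_def split: if_splits)
  have "I = I - N + N" "L = L - N + N" using N by (auto simp: vec_eq_iff less_eq_vec_def)
  then show ?thesis using that[of "I - N" N J K "L - N"] \<alpha> \<beta> N by metis
qed

section \<open>Growth of the structure constants\<close>

text \<open>
  For fixed \<open>\<gamma> = (P, Q)\<close> the nonzero structure constants are parametrised by \<open>K \<le> P\<close>, \<open>J \<le> Q\<close> and an arbitrary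
  \<open>N\<close>, and either factor has degree at most \<open>|\<gamma>| + |N|\<close>; the function \<open>sel\<close> picks one of them. Up to exponential factors
  the weight is at most \<open>|\<gamma>|!\<close> to the power \<open>2 \<delta>\<close> times \<open>|N|!\<close> to the power \<open>2 \<delta> \<le> 1/2\<close>, and the latter is summable
  against \<open>1 / N!\<close>. The factors exponential in \<open>|\<gamma>|\<close>, among them the number of pairs \<open>(K, J)\<close>, cost
  \<open>|\<gamma>|!\<close> to the power \<open>2 \<delta>\<close> once more.
\<close>

lemma wick_struct_sum_le:
  fixes sel :: "'n::finite bidx \<Rightarrow> 'n bidx \<Rightarrow> 'n bidx"
  assumes hbar: "hbar > 0" and \<delta>: "0 < \<delta>" "\<delta> < 1/4"
    and sel: "\<And>K' N J K J'. bideg (sel (K' + N, J) (K, J' + N)) \<le> bideg (K' + K, J + J') + mdeg N"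
  shows "\<exists>B. \<forall>\<gamma> F G. finite F \<longrightarrow> finite G \<longrightarrow>
      (\<Sum>\<alpha>\<in>F. \<Sum>\<beta>\<in>G. fact (bideg (sel \<alpha> \<beta>)) powr (2 * \<delta>) * norm (wick_struct hbar \<alpha> \<beta> \<gamma>))
        \<le> B * fact (bideg \<gamma>) powr (4 * \<delta>)"
proof -
  interpret m: subfactorial_index "mdeg :: nat ^ 'n \<Rightarrow> nat" "CARD('n)" by (rule mdeg_index)
  define R :: real where "R = 2 ^ CARD('n)"
  have R: "R \<ge> 1" by (simp add: R_def)
  define S where "S = 2 * R / (2 * hbar)"
  have S: "S > 0" using R hbar by (simp add: S_def)
  obtain C1 where C1: "C1 > 0" "\<And>k. S ^ k \<le> C1 * fact k powr (1/4)"
    using power_le_fact_powr[of "1/4" S] by auto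
  obtain C2 where C2: "C2 > 0" "\<And>k. (4 * R) ^ k \<le> C2 * fact k powr (2 * \<delta>)"
    using power_le_fact_powr[of "2 * \<delta>" "4 * R"] \<delta> by auto
  define W where "W = (\<Sum>\<^sub>\<infinity>N\<in>UNIV. m.wt (-(1/4)) N)"
  have sumW: "(\<lambda>N. m.wt (-(1/4)) N) summable_on UNIV" by (rule m.summable_wt) simp
  have W: "(\<Sum>N\<in>H. m.wt (-(1/4)) N) \<le> W" if "finite H" for H
    unfolding W_def using that by (intro finite_sum_le_infsum sumW) auto
  have W0: "W \<ge> 0" using W[of "{}"] by simp

  have main: "(\<Sum>\<alpha>\<in>F. \<Sum>\<beta>\<in>G. fact (bideg (sel \<alpha> \<beta>)) powr (2 * \<delta>) * norm (wick_struct hbar \<alpha> \<beta> \<gamma>))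
      \<le> C1 * C2 * W * fact (bideg \<gamma>) powr (4 * \<delta>)" if FG: "finite F" "finite G" for F G \<gamma>
  proof -
    obtain P Q where \<gamma>: "\<gamma> = (P, Q)" by (cases \<gamma>)
    let ?g = "bideg \<gamma>"
    define t where "t \<alpha> \<beta> = fact (bideg (sel \<alpha> \<beta>)) powr (2 * \<delta>) * norm (wick_struct hbar \<alpha> \<beta> \<gamma>)" for \<alpha> \<beta>
    have t0: "t \<alpha> \<beta> \<ge> 0" for \<alpha> \<beta> by (simp add: t_def)
    \<comment> \<open>The factors with structure constant at \<open>(P, Q)\<close>, for the parameters \<open>(K, J, N)\<close>.\<close>
    define \<phi> where "\<phi> = (\<lambda>(K, J, N). ((P - K + N, J), (K, Q - J + N)))"
    define D where "D = {K. K \<le> P} \<times> {J. J \<le> Q} \<times> (UNIV :: (nat ^ 'n) set)"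
    have inj: "inj \<phi>" by (auto simp: inj_def \<phi>_def)
    define X where "X = {(\<alpha>, \<beta>) \<in> F \<times> G. t \<alpha> \<beta> \<noteq> 0}"
    have finX: "finite X" by (rule finite_subset[of _ "F \<times> G"]) (use FG in \<open>auto simp: X_def\<close>)
    have X: "X \<subseteq> \<phi> ` D"
    proof
      fix x assume x: "x \<in> X"
      obtain \<alpha> \<beta> where ab: "x = (\<alpha>, \<beta>)" by (cases x)
      then have "wick_struct hbar \<alpha> \<beta> \<gamma> \<noteq> 0" using x by (auto simp: X_def t_def)
      then obtain K' N J K J' where "\<alpha> = (K' + N, J)" "\<beta> = (K, J' + N)" "\<gamma> = (K' + K, J + J')"
        using wick_struct_nonzeroE[OF _ hbar] by metis
      then have "x = \<phi> (K, J, N)" "(K, J, N) \<in> D"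
        using ab \<gamma> by (auto simp: \<phi>_def D_def add.commute[of J])
      then show "x \<in> \<phi> ` D" by blast
    qed
    define Y where "Y = \<phi> -` X \<inter> D"
    have XY: "X = \<phi> ` Y" using X by (auto simp: Y_def)
    have finY: "finite Y" using finX inj unfolding Y_def by (intro finite_Int disjI1 finite_vimageI)
    define H where "H = (snd \<circ> snd) ` Y"
    have H: "finite H" "Y \<subseteq> {K. K \<le> P} \<times> {J. J \<le> Q} \<times> H" using finY by (auto simp: H_def Y_def D_def image_iff) force
    have term_le: "t (P - K + N, J) (K, Q - J + N) \<le>
        (4 ^ ?g * fact ?g powr (2 * \<delta>) * C1) * m.wt (-(1/4)) N" if KJ: "K \<le> P" "J \<le> Q" for K J N
    proof -
      obtain K' where P: "P = K' + K" using KJ(1) by (rule le_vec_addE)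
      obtain J' where Q: "Q = J' + J" using KJ(2) by (rule le_vec_addE)
      have "fact (bideg (sel (P - K + N, J) (K, Q - J + N))) \<le> (fact (?g + mdeg N) :: real)"
        using sel[of K' N J K J'] by (intro fact_mono) (simp add: P Q \<gamma> add.commute)
      also have "\<dots> \<le> 2 ^ (?g + mdeg N) * fact ?g * fact (mdeg N)" by (rule fact_add_le)
      finally have "fact (bideg (sel (P - K + N, J) (K, Q - J + N))) powr (2 * \<delta>) \<le>
          (2 ^ (?g + mdeg N) * fact ?g * fact (mdeg N)) powr (2 * \<delta>)"
        using \<delta> by (intro powr_mono2) auto
      also have "\<dots> = (2 ^ (?g + mdeg N)) powr (2 * \<delta>) * fact ?g powr (2 * \<delta>) * fact (mdeg N) powr (2 * \<delta>)"
        by (simp add: powr_mult)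
      also have "\<dots> \<le> 2 ^ (?g + mdeg N) * fact ?g powr (2 * \<delta>) * fact (mdeg N) powr (1/2)"
      proof (intro mult_mono)
        show "(2 ^ (?g + mdeg N)) powr (2 * \<delta>) \<le> (2 :: real) ^ (?g + mdeg N)"
          using \<delta> powr_mono[of "2 * \<delta>" 1 "(2::real) ^ (?g + mdeg N)"] by simp
        show "fact (mdeg N) powr (2 * \<delta>) \<le> (fact (mdeg N) :: real) powr (1/2)" using \<delta> by (intro powr_mono) auto
      qed auto
      finally have 1: "fact (bideg (sel (P - K + N, J) (K, Q - J + N))) powr (2 * \<delta>) \<le>
          2 ^ (?g + mdeg N) * fact ?g powr (2 * \<delta>) * fact (mdeg N) powr (1/2)" .
      have "norm (wick_struct hbar (P - K + N, J) (K, Q - J + N) \<gamma>) =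
          real (mchoose K' K) * real (mchoose J J') / ((2 * hbar) ^ mdeg N * real (mfact N))"
        using wick_struct_eq[OF hbar, of K' N J K J'] hbar
        by (simp add: P Q \<gamma> add.commute[of J' J] norm_mult norm_divide norm_power)
      also have "\<dots> \<le> 2 ^ mdeg P * 2 ^ mdeg Q / ((2 * hbar) ^ mdeg N * (fact (mdeg N) / R ^ mdeg N))"
      proof (intro frac_le mult_mono)
        show "real (mchoose K' K) \<le> 2 ^ mdeg P" using mchoose_le[of K' K] by (simp add: P)
        show "real (mchoose J J') \<le> 2 ^ mdeg Q" using mchoose_le[of J J'] by (simp add: Q add.commute)
        show "fact (mdeg N) / R ^ mdeg N \<le> real (mfact N)"
          using fact_le_mfact[of N] R by (simp add: R_def divide_le_eq mult.commute)
      qed (use hbar R in auto)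
      also have "\<dots> = 2 ^ ?g * (R / (2 * hbar)) ^ mdeg N / fact (mdeg N)"
        by (simp add: \<gamma> power_add power_divide)
      finally have 2: "norm (wick_struct hbar (P - K + N, J) (K, Q - J + N) \<gamma>) \<le>
          2 ^ ?g * (R / (2 * hbar)) ^ mdeg N / fact (mdeg N)" .
      have "t (P - K + N, J) (K, Q - J + N) \<le> (2 ^ (?g + mdeg N) * fact ?g powr (2 * \<delta>) * fact (mdeg N) powr (1/2)) *
          (2 ^ ?g * (R / (2 * hbar)) ^ mdeg N / fact (mdeg N))"
        unfolding t_def by (intro mult_mono 1 2) auto
      also have "\<dots> = 4 ^ ?g * fact ?g powr (2 * \<delta>) * (S ^ mdeg N * (fact (mdeg N) powr (1/2) / fact (mdeg N)))"
      proof -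
        have "(2::real) ^ ?g * 2 ^ ?g = 4 ^ ?g" by (simp flip: power_mult_distrib)
        moreover have "S ^ mdeg N = 2 ^ mdeg N * (R / (2 * hbar)) ^ mdeg N"
          by (simp add: S_def flip: power_mult_distrib)
        ultimately show ?thesis by (simp only: power_add) (simp add: mult_ac)
      qed
      also have "\<dots> \<le> 4 ^ ?g * fact ?g powr (2 * \<delta>) * ((C1 * fact (mdeg N) powr (1/4)) * (fact (mdeg N) powr (1/2) / fact (mdeg N)))"
        by (intro mult_left_mono mult_right_mono C1) auto
      also have "(C1 * fact (mdeg N) powr (1/4)) * (fact (mdeg N) powr (1/2) / fact (mdeg N)) = C1 * m.wt (-(1/4)) N"
      proof -
        have "m.wt (-(1/4)) N = fact (mdeg N) powr (1/4 + 1/2 - 1)" by simp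
        also have "\<dots> = fact (mdeg N) powr (1/4) * fact (mdeg N) powr (1/2) / fact (mdeg N) powr 1"
          by (simp only: powr_diff powr_add)
        finally show ?thesis by simp
      qed
      finally show ?thesis by (simp add: mult_ac)
    qed
    have "(\<Sum>\<alpha>\<in>F. \<Sum>\<beta>\<in>G. t \<alpha> \<beta>) = (\<Sum>(\<alpha>, \<beta>)\<in>F \<times> G. t \<alpha> \<beta>)" by (simp add: sum.cartesian_product)
    also have "\<dots> = (\<Sum>(\<alpha>, \<beta>)\<in>X. t \<alpha> \<beta>)"
      by (rule sum.mono_neutral_right) (use FG in \<open>auto simp: X_def\<close>)
    also have "\<dots> = (\<Sum>x\<in>Y. case_prod t (\<phi> x))"
      unfolding XY using inj by (subst sum.reindex) (auto intro: inj_on_subset)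
    also have "\<dots> \<le> (\<Sum>x\<in>{K. K \<le> P} \<times> {J. J \<le> Q} \<times> H. case_prod t (\<phi> x))"
      using H finite_le_multiindex t0 by (intro sum_mono2) (auto simp: case_prod_unfold)
    also have "\<dots> = (\<Sum>K\<in>{K. K \<le> P}. \<Sum>J\<in>{J. J \<le> Q}. \<Sum>N\<in>H. t (P - K + N, J) (K, Q - J + N))"
      by (simp add: sum.cartesian_product \<phi>_def case_prod_unfold)
    also have "\<dots> \<le> (\<Sum>K\<in>{K. K \<le> P}. \<Sum>J\<in>{J. J \<le> Q}. \<Sum>N\<in>H. (4 ^ ?g * fact ?g powr (2 * \<delta>) * C1) * m.wt (-(1/4)) N)"
      by (intro sum_mono term_le) auto
    also have "\<dots> = real (card {K. K \<le> P}) * real (card {J. J \<le> Q}) *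
        ((4 ^ ?g * fact ?g powr (2 * \<delta>) * C1) * (\<Sum>N\<in>H. m.wt (-(1/4)) N))"
      by (simp add: sum_distrib_left mult.assoc)
    also have "\<dots> \<le> R ^ mdeg P * R ^ mdeg Q * ((4 ^ ?g * fact ?g powr (2 * \<delta>) * C1) * W)"
    proof (intro mult_mono mult_left_mono W H(1))
      have "real (card {K. K \<le> P}) \<le> real ((2 ^ CARD('n)) ^ mdeg P)" by (intro of_nat_mono card_le_multiindex)
      then show "real (card {K. K \<le> P}) \<le> R ^ mdeg P" by (simp add: R_def)
      have "real (card {K. K \<le> Q}) \<le> real ((2 ^ CARD('n)) ^ mdeg Q)" by (intro of_nat_mono card_le_multiindex)
      then show "real (card {K. K \<le> Q}) \<le> R ^ mdeg Q" by (simp add: R_def)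
    qed (use C1 R in \<open>auto intro!: mult_nonneg_nonneg sum_nonneg\<close>)
    also have "\<dots> = (4 * R) ^ ?g * (fact ?g powr (2 * \<delta>) * C1 * W)"
      by (simp add: \<gamma> power_add power_mult_distrib mult_ac)
    also have "\<dots> \<le> (C2 * fact ?g powr (2 * \<delta>)) * (fact ?g powr (2 * \<delta>) * C1 * W)"
      using C1 W0 by (intro mult_right_mono C2) auto
    also have "\<dots> = C1 * C2 * W * (fact ?g powr (2 * \<delta>) * fact ?g powr (2 * \<delta>))" by (simp only: mult_ac)
    also have "fact ?g powr (2 * \<delta>) * fact ?g powr (2 * \<delta>) = (fact ?g :: real) powr (4 * \<delta>)"
      by (simp flip: powr_add)
    finally show ?thesis by (simp add: t_def)
  qed
  then show ?thesis by blast
qed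

text \<open>
  \<open>(0, 0)\<close> is the index of the unit, so every step of the recursion can stay at \<open>\<alpha>\<close> with weight 1.
\<close>

lemma hnorm_zero_ge:
  assumes "hbar > 0" shows "ennreal (norm (a \<alpha>) ^ (2 ^ m)) \<le> hnorm (wick_struct hbar) m 0 \<alpha> a"
proof (induction m)
  case (Suc m)
  obtain I J where \<alpha>: "\<alpha> = (I, J)" by (cases \<alpha>)
  have one: "wick_struct hbar \<alpha> (0, 0) \<alpha> = 1"
    using wick_struct_eq[OF assms, of I 0 J 0 0] by (simp add: \<alpha> mchoose_def)
  have "ennreal (norm (a \<alpha>) ^ (2 ^ Suc m)) = (ennreal (norm (a \<alpha>) ^ (2 ^ m)))\<^sup>2"
    by (simp add: ennreal_power power_mult[symmetric] mult.commute)
  also have "\<dots> \<le> (hnorm (wick_struct hbar) m (0 div 2) \<alpha> a)\<^sup>2 * ennreal (norm (wick_struct hbar \<alpha> (0, 0) \<alpha>))"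
    using power_mono[OF Suc, of 2] by (simp add: one)
  also have "\<dots> \<le> hnorm (wick_struct hbar) (Suc m) 0 \<alpha> a" by (rule hnorm_ge_even) simp
  finally show ?case .
qed simp

text \<open>
  The path \<open>(0, 0)\<close>, \<open>(I, 0)\<close>, \<open>(I, J)\<close>: the first step uses a left factor and the second a right factor, whence the
  label 2, which is even and has an odd half. The second price is squared because it enters one level further down.
\<close>

lemma hnorm_path_ge:
  fixes hbar :: real
  assumes hbar: "hbar > 0"
  shows "ennreal (norm (a (I, J)) ^ (2 ^ (m + 2)) / ((2 * hbar) ^ mdeg I * mfact I * ((2 * hbar) ^ mdeg J * mfact J)\<^sup>2))
    \<le> hnorm (wick_struct hbar) (m + 2) 2 (0, 0) a"
proof -
  let ?h = "hnorm (wick_struct hbar)"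
  have c1: "wick_struct hbar (I, 0) (0, I) (0, 0) = of_real (1 / ((2 * hbar) ^ mdeg I * mfact I))"
    using wick_struct_eq[OF hbar, of 0 I 0 0 0] by (simp add: mchoose_def)
  have c2: "wick_struct hbar (J, 0) (I, J) (I, 0) = of_real (1 / ((2 * hbar) ^ mdeg J * mfact J))"
    using wick_struct_eq[OF hbar, of 0 J 0 I 0] by (simp add: mchoose_def)
  define d1 where "d1 = 1 / ((2 * hbar) ^ mdeg I * mfact I)"
  define d2 where "d2 = 1 / ((2 * hbar) ^ mdeg J * mfact J)"
  have d: "d1 \<ge> 0" "d2 \<ge> 0" using hbar by (auto simp: d1_def d2_def)
  have n1: "norm (wick_struct hbar (I, 0) (0, I) (0, 0)) = d1"
    unfolding c1 d1_def[symmetric] norm_of_real using d by simp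
  have n2: "norm (wick_struct hbar (J, 0) (I, J) (I, 0)) = d2"
    unfolding c2 d2_def[symmetric] norm_of_real using d by simp
  have "ennreal ((norm (a (I, J)) ^ (2 ^ m))\<^sup>2 * d2) = (ennreal (norm (a (I, J)) ^ (2 ^ m)))\<^sup>2 * ennreal (norm (wick_struct hbar (J, 0) (I, J) (I, 0)))"
    using d unfolding n2 by (simp add: ennreal_power ennreal_mult)
  also have "\<dots> \<le> (?h m (1 div 2) (I, J) a)\<^sup>2 * ennreal (norm (wick_struct hbar (J, 0) (I, J) (I, 0)))"
    using hnorm_zero_ge[OF hbar, of a "(I, J)" m] by (intro mult_right_mono power_mono) auto
  also have "\<dots> \<le> ?h (Suc m) 1 (I, 0) a" by (rule hnorm_ge_odd) simp
  finally have 1: "ennreal ((norm (a (I, J)) ^ (2 ^ m))\<^sup>2 * d2) \<le> ?h (Suc m) 1 (I, 0) a" .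
  have "ennreal (((norm (a (I, J)) ^ (2 ^ m))\<^sup>2 * d2)\<^sup>2 * d1) = (ennreal ((norm (a (I, J)) ^ (2 ^ m))\<^sup>2 * d2))\<^sup>2 * ennreal (norm (wick_struct hbar (I, 0) (0, I) (0, 0)))"
    using d unfolding n1 by (subst ennreal_power) (auto simp flip: ennreal_mult)
  also have "\<dots> \<le> (?h (Suc m) (2 div 2) (I, 0) a)\<^sup>2 * ennreal (norm (wick_struct hbar (I, 0) (0, I) (0, 0)))"
    using 1 by (intro mult_right_mono power_mono) auto
  also have "\<dots> \<le> ?h (Suc (Suc m)) 2 (0, 0) a" by (rule hnorm_ge_even) simp
  finally have "ennreal (((norm (a (I, J)) ^ (2 ^ m))\<^sup>2 * d2)\<^sup>2 * d1) \<le> ?h (m + 2) 2 (0, 0) a" by (simp del: hnorm.simps)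
  also have "((norm (a (I, J)) ^ (2 ^ m))\<^sup>2 * d2)\<^sup>2 * d1 =
      norm (a (I, J)) ^ (2 ^ (m + 2)) / ((2 * hbar) ^ mdeg I * mfact I * ((2 * hbar) ^ mdeg J * mfact J)\<^sup>2)"
  proof -
    have "((x ^ (2 ^ m))\<^sup>2)\<^sup>2 = x ^ (2 ^ (m + 2))" for x :: real
      by (simp add: power_mult[symmetric] mult.commute)
    then show ?thesis unfolding d1_def d2_def power_mult_distrib power_divide by simp
  qed
  finally show ?thesis .
qed

lemma hnorm_wick_lower:
  assumes hbar: "hbar > 0"
  shows "\<exists>D. \<forall>m \<alpha> a. ennreal (norm (a \<alpha>) ^ (2 ^ (m + 2))) \<le>
      ennreal (D * fact (bideg \<alpha>) powr 3) * hnorm (wick_struct hbar) (m + 2) 2 (0, 0) a"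
proof -
  define T where "T = max 1 (2 * hbar)"
  have T: "T \<ge> 1" "2 * hbar \<le> T" by (auto simp: T_def)
  obtain D where D: "D > 0" "\<And>k. (T\<^sup>2) ^ k \<le> D * fact k powr 1"
    using power_le_fact_powr[of 1 "T\<^sup>2"] by auto
  have "ennreal (norm (a \<alpha>) ^ (2 ^ (m + 2))) \<le>
      ennreal (D * fact (bideg \<alpha>) powr 3) * hnorm (wick_struct hbar) (m + 2) 2 (0, 0) a" for m \<alpha> a
  proof -
    obtain I J where \<alpha>: "\<alpha> = (I, J)" by (cases \<alpha>)
    define e where "e = (2 * hbar) ^ mdeg I * mfact I * ((2 * hbar) ^ mdeg J * mfact J)\<^sup>2"
    have e: "e > 0" using hbar mfact_pos[of I] mfact_pos[of J] by (simp add: e_def)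
    let ?g = "bideg \<alpha>"
    have "e = ((2 * hbar) ^ mdeg I * ((2 * hbar) ^ mdeg J)\<^sup>2) * ((real (mfact I) * real (mfact J)) * real (mfact J))"
      by (simp add: e_def power2_eq_square mult_ac)
    also have "\<dots> \<le> (T\<^sup>2) ^ ?g * ((fact ?g) * fact ?g)"
    proof (intro mult_mono)
      have "(2 * hbar) ^ mdeg I * ((2 * hbar) ^ mdeg J)\<^sup>2 \<le> T ^ mdeg I * (T ^ mdeg J)\<^sup>2"
        using T hbar by (intro mult_mono power_mono) auto
      also have "\<dots> = T ^ (mdeg I + 2 * mdeg J)" by (simp add: power_add power_mult[symmetric] mult.commute)
      also have "\<dots> \<le> T ^ (2 * ?g)" using T by (intro power_increasing) (auto simp: \<alpha>)
      finally show "(2 * hbar) ^ mdeg I * ((2 * hbar) ^ mdeg J)\<^sup>2 \<le> (T\<^sup>2) ^ ?g" by (simp add: power_mult)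
      have "real (mfact I) * real (mfact J) \<le> fact (mdeg I) * fact (mdeg J)"
        by (intro mult_mono mfact_le_fact) auto
      also have "\<dots> \<le> fact ?g" using fact_add_ge by (simp add: \<alpha>)
      finally show "real (mfact I) * real (mfact J) \<le> fact ?g" .
      show "real (mfact J) \<le> fact ?g"
        by (rule order_trans[OF mfact_le_fact]) (simp add: \<alpha> fact_mono)
    qed auto
    also have "\<dots> \<le> (D * fact ?g powr 1) * (fact ?g * fact ?g)" by (intro mult_right_mono D) auto
    also have "\<dots> = D * fact ?g powr 3" by (simp add: powr_numeral power3_eq_cube)
    finally have e_le: "e \<le> D * fact ?g powr 3" .
    have "ennreal (norm (a \<alpha>) ^ (2 ^ (m + 2))) = ennreal e * ennreal (norm (a \<alpha>) ^ (2 ^ (m + 2)) / e)"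
      using e by (simp add: ennreal_mult[symmetric])
    also have "\<dots> \<le> ennreal (D * fact ?g powr 3) * hnorm (wick_struct hbar) (m + 2) 2 (0, 0) a"
      using hnorm_path_ge[OF hbar, of a I J m] e_le unfolding e_def[symmetric] \<alpha>[symmetric]
      by (intro mult_mono ennreal_leI) simp_all
    finally show ?thesis .
  qed
  then show ?thesis by blast
qed

lemma wick_star_product_index:
  assumes "hbar > 0"
  shows "star_product_index (bideg :: 'n::finite bidx \<Rightarrow> nat) (2 * CARD('n)) (wick_struct hbar)"
proof -
  interpret subfactorial_index "bideg :: 'n bidx \<Rightarrow> nat" "2 * CARD('n)" by (rule bideg_index)
  show ?thesis
  proof
    fix \<delta> :: real assume d: "0 < \<delta>" "\<delta> < 1/4"
    show "\<exists>B. \<forall>\<gamma> F G. finite F \<longrightarrow> finite G \<longrightarrow>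
      (\<Sum>\<alpha>\<in>F. \<Sum>\<beta>\<in>G. wt (2 * \<delta>) \<alpha> * norm (wick_struct hbar \<alpha> \<beta> \<gamma>)) \<le> B * wt (4 * \<delta>) \<gamma>"
      by (rule wick_struct_sum_le[OF assms d, of "\<lambda>\<alpha> \<beta>. \<alpha>"]) simp
    show "\<exists>B. \<forall>\<gamma> F G. finite F \<longrightarrow> finite G \<longrightarrow>
      (\<Sum>\<alpha>\<in>F. \<Sum>\<beta>\<in>G. wt (2 * \<delta>) \<beta> * norm (wick_struct hbar \<alpha> \<beta> \<gamma>)) \<le> B * wt (4 * \<delta>) \<gamma>"
      by (rule wick_struct_sum_le[OF assms d, of "\<lambda>\<alpha> \<beta>. \<beta>"]) simp
  next
    show "\<exists>\<gamma> D. \<forall>m \<alpha> a. ennreal (norm (a \<alpha>) ^ (2 ^ (m + 2))) \<le>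
      ennreal (D * wt 3 \<alpha>) * hnorm (wick_struct hbar) (m + 2) 2 \<gamma> a"
      using hnorm_wick_lower[OF assms] by blast
  qed
qed

section \<open>Associativity of the Wick product\<close>

lemma poly_scale_eq_mult: "poly_scale c f = Poly_Mapping.single 0 c * f"
  unfolding poly_scale_def by (rule mult_map_scale_conv_mult)

lemma pd_z_add: "pd_z N (f + g) = pd_z N f + pd_z N g"
  and pd_zbar_add: "pd_zbar N (f + g) = pd_zbar N f + pd_zbar N g"
  and pd_z_scale: "pd_z N (poly_scale c f) = poly_scale c (pd_z N f)"
  and pd_zbar_scale: "pd_zbar N (poly_scale c f) = poly_scale c (pd_zbar N f)"
  by (auto simp: poly_mapping_eq_iff fun_eq_iff lookup_add lookup_pd_z lookup_pd_zbar lookup_poly_scale algebra_simps)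

definition wick_weight :: "real \<Rightarrow> nat ^ 'n::finite \<Rightarrow> 'n zpoly" where
  "wick_weight hbar N = Poly_Mapping.single 0 (of_real ((2 * hbar) ^ mdeg N / of_nat (mfact N)))"

lemma wick_mult_sum:
  assumes "finite S" "{N. pd_z N f \<noteq> 0} \<subseteq> S"
  shows "wick_mult hbar f g = (\<Sum>N\<in>S. wick_weight hbar N * (pd_z N f * pd_zbar N g))"
  using wick_mult_eq_sum[OF assms, of hbar g] by (simp add: wick_weight_def poly_scale_eq_mult)

lemma wick_mult_add_left: "wick_mult hbar (f + f') g = wick_mult hbar f g + wick_mult hbar f' g"
proof -
  let ?S = "{N. pd_z N f \<noteq> 0} \<union> {N. pd_z N f' \<noteq> 0} \<union> {N. pd_z N (f + f') \<noteq> 0}"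
  have "finite ?S" by (simp add: finite_pd_z_nonzero)
  then have "wick_mult hbar x g = (\<Sum>N\<in>?S. wick_weight hbar N * (pd_z N x * pd_zbar N g))"
    if "x \<in> {f, f', f + f'}" for x using that by (intro wick_mult_sum) auto
  then show ?thesis by (simp add: pd_z_add algebra_simps sum.distrib)
qed

lemma wick_mult_add_right: "wick_mult hbar f (g + g') = wick_mult hbar f g + wick_mult hbar f g'"
  using wick_mult_sum[OF finite_pd_z_nonzero[of f] subset_refl, of hbar]
  by (simp add: pd_zbar_add algebra_simps sum.distrib)

lemma wick_mult_scale_left: "wick_mult hbar (poly_scale c f) g = poly_scale c (wick_mult hbar f g)"
proof -
  let ?S = "{N. pd_z N f \<noteq> 0} \<union> {N. pd_z N (poly_scale c f) \<noteq> 0}"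
  have "finite ?S" by (simp add: finite_pd_z_nonzero)
  then have "wick_mult hbar x g = (\<Sum>N\<in>?S. wick_weight hbar N * (pd_z N x * pd_zbar N g))"
    if "x \<in> {f, poly_scale c f}" for x using that by (intro wick_mult_sum) auto
  then show ?thesis by (simp add: pd_z_scale) (simp add: poly_scale_eq_mult sum_distrib_left mult_ac)
qed

lemma wick_mult_scale_right: "wick_mult hbar f (poly_scale c g) = poly_scale c (wick_mult hbar f g)"
  using wick_mult_sum[OF finite_pd_z_nonzero[of f] subset_refl, of hbar]
  by (simp add: pd_zbar_scale) (simp add: poly_scale_eq_mult sum_distrib_left mult_ac)

lemma wick_mult_zero [simp]: "wick_mult hbar 0 g = 0" "wick_mult hbar f 0 = 0"
  using wick_mult_scale_left[of hbar 0 0 g] wick_mult_scale_right[of hbar f 0 0]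
  by (simp_all add: poly_scale_eq_mult)

lemma wick_mult_sum_left: "wick_mult hbar (\<Sum>x\<in>A. f x) g = (\<Sum>x\<in>A. wick_mult hbar (f x) g)"
  by (induction A rule: infinite_finite_induct) (simp_all add: wick_mult_add_left)

lemma wick_mult_sum_right: "wick_mult hbar g (\<Sum>x\<in>A. f x) = (\<Sum>x\<in>A. wick_mult hbar g (f x))"
  by (induction A rule: infinite_finite_induct) (simp_all add: wick_mult_add_right)

definition idx :: "'n::finite \<Rightarrow> nat ^ 'n" where "idx k = axis k 1"

definition zvar :: "'n::finite \<Rightarrow> 'n zpoly" where "zvar k = Poly_Mapping.single (idx k, 0) 1"
definition zbarvar :: "'n::finite \<Rightarrow> 'n zpoly" where "zbarvar k = Poly_Mapping.single (0, idx k) 1"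

lemma idx_component: "idx k $ j = (if j = k then 1 else 0)"
  by (simp add: idx_def axis_def)

lemma idx_add_eq_iff: "idx k + A = B \<longleftrightarrow> B $ k > 0 \<and> A = B - idx k"
proof
  assume "B $ k > 0 \<and> A = B - idx k"
  then show "idx k + A = B" by (auto simp: vec_eq_iff idx_component)
next
  assume "idx k + A = B"
  then have B: "B = idx k + A" by simp
  show "B $ k > 0 \<and> A = B - idx k" unfolding B by (auto simp: vec_eq_iff idx_component)
qed

lemma mfact_add_idx: "mfact (I + idx k) = (I $ k + 1) * mfact I"
proof -
  have "mfact (I + idx k) = (\<Prod>j\<in>UNIV. (if j = k then I $ k + 1 else 1) * fact (I $ j))"
    unfolding mfact_def by (intro prod.cong) (auto simp: idx_component)
  then show ?thesis by (simp add: prod.distrib mfact_def)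
qed

lemma mdeg_idx [simp]: "mdeg (idx k) = 1"
  by (simp add: mdeg_def idx_component)

text \<open>
  The premise expresses that \<open>\<delta>\<close> is the difference \<open>\<gamma> - \<alpha>\<close>, which exists under the condition \<open>P\<close>.
\<close>

lemma lookup_single_mult:
  fixes f :: "'n::finite zpoly"
  assumes "\<And>\<beta>. \<alpha> + \<beta> = \<gamma> \<longleftrightarrow> P \<and> \<beta> = \<delta>"
  shows "Poly_Mapping.lookup (Poly_Mapping.single \<alpha> c * f) \<gamma> = (if P then c * Poly_Mapping.lookup f \<delta> else 0)"
proof -
  have "Poly_Mapping.single \<alpha> c * f = (\<Sum>\<beta>\<in>Poly_Mapping.keys f. Poly_Mapping.single (\<alpha> + \<beta>) (c * Poly_Mapping.lookup f \<beta>))"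
  proof -
    have "f = (\<Sum>\<beta>\<in>Poly_Mapping.keys f. Poly_Mapping.single \<beta> (Poly_Mapping.lookup f \<beta>))"
      by (auto simp: poly_mapping_eq_iff fun_eq_iff lookup_sum lookup_single when_def in_keys_iff)
    then have "Poly_Mapping.single \<alpha> c * f = Poly_Mapping.single \<alpha> c * (\<Sum>\<beta>\<in>Poly_Mapping.keys f. Poly_Mapping.single \<beta> (Poly_Mapping.lookup f \<beta>))"
      by simp
    then show ?thesis by (simp add: sum_distrib_left mult_single)
  qed
  then show ?thesis
    by (auto simp: lookup_sum lookup_single when_def assms in_keys_iff)
qed

lemma lookup_zvar_mult: "Poly_Mapping.lookup (zvar k * f) (I, J) =
    (if I $ k > 0 then Poly_Mapping.lookup f (I - idx k, J) else 0)"
  unfolding zvar_def using idx_add_eq_iff[of k _ I]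
  by (subst lookup_single_mult[where P = "I $ k > 0" and \<delta> = "(I - idx k, J)"]) auto

lemma lookup_zbarvar_mult: "Poly_Mapping.lookup (zbarvar k * f) (I, J) =
    (if J $ k > 0 then Poly_Mapping.lookup f (I, J - idx k) else 0)"
  unfolding zbarvar_def using idx_add_eq_iff[of k _ J]
  by (subst lookup_single_mult[where P = "J $ k > 0" and \<delta> = "(I, J - idx k)"]) auto

lemma zpoly_eqI: "(\<And>I J. Poly_Mapping.lookup f (I, J) = Poly_Mapping.lookup g (I, J)) \<Longrightarrow> f = (g :: 'n::finite zpoly)"
  by (auto simp: poly_mapping_eq_iff fun_eq_iff)

text \<open>
  Constants, multiplication by the variables, and sums generate all polynomials.
\<close>

lemma zpoly_induct [case_names const z zbar add]:
  fixes f :: "'n::finite zpoly"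
  assumes const: "\<And>c. P (Poly_Mapping.single 0 c)"
    and z: "\<And>k f. P f \<Longrightarrow> P (zvar k * f)" and zbar: "\<And>k f. P f \<Longrightarrow> P (zbarvar k * f)"
    and add: "\<And>f g. P f \<Longrightarrow> P g \<Longrightarrow> P (f + g)"
  shows "P f"
proof -
  have mono: "P (Poly_Mapping.single (I, J) c)" for I J :: "nat ^ 'n" and c
  proof (induction "mdeg I + mdeg J" arbitrary: I J)
    case 0
    have "I = 0" "J = 0" using 0 by (auto simp: mdeg_def vec_eq_iff)
    then show ?case using const by (simp add: zero_prod_def)
  next
    case (Suc n)
    then have "mdeg I \<noteq> 0 \<or> mdeg J \<noteq> 0" by linarith
    then consider k where "I $ k > 0" | k where "J $ k > 0" by (auto simp: mdeg_def)
    then show ?case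
    proof cases
      case 1
      then have I: "idx k + (I - idx k) = I" by (simp add: idx_add_eq_iff)
      then have "mdeg I = 1 + mdeg (I - idx k)" by (metis mdeg_add mdeg_idx)
      then have "P (zvar k * Poly_Mapping.single (I - idx k, J) c)" using Suc by (intro z) auto
      then show ?thesis by (simp add: zvar_def mult_single I)
    next
      case 2
      then have J: "idx k + (J - idx k) = J" by (simp add: idx_add_eq_iff)
      then have "mdeg J = 1 + mdeg (J - idx k)" by (metis mdeg_add mdeg_idx)
      then have "P (zbarvar k * Poly_Mapping.single (I, J - idx k) c)" using Suc by (intro zbar) auto
      then show ?thesis by (simp add: zbarvar_def mult_single J)
    qed
  qed
  have "P (\<Sum>\<alpha>\<in>A. Poly_Mapping.single \<alpha> (Poly_Mapping.lookup f \<alpha>))" if "finite A" for A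
    using that
  proof induction
    case empty show ?case using const[of 0] by simp
  next
    case (insert x F)
    then show ?case using add mono by (cases x) simp
  qed
  moreover have "f = (\<Sum>\<beta>\<in>Poly_Mapping.keys f. Poly_Mapping.single \<beta> (Poly_Mapping.lookup f \<beta>))"
    by (auto simp: poly_mapping_eq_iff fun_eq_iff lookup_sum lookup_single when_def in_keys_iff)
  ultimately show ?thesis by (metis finite_keys)
qed

lemma pd_z_zbarvar_mult: "pd_z N (zbarvar k * f) = zbarvar k * pd_z N f"
  and pd_zbar_zvar_mult: "pd_zbar N (zvar k * f) = zvar k * pd_zbar N f"
  by (rule zpoly_eqI; simp add: lookup_pd_z lookup_pd_zbar lookup_zvar_mult lookup_zbarvar_mult)+

lemma pd_z_zvar_mult:
  "pd_z N (zvar k * f) = zvar k * pd_z N f + (if N $ k = 0 then 0 else of_nat (N $ k) * pd_z (N - idx k) f)"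
proof (rule zpoly_eqI)
  fix I J :: "nat ^ 'a"
  have of_nat_mult: "Poly_Mapping.lookup (of_nat m * g) \<gamma> = of_nat m * Poly_Mapping.lookup g \<gamma>" for m and g :: "'a zpoly" and \<gamma>
    by (simp only: single_of_nat[symmetric] poly_scale_eq_mult[symmetric] lookup_poly_scale)
  have "I $ k = 0 \<or> I $ k > 0" "N $ k = 0 \<or> N $ k > 0" by auto
  then consider "I $ k = 0" "N $ k = 0" | "N $ k > 0" "I $ k = 0" | "N $ k = 0" "I $ k > 0" | "N $ k > 0" "I $ k > 0" by blast
  then show "Poly_Mapping.lookup (pd_z N (zvar k * f)) (I, J) = Poly_Mapping.lookup (zvar k * pd_z N f + (if N $ k = 0 then 0 else of_nat (N $ k) * pd_z (N - idx k) f)) (I, J)"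
  proof cases
    case 1 then show ?thesis by (simp add: lookup_pd_z lookup_zvar_mult lookup_add)
  next
    case 2
    then obtain M where N: "N = M + idx k" by (metis idx_add_eq_iff add.commute)
    have "I + N - idx k = I + M" by (simp add: N vec_eq_iff)
    moreover have "mfact (I + N) = (I $ k + M $ k + 1) * mfact (I + M)"
      using mfact_add_idx[of "I + M" k] by (simp add: N add.assoc)
    moreover have "N - idx k = M" "(I + N) $ k > 0" "N $ k = I $ k + M $ k + 1" "N $ k \<noteq> 0" "\<not> I $ k > 0"
      using 2 by (auto simp: N idx_component)
    ultimately show ?thesis
      by (simp only: lookup_add of_nat_mult lookup_pd_z lookup_zvar_mult if_True if_False) (simp add: algebra_simps)
  next
    case 3
    then obtain L where I: "I = L + idx k" by (metis idx_add_eq_iff add.commute)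
    have e: "I + N - idx k = L + N" by (simp add: I vec_eq_iff)
    obtain u where u: "u > 0" "mfact (I + N) = u * mfact (L + N)" "mfact I = u * mfact L"
      using mfact_add_idx[of "L + N" k] mfact_add_idx[of L k] 3
      by (intro that[of "L $ k + 1"]) (simp_all add: I ac_simps)
    have "I - idx k = L" "(I + N) $ k > 0" using 3 by (simp_all add: I idx_component)
    then show ?thesis using 3 e u
      by (simp only: lookup_add lookup_pd_z lookup_zvar_mult if_True of_nat_mult) simp
  next
    case 4
    obtain L where I: "I = L + idx k" using 4 by (metis idx_add_eq_iff add.commute)
    obtain M where N: "N = M + idx k" using 4 by (metis idx_add_eq_iff add.commute)
    have e: "I + N - idx k = L + M + idx k" "I - idx k + N = L + M + idx k" "I + (N - idx k) = L + M + idx k" "I - idx k = L"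
      by (simp_all add: I N vec_eq_iff)
    define D where "D = L + M + idx k"
    define u where "u = I $ k"
    define v where "v = N $ k"
    have 1: "mfact (I + N) = (u + v) * mfact D" "mfact I = u * mfact L"
      using mfact_add_idx[of "L + M + idx k" k] mfact_add_idx[of L k]
      by (simp_all add: I N D_def u_def v_def ac_simps idx_component)
    have pos: "u > 0" "v \<noteq> 0" "I $ k > 0" "(I + N) $ k > 0" "N $ k = v" using 4 by (auto simp: u_def v_def)
    have *: "((c + d) * x) / (c * y) * z = x / y * z + d * (x / (c * y) * z)"
      if "c \<noteq> 0" "y \<noteq> 0" for c d x y z :: complex using that by (simp add: field_simps)
    have "L + N = D" by (simp add: D_def N ac_simps)
    with *[of "of_nat u" "of_nat (mfact L)" "of_nat v" "of_nat (mfact D)"]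
    show ?thesis using pos
      by (simp only: lookup_add of_nat_mult lookup_pd_z lookup_zvar_mult e[folded D_def] 1 if_True if_False) simp
  qed
qed

abbreviation dzbar :: "'n::finite \<Rightarrow> 'n zpoly \<Rightarrow> 'n zpoly" where "dzbar k \<equiv> pd_zbar (idx k)"

lemma lookup_dzbar: "Poly_Mapping.lookup (dzbar k f) (I, J) = of_nat (J $ k + 1) * Poly_Mapping.lookup f (I, J + idx k)"
  unfolding lookup_pd_zbar mfact_add_idx of_nat_mult by simp

lemma dzbar_zbarvar_mult: "dzbar k (zbarvar j * f) = zbarvar j * dzbar k f + (if j = k then f else 0)"
proof (rule zpoly_eqI)
  fix I J
  show "Poly_Mapping.lookup (dzbar k (zbarvar j * f)) (I, J) =
      Poly_Mapping.lookup (zbarvar j * dzbar k f + (if j = k then f else 0)) (I, J)"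
  proof (cases "J $ j > 0")
    case True
    then obtain L where J: "J = L + idx j" by (metis idx_add_eq_iff add.commute)
    have e: "J + idx k - idx j = L + idx k" "J - idx j = L" by (simp_all add: J vec_eq_iff)
    show ?thesis
    proof (cases "j = k")
      case True
      have "J $ k = L $ k + 1" "J = L + idx k" using True by (auto simp: J idx_component)
      then show ?thesis using True e
        by (simp add: lookup_dzbar lookup_zbarvar_mult lookup_add distrib_right)
    next
      case False
      have "J $ k = L $ k" "J $ j > 0" using False by (auto simp: J idx_component)
      then show ?thesis using False e
        by (simp add: lookup_dzbar lookup_zbarvar_mult lookup_add)
    qed
  next
    case False
    then show ?thesis by (auto simp: lookup_dzbar lookup_zbarvar_mult lookup_add idx_component)
  qed
qed

lemma dzbar_mult: "dzbar k (f * g) = dzbar k f * g + f * dzbar k g"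
proof (induction f rule: zpoly_induct)
  case (const c)
  have "dzbar k (Poly_Mapping.single 0 c) = 0"
    by (simp add: zero_prod_def pd_zbar_single less_eq_vec_def idx_component)
  then show ?case using pd_zbar_scale[of "idx k" c g] by (simp add: poly_scale_eq_mult)
next
  case (z j f) then show ?case by (simp add: mult.assoc pd_zbar_zvar_mult distrib_left)
next
  case (zbar j f) then show ?case by (simp add: mult.assoc dzbar_zbarvar_mult) (simp add: algebra_simps)
next
  case (add f g) then show ?case by (simp add: pd_zbar_add algebra_simps)
qed

lemma pd_zbar_dzbar: "pd_zbar N (dzbar k f) = pd_zbar (N + idx k) f"
proof (rule zpoly_eqI)
  fix I J
  have "mfact (J + (N + idx k)) = (J $ k + N $ k + 1) * mfact (J + N)"
    using mfact_add_idx[of "J + N" k] by (simp add: add.assoc)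
  then show "Poly_Mapping.lookup (pd_zbar N (dzbar k f)) (I, J) = Poly_Mapping.lookup (pd_zbar (N + idx k) f) (I, J)"
    unfolding lookup_pd_zbar[of N] lookup_dzbar lookup_pd_zbar[of "N + idx k"]
    by (simp only: of_nat_mult vector_add_component) (simp add: add.assoc)
qed

lemma dzbar_pd_zbar: "dzbar k (pd_zbar N f) = pd_zbar (N + idx k) f"
proof (rule zpoly_eqI)
  fix I J
  have "mfact (J + idx k) = (J $ k + 1) * mfact J" by (rule mfact_add_idx)
  moreover have "J + idx k + N = J + (N + idx k)" by (simp add: ac_simps)
  moreover have "complex_of_nat (J $ k + 1) \<noteq> 0" by (simp del: of_nat_add of_nat_Suc)
  ultimately show "Poly_Mapping.lookup (dzbar k (pd_zbar N f)) (I, J) = Poly_Mapping.lookup (pd_zbar (N + idx k) f) (I, J)"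
    unfolding lookup_pd_zbar[of N] lookup_dzbar lookup_pd_zbar[of "N + idx k"] by (simp only: of_nat_mult) simp
qed

lemma dzbar_pd_z: "dzbar k (pd_z N f) = pd_z N (dzbar k f)"
  by (rule zpoly_eqI) (simp add: lookup_dzbar lookup_pd_z)

lemma pd_zbar_sum: "pd_zbar N (\<Sum>x\<in>A. f x) = (\<Sum>x\<in>A. pd_zbar N (f x))"
proof (induction A rule: infinite_finite_induct)
  case (insert x F) then show ?case by (simp add: pd_zbar_add)
qed (simp_all add: pd_zbar_def)

lemma dzbar_wick_mult: "dzbar k (wick_mult hbar f g) = wick_mult hbar (dzbar k f) g + wick_mult hbar f (dzbar k g)"
proof -
  let ?S = "{N. pd_z N f \<noteq> 0} \<union> {N. pd_z N (dzbar k f) \<noteq> 0}"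
  have "finite ?S" by (simp add: finite_pd_z_nonzero)
  then have *: "wick_mult hbar x h = (\<Sum>N\<in>?S. wick_weight hbar N * (pd_z N x * pd_zbar N h))"
    if "x \<in> {f, dzbar k f}" for x h using that by (intro wick_mult_sum) auto
  have "dzbar k (wick_weight hbar N * (pd_z N f * pd_zbar N g)) =
    wick_weight hbar N * (pd_z N (dzbar k f) * pd_zbar N g) + wick_weight hbar N * (pd_z N f * pd_zbar N (dzbar k g))" for N
  proof -
    have "dzbar k (wick_weight hbar N * h) = wick_weight hbar N * dzbar k h" for h
      using pd_zbar_scale[of "idx k"] unfolding wick_weight_def poly_scale_eq_mult by blast
    then show ?thesis by (simp add: dzbar_mult dzbar_pd_z dzbar_pd_zbar pd_zbar_dzbar distrib_left)
  qed
  then show ?thesis by (simp add: * pd_zbar_sum sum.distrib)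
qed

lemma wick_mult_zbarvar_left: "wick_mult hbar (zbarvar k * f) g = zbarvar k * wick_mult hbar f g"
proof -
  let ?S = "{N. pd_z N f \<noteq> 0} \<union> {N. pd_z N (zbarvar k * f) \<noteq> 0}"
  have "finite ?S" by (simp add: finite_pd_z_nonzero)
  then have "wick_mult hbar x g = (\<Sum>N\<in>?S. wick_weight hbar N * (pd_z N x * pd_zbar N g))"
    if "x \<in> {f, zbarvar k * f}" for x using that by (intro wick_mult_sum) auto
  then show ?thesis by (simp add: pd_z_zbarvar_mult) (simp add: sum_distrib_left mult_ac)
qed

lemma wick_weight_add_idx:
  "of_nat (N $ k + 1) * wick_weight hbar (N + idx k) = Poly_Mapping.single 0 (of_real (2 * hbar)) * wick_weight hbar N"
proof -
  have "complex_of_nat (N $ k + 1) * of_real ((2 * hbar) ^ mdeg (N + idx k) / of_nat (mfact (N + idx k))) =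
      of_real (2 * hbar) * of_real ((2 * hbar) ^ mdeg N / of_nat (mfact N))"
    unfolding mfact_add_idx of_nat_mult by (simp add: field_simps del: of_nat_Suc of_nat_add)
  then show ?thesis unfolding wick_weight_def single_of_nat[symmetric] mult_single by simp
qed

text \<open>
  By \<open>pd_z_zvar_mult\<close> the \<open>N\<close>-th derivative of \<open>zvar k * f\<close> has the additional term \<open>N\<^sub>k\<close> times a derivative of order
  one less in direction \<open>k\<close>. Shifting \<open>N\<close> by \<open>idx k\<close> moves the surplus derivative to \<open>g\<close>.
\<close>

lemma wick_mult_zvar_left:
  "wick_mult hbar (zvar k * f) g = zvar k * wick_mult hbar f g + poly_scale (of_real (2 * hbar)) (wick_mult hbar f (dzbar k g))"
proof -
  let ?T = "{N. pd_z N f \<noteq> 0}"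
  let ?S = "?T \<union> (\<lambda>N. N + idx k) ` ?T \<union> {N. pd_z N (zvar k * f) \<noteq> 0}"
  have T: "finite ?T" by (rule finite_pd_z_nonzero)
  have S: "finite ?S" by (simp add: finite_pd_z_nonzero)
  let ?r = "\<lambda>N. if N $ k = 0 then 0 else of_nat (N $ k) * wick_weight hbar N * (pd_z (N - idx k) f * pd_zbar N g)"
  have "wick_mult hbar (zvar k * f) g = (\<Sum>N\<in>?S. wick_weight hbar N * (pd_z N (zvar k * f) * pd_zbar N g))"
    by (rule wick_mult_sum[OF S]) auto
  also have "\<dots> = (\<Sum>N\<in>?S. zvar k * (wick_weight hbar N * (pd_z N f * pd_zbar N g)) + ?r N)"
    by (intro sum.cong refl) (simp only: pd_z_zvar_mult, simp add: algebra_simps)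
  also have "\<dots> = zvar k * wick_mult hbar f g + (\<Sum>N\<in>?S. ?r N)"
    by (subst wick_mult_sum[OF S]) (auto simp: sum.distrib sum_distrib_left)
  also have "(\<Sum>N\<in>?S. ?r N) = (\<Sum>N\<in>(\<lambda>N. N + idx k) ` ?T. ?r N)"
  proof (rule sum.mono_neutral_right[OF S])
    show "\<forall>N\<in>?S - (\<lambda>N. N + idx k) ` ?T. ?r N = 0"
    proof
      fix N assume N: "N \<in> ?S - (\<lambda>N. N + idx k) ` ?T"
      show "?r N = 0"
      proof (cases "N $ k = 0")
        case False
        then have "N = (N - idx k) + idx k" using idx_add_eq_iff[of k "N - idx k" N] by (simp add: add.commute)
        then have "N - idx k \<notin> ?T" using N by blast
        then show ?thesis by simp
      qed simp
    qed
  qed blast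
  also have "\<dots> = (\<Sum>N\<in>?T. of_nat (N $ k + 1) * wick_weight hbar (N + idx k) * (pd_z N f * pd_zbar (N + idx k) g))"
    by (subst sum.reindex) (auto simp: inj_on_def idx_component)
  also have "\<dots> = poly_scale (of_real (2 * hbar)) (wick_mult hbar f (dzbar k g))"
    unfolding wick_weight_add_idx
    by (subst wick_mult_sum[OF T subset_refl]) (simp add: pd_zbar_dzbar poly_scale_eq_mult sum_distrib_left mult.assoc)
  finally show ?thesis .
qed

lemma wick_mult_const_left: "wick_mult hbar (Poly_Mapping.single 0 c) g = poly_scale c g"
proof -
  have pd: "pd_z N (Poly_Mapping.single 0 c) = (if N = 0 then Poly_Mapping.single 0 c else 0)" for N :: "nat ^ 'a"
  proof (cases "N = 0")
    case False
    then have "\<not> N \<le> 0" by (auto simp: less_eq_vec_def vec_eq_iff)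
    then show ?thesis using False pd_z_single[of N 0 0 c] by (simp add: zero_prod_def)
  qed (use pd_z_single[of 0 0 0 c] in \<open>simp add: zero_prod_def\<close>)
  have "wick_mult hbar (Poly_Mapping.single 0 c) g = (\<Sum>N\<in>{0}. wick_weight hbar N * (pd_z N (Poly_Mapping.single 0 c) * pd_zbar N g))"
    by (intro wick_mult_sum) (auto simp: pd)
  moreover have "wick_weight hbar (0 :: nat ^ 'a) = 1" by (simp add: wick_weight_def)
  moreover have "pd_zbar 0 g = g" by (rule zpoly_eqI) (simp add: lookup_pd_zbar)
  ultimately show ?thesis
    by (simp add: poly_scale_eq_mult pd)
qed

text \<open>
  Left multiplication by \<open>zbarvar k\<close> is the ordinary one, and left multiplication by \<open>zvar k\<close> differs from the
  ordinary one by \<open>2 hbar\<close> times \<open>dzbar k\<close>, which is a derivation of the Wick product as well. So associativity for \<open>f\<close>, as a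
  statement about all \<open>g\<close> and \<open>h\<close>, passes to the products of \<open>f\<close> with the variables.
\<close>

lemma wick_mult_assoc: "wick_mult hbar (wick_mult hbar f g) h = wick_mult hbar f (wick_mult hbar g h)"
proof (induction f arbitrary: g h rule: zpoly_induct)
  case (const c) show ?case by (simp add: wick_mult_const_left wick_mult_scale_left)
next
  case (z k f)
  then show ?case
    by (simp add: wick_mult_zvar_left wick_mult_add_left wick_mult_add_right wick_mult_scale_left
        dzbar_wick_mult z) (simp add: poly_scale_eq_mult algebra_simps)
next
  case (zbar k f) then show ?case by (simp add: wick_mult_zbarvar_left)
next
  case (add f f') then show ?case by (simp add: wick_mult_add_left)
qed

section \<open>Polynomials inside the completion\<close>

lemma wick_coords_add: "hbar > 0 \<Longrightarrow> wick_coords hbar (f + g) = wick_coords hbar f + wick_coords hbar g"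
  and wick_coords_scale: "hbar > 0 \<Longrightarrow> wick_coords hbar (poly_scale c f) = fam_scale c (wick_coords hbar f)"
  by (auto simp: fun_eq_iff wick_coords_eq lookup_add lookup_poly_scale fam_scale_def algebra_simps)

lemma wick_coords_zero: "hbar > 0 \<Longrightarrow> wick_coords hbar 0 = 0"
  by (auto simp: fun_eq_iff wick_coords_eq)

lemma wick_coords_sum: "hbar > 0 \<Longrightarrow> wick_coords hbar (\<Sum>x\<in>A. f x) = (\<Sum>x\<in>A. wick_coords hbar (f x))"
  by (induction A rule: infinite_finite_induct) (simp_all add: wick_coords_zero wick_coords_add del: plus_fun_apply)

lemma wick_coords_basis: assumes "hbar > 0" shows "wick_coords hbar (wick_basis hbar \<alpha>) = unit_family \<alpha>"
  using assms mfact_pos[of "fst \<alpha>"] mfact_pos[of "snd \<alpha>"]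
  by (auto simp: fun_eq_iff wick_coords_eq unit_family_def wick_basis_def bideg_def lookup_single when_def split: prod.splits)

lemma inj_wick_coords: assumes "hbar > 0" shows "inj (wick_coords hbar :: 'n::finite zpoly \<Rightarrow> _)"
proof (rule injI, rule zpoly_eqI)
  fix f g :: "'n zpoly" and I J assume "wick_coords hbar f = wick_coords hbar g"
  then have "wick_coords hbar f (I, J) = wick_coords hbar g (I, J)" by simp
  then show "Poly_Mapping.lookup f (I, J) = Poly_Mapping.lookup g (I, J)"
    using assms by (simp add: wick_coords_eq)
qed

lemma finite_wick_coords: assumes "hbar > 0" shows "finite {\<alpha>. wick_coords hbar f \<alpha> \<noteq> 0}"
  by (rule finite_subset[of _ "Poly_Mapping.keys f"]) (use assms in \<open>auto simp: wick_coords_eq in_keys_iff\<close>)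

lemma wick_expansion:
  assumes "hbar > 0"
  shows "f = (\<Sum>\<alpha>\<in>Poly_Mapping.keys f. poly_scale (wick_coords hbar f \<alpha>) (wick_basis hbar \<alpha>))"
  using wick_basis_expansion[of hbar f] assms by (simp add: wick_coords_eq)

lemma wick_coords_mult:
  assumes "hbar > 0"
  shows "wick_coords hbar (wick_mult hbar f g) = hat_mult (wick_struct hbar) (wick_coords hbar f) (wick_coords hbar g)"
proof
  fix \<gamma>
  let ?F = "Poly_Mapping.keys f" and ?G = "Poly_Mapping.keys g"
  let ?a = "wick_coords hbar f" and ?b = "wick_coords hbar g"
  have sum_app: "(\<Sum>x\<in>A. h x) \<gamma> = (\<Sum>x\<in>A. h x \<gamma>)" for A and h :: "'a bidx \<Rightarrow> 'a bidx \<Rightarrow> complex"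
    by (induction A rule: infinite_finite_induct) auto
  have "wick_mult hbar f g = (\<Sum>\<alpha>\<in>?F. \<Sum>\<beta>\<in>?G. poly_scale (?a \<alpha>) (poly_scale (?b \<beta>) (wick_mult hbar (wick_basis hbar \<alpha>) (wick_basis hbar \<beta>))))"
    (is "_ = ?R")
  proof -
    have "wick_mult hbar f g = wick_mult hbar (\<Sum>\<alpha>\<in>?F. poly_scale (?a \<alpha>) (wick_basis hbar \<alpha>))
        (\<Sum>\<beta>\<in>?G. poly_scale (?b \<beta>) (wick_basis hbar \<beta>))"
      by (rule arg_cong2[OF wick_expansion[OF assms] wick_expansion[OF assms]])
    also have "\<dots> = ?R"
      by (simp only: wick_mult_sum_left, simp only: wick_mult_sum_right,
          simp only: wick_mult_scale_left, simp only: wick_mult_scale_right)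
    finally show ?thesis .
  qed
  then have "wick_coords hbar (wick_mult hbar f g) \<gamma> = (\<Sum>\<alpha>\<in>?F. \<Sum>\<beta>\<in>?G. wick_struct hbar \<alpha> \<beta> \<gamma> * ?a \<alpha> * ?b \<beta>)"
    by (simp add: wick_coords_sum[OF assms] wick_coords_scale[OF assms] sum_app fam_scale_def wick_struct_def mult_ac)
  also have "\<dots> = (\<Sum>(\<alpha>, \<beta>)\<in>?F \<times> ?G. wick_struct hbar \<alpha> \<beta> \<gamma> * ?a \<alpha> * ?b \<beta>)"
    by (simp add: sum.cartesian_product)
  also have "\<dots> = (\<Sum>\<^sub>\<infinity>(\<alpha>, \<beta>)\<in>?F \<times> ?G. wick_struct hbar \<alpha> \<beta> \<gamma> * ?a \<alpha> * ?b \<beta>)" by simp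
  also have "\<dots> = hat_mult (wick_struct hbar) ?a ?b \<gamma>"
    unfolding hat_mult_def
    by (rule infsum_cong_neutral) (use assms in \<open>auto simp: wick_coords_eq in_keys_iff\<close>)
  finally show "wick_coords hbar (wick_mult hbar f g) \<gamma> = hat_mult (wick_struct hbar) ?a ?b \<gamma>" .
qed

text \<open>
  The dummy argument fixes the type of variables, on which \<open>hbar\<close> does not depend.
\<close>

locale wick =
  fixes hbar :: real and dummy :: "'n::finite itself"
  assumes hbar: "hbar > 0"
begin

abbreviation "C \<equiv> wick_struct hbar :: 'n bidx \<Rightarrow> 'n bidx \<Rightarrow> 'n bidx \<Rightarrow> complex"

sublocale star_product_index "bideg :: 'n bidx \<Rightarrow> nat" "2 * CARD('n)" C
  by (rule wick_star_product_index[OF hbar])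

lemma wick_coords_in_V: "wick_coords hbar f \<in> V" for f :: "'n zpoly"
  by (rule finite_support_in_V) (rule finite_wick_coords[OF hbar])

lemma frechet_algebra_wick: "frechet_algebra fam_scale V K.T (hat_mult C)"
proof (rule frechet_algebra_hat)
  fix \<alpha> \<beta> \<gamma> :: "'n bidx"
  show "hat_mult C (hat_mult C (unit_family \<alpha>) (unit_family \<beta>)) (unit_family \<gamma>) =
      hat_mult C (unit_family \<alpha>) (hat_mult C (unit_family \<beta>) (unit_family \<gamma>))"
    unfolding wick_coords_basis[OF hbar, symmetric] wick_coords_mult[OF hbar, symmetric] wick_mult_assoc ..
qed

lemma closure_polynomials: "K.T closure_of range (wick_coords hbar :: 'n zpoly \<Rightarrow> _) = V"
proof
  show "K.T closure_of range (wick_coords hbar :: 'n zpoly \<Rightarrow> _) \<subseteq> V"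
    using closure_of_subset_topspace[of K.T] by (simp add: topspace_K)
  show "V \<subseteq> K.T closure_of range (wick_coords hbar :: 'n zpoly \<Rightarrow> _)"
  proof
    fix a assume a: "a \<in> V"
    show "a \<in> K.T closure_of range (wick_coords hbar :: 'n zpoly \<Rightarrow> _)"
      unfolding in_closure_of
    proof (intro conjI allI impI)
      show "a \<in> topspace K.T" using a by (simp add: topspace_K)
      fix U assume U: "a \<in> U \<and> openin K.T U"
      then have "\<forall>\<^sub>F F in finite_subsets_at_top UNIV. (\<Sum>\<alpha>\<in>F. fam_scale (a \<alpha>) (unit_family \<alpha>)) \<in> U"
        using expansion_converges[OF a] unfolding limitin_def by blast
      then obtain F where "(\<Sum>\<alpha>\<in>F. fam_scale (a \<alpha>) (unit_family \<alpha>)) \<in> U"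
        unfolding eventually_finite_subsets_at_top by blast
      moreover have "(\<Sum>\<alpha>\<in>F. fam_scale (a \<alpha>) (unit_family \<alpha>)) =
          wick_coords hbar (\<Sum>\<alpha>\<in>F. poly_scale (a \<alpha>) (wick_basis hbar \<alpha>))"
        by (simp only: wick_coords_sum[OF hbar] wick_coords_scale[OF hbar] wick_coords_basis[OF hbar])
      ultimately show "\<exists>y. y \<in> range (wick_coords hbar :: 'n zpoly \<Rightarrow> _) \<and> y \<in> U" by auto
    qed
  qed
qed

lemma completion_wick:
  "frechet_algebra_completion poly_scale (UNIV :: 'n zpoly set) (wick_topology hbar) (wick_mult hbar)
     fam_scale (hat_space C) (hat_topology C) (hat_mult C) (wick_coords hbar)"
  unfolding frechet_algebra_completion_def
proof (intro conjI ballI)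
  show "frechet_algebra fam_scale (hat_space C) (hat_topology C) (hat_mult C)"
    unfolding hat_space_eq hat_topology_eq by (rule frechet_algebra_wick)
  show "range (wick_coords hbar) \<subseteq> hat_space C" unfolding hat_space_eq using wick_coords_in_V by blast
  show "lin_on poly_scale UNIV fam_scale (wick_coords hbar)"
    unfolding lin_on_def using wick_coords_add[OF hbar] wick_coords_scale[OF hbar] by blast
  show "\<And>f g. wick_coords hbar (wick_mult hbar f g) = hat_mult C (wick_coords hbar f) (wick_coords hbar g)"
    by (rule wick_coords_mult[OF hbar])
  show "hat_topology C closure_of range (wick_coords hbar) = hat_space C"
    unfolding hat_space_eq hat_topology_eq by (rule closure_polynomials)
  have diff: "wick_coords hbar (f - g) = wick_coords hbar f - wick_coords hbar g" for f g :: "'n zpoly"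
    using wick_coords_add[OF hbar, of "f - g" g] by (simp add: algebra_simps)
  have "seminorm_family fam_scale (hat_space C) (snorms C)"
  proof -
    interpret vector_space "fam_scale :: complex \<Rightarrow> ('n bidx \<Rightarrow> complex) \<Rightarrow> _" by (rule vector_space_fam_scale)
    show ?thesis
    proof unfold_locales
      show "module.subspace fam_scale (hat_space C)" unfolding hat_space_eq by (rule subspace_V)
      show "\<And>p. p \<in> snorms C \<Longrightarrow> seminorm_on fam_scale (hat_space C) p"
        using seminorm_snorm[of _ _ C] unfolding snorms_def by blast
      show "snorms C \<noteq> {}" unfolding snorms_def by (blast intro: zero_less_power[of "2::nat"] zero_less_numeral)
    qed
  qed
  then show "embedding_map (wick_topology hbar) (hat_topology C) (wick_coords hbar)"
    unfolding wick_topology_def hat_topology_def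
    by (rule embedding_map_lc) (use inj_wick_coords[OF hbar] wick_coords_in_V diff in \<open>auto simp: hat_space_eq[simplified] simp del: fun_diff_def\<close>)
qed

end

section \<open>Monomials and their derivatives\<close>

definition pw :: "complex ^ 'n::finite \<Rightarrow> nat ^ 'n \<Rightarrow> complex" where
  "pw z I = (\<Prod>k\<in>UNIV. (z $ k) ^ (I $ k))"

lemma pw_zero [simp]: "pw z 0 = 1"
  by (simp add: pw_def)

lemma pw_add: "pw z (I + J) = pw z I * pw z J"
  by (simp add: pw_def power_add prod.distrib)

lemma pw_at_zero: "pw 0 I = (if I = 0 then 1 else 0)"
  by (auto simp: pw_def vec_eq_iff)

lemma norm_pw_le:
  assumes "\<And>k. norm (z $ k) \<le> \<rho>" shows "norm (pw z I) \<le> \<rho> ^ mdeg I"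
proof -
  have "norm (pw z I) \<le> (\<Prod>k\<in>UNIV. \<rho> ^ (I $ k))"
    unfolding pw_def prod_norm[symmetric]
    by (intro prod_mono) (auto simp: norm_power intro!: power_mono assms)
  then show ?thesis by (simp add: mdeg_def power_sum)
qed

definition cvec :: "complex ^ 'n::finite \<Rightarrow> complex ^ 'n" where
  "cvec z = (\<chi> k. cnj (z $ k))"

lemma poly_eval_pw: "poly_eval f z = (\<Sum>\<alpha>\<in>Poly_Mapping.keys f. Poly_Mapping.lookup f \<alpha> * pw z (fst \<alpha>) * pw (cvec z) (snd \<alpha>))"
  unfolding poly_eval_def pw_def cvec_def by (intro sum.cong) (auto split: prod.splits)

definition bcoef :: "real \<Rightarrow> 'n::finite bidx \<Rightarrow> real" where
  "bcoef hbar \<alpha> = 1 / (real (mfact (fst \<alpha>)) * real (mfact (snd \<alpha>)) * (2 * hbar) ^ bideg \<alpha>)"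

lemma bcoef_pos: "hbar > 0 \<Longrightarrow> bcoef hbar \<alpha> > 0"
  using mfact_pos[of "fst \<alpha>"] mfact_pos[of "snd \<alpha>"] by (simp add: bcoef_def)

lemma poly_eval_basis:
  assumes "hbar > 0"
  shows "poly_eval (wick_basis hbar \<alpha>) z = of_real (bcoef hbar \<alpha>) * pw z (fst \<alpha>) * pw (cvec z) (snd \<alpha>)"
proof -
  have b: "wick_basis hbar \<alpha> = Poly_Mapping.single \<alpha> (of_real (bcoef hbar \<alpha>))"
    by (cases \<alpha>) (simp add: wick_basis_def bcoef_def)
  show ?thesis unfolding poly_eval_pw b using bcoef_pos[OF assms, of \<alpha>] by simp
qed

lemma bcoef_idx:
  assumes "hbar > 0"
  shows "bcoef hbar (I + idx k, J) * real (I $ k + 1) = bcoef hbar (I, J) / (2 * hbar)"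
    and "bcoef hbar (I, J + idx k) * real (J $ k + 1) = bcoef hbar (I, J) / (2 * hbar)"
  unfolding bcoef_def fst_conv snd_conv mfact_add_idx of_nat_mult bideg_Pair
  using assms by (simp_all del: of_nat_Suc of_nat_add)

lemma pw_line:
  "pw (z + axis k c) I = (z $ k + c) ^ (I $ k) * (\<Prod>j\<in>UNIV - {k}. (z $ j) ^ (I $ j))"
proof -
  have "pw (z + axis k c) I = ((z + axis k c) $ k) ^ (I $ k) * (\<Prod>j\<in>UNIV - {k}. ((z + axis k c) $ j) ^ (I $ j))"
    unfolding pw_def by (rule prod.remove) auto
  also have "(\<Prod>j\<in>UNIV - {k}. ((z + axis k c) $ j) ^ (I $ j)) = (\<Prod>j\<in>UNIV - {k}. (z $ j) ^ (I $ j))"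
    by (intro prod.cong) (auto simp: axis_def)
  finally show ?thesis by (simp add: axis_def)
qed

lemma DERIV_pw_line:
  "((\<lambda>s. pw (z + axis k (c * s)) I) has_field_derivative c * of_nat (I $ k) * pw (z + axis k (c * s)) (I - idx k)) (at s)"
proof -
  let ?R = "\<Prod>j\<in>UNIV - {k}. (z $ j) ^ (I $ j)"
  have "(\<Prod>j\<in>UNIV - {k}. (z $ j) ^ ((I - idx k) $ j)) = ?R"
    by (intro prod.cong) (auto simp: idx_component)
  then have *: "pw (z + axis k (c * s)) (I - idx k) = (z $ k + c * s) ^ (I $ k - 1) * ?R"
    by (simp add: pw_line idx_component)
  have "((\<lambda>s. (z $ k + c * s) ^ (I $ k) * ?R) has_field_derivative
      (of_nat (I $ k) * (z $ k + c * s) ^ (I $ k - 1) * c) * ?R) (at s)"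
    by (auto intro!: derivative_eq_intros)
  then show ?thesis unfolding pw_line[of z k _ I] * by (simp add: mult_ac)
qed

text \<open>
  Along the injection \<open>e\<close> this is the theorem on termwise differentiation of a sequence of functions whose derivatives have a
  summable majorant; indices outside the range of \<open>e\<close> carry zero terms.
\<close>

lemma has_field_derivative_infsum:
  fixes f f' :: "'i \<Rightarrow> complex \<Rightarrow> complex" and e :: "'i \<Rightarrow> nat"
  assumes e: "inj e"
    and der: "\<And>\<alpha> s. s \<in> ball 0 1 \<Longrightarrow> (f \<alpha> has_field_derivative f' \<alpha> s) (at s)"
    and f: "\<And>\<alpha> s. s \<in> ball 0 1 \<Longrightarrow> norm (f \<alpha> s) \<le> M \<alpha>"
    and f': "\<And>\<alpha> s. s \<in> ball 0 1 \<Longrightarrow> norm (f' \<alpha> s) \<le> M \<alpha>"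
    and M: "M summable_on UNIV"
  shows "((\<lambda>s. \<Sum>\<^sub>\<infinity>\<alpha>. f \<alpha> s) has_field_derivative (\<Sum>\<^sub>\<infinity>\<alpha>. f' \<alpha> 0)) (at 0)"
proof -
  define G where "G h k = (if k \<in> range e then h (inv e k) else 0)" for h :: "'i \<Rightarrow> complex" and k
  define N where "N k = (if k \<in> range e then M (inv e k) else 0)" for k
  have G_e: "G h (e \<alpha>) = h \<alpha>" for h and \<alpha> using e by (simp add: G_def)
  have N_e: "N (e \<alpha>) = M \<alpha>" for \<alpha> using e by (simp add: N_def)
  have sumM: "summable N"
  proof -
    have "(N \<circ> e) summable_on UNIV" using M by (simp add: comp_def N_e)
    then have "N summable_on range e" using summable_on_reindex[OF e, of N] by simp
    then have "N summable_on UNIV" by (rule summable_on_cong_neutral[THEN iffD1, rotated -1]) (auto simp: N_def)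
    then show ?thesis by (rule summable_on_imp_summable)
  qed
  have infsum_G: "(\<Sum>\<^sub>\<infinity>\<alpha>. h \<alpha>) = suminf (G h)" "summable (G h)"
    if "\<And>\<alpha>. norm (h \<alpha>) \<le> M \<alpha>" for h :: "'i \<Rightarrow> complex"
  proof -
    have le: "norm (G h k) \<le> N k" for k using that by (auto simp: G_def N_def)
    then have s: "summable (\<lambda>k. norm (G h k))" by (intro summable_comparison_test'[OF sumM]) auto
    then show "summable (G h)" by (rule summable_norm_cancel)
    then have "(G h has_sum suminf (G h)) UNIV" by (intro norm_summable_imp_has_sum[OF s] summable_sums)
    then have "(G h has_sum suminf (G h)) (range e)"
      by (rule has_sum_cong_neutral[THEN iffD1, rotated -1]) (auto simp: G_def)
    then have "(h has_sum suminf (G h)) UNIV" using has_sum_reindex[OF e, of "G h"] by (simp add: comp_def G_e)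
    then show "(\<Sum>\<^sub>\<infinity>\<alpha>. h \<alpha>) = suminf (G h)" by (rule infsumI)
  qed
  have "((\<lambda>s. suminf (G (\<lambda>\<alpha>. f \<alpha> s))) has_field_derivative suminf (G (\<lambda>\<alpha>. f' \<alpha> 0))) (at 0)"
  proof (rule has_field_derivative_series'(2)[where f = "\<lambda>k s. G (\<lambda>\<alpha>. f \<alpha> s) k" and f' = "\<lambda>k s. G (\<lambda>\<alpha>. f' \<alpha> s) k" and S = "ball 0 1" and ?x0.0 = 0])
    fix k and s :: complex assume s: "s \<in> ball 0 1"
    then have "(f \<alpha> has_field_derivative f' \<alpha> s) (at s within ball 0 1)" for \<alpha>
      using der by (blast intro: has_field_derivative_at_within)
    then show "((\<lambda>s. G (\<lambda>\<alpha>. f \<alpha> s) k) has_field_derivative G (\<lambda>\<alpha>. f' \<alpha> s) k) (at s within ball 0 1)"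
      by (simp add: G_def)
  next
    show "uniformly_convergent_on (ball 0 1) (\<lambda>n s. \<Sum>i<n. G (\<lambda>\<alpha>. f' \<alpha> s) i)"
      by (rule Weierstrass_m_test'[OF _ sumM]) (use f' in \<open>auto simp: G_def N_def\<close>)
    show "summable (G (\<lambda>\<alpha>. f \<alpha> 0))" by (rule infsum_G) (use f in auto)
  qed auto
  then have "((\<lambda>s. suminf (G (\<lambda>\<alpha>. f \<alpha> s))) has_field_derivative (\<Sum>\<^sub>\<infinity>\<alpha>. f' \<alpha> 0)) (at 0)"
    using infsum_G(1)[of "\<lambda>\<alpha>. f' \<alpha> 0"] f'[of 0] by simp
  then show ?thesis
    by (rule has_field_derivative_transform_within_open[of _ _ _ "ball 0 1"]) (use infsum_G(1) f in auto)
qed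

section \<open>Taylor series\<close>

context wick
begin

text \<open>
  \<open>1 / (I! J!)\<close> is at most exponential in \<open>|\<alpha>|\<close> times \<open>1 / |\<alpha>|!\<close>, so it outweighs both the growth of \<open>a\<close> and
  any power of \<open>\<rho>\<close>: the Taylor series converges absolutely everywhere.
\<close>

lemma bcoef_summable:
  assumes a: "a \<in> V" and \<rho>: "\<rho> \<ge> 0"
  shows "(\<lambda>\<alpha>. norm (a \<alpha>) * bcoef hbar \<alpha> * \<rho> ^ bideg \<alpha>) summable_on UNIV"
proof -
  define R :: real where "R = 2 ^ CARD('n)"
  have R: "R \<ge> 1" by (simp add: R_def)
  obtain D where D: "D > 0" "\<And>k. (2 * R * \<rho> / (2 * hbar)) ^ k \<le> D * fact k powr (1/4)"
    using power_le_fact_powr[of "1/4" "2 * R * \<rho> / (2 * hbar)"] by auto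
  have "(\<lambda>\<alpha>. (kn (1/4) a * D) * wt (-(1/2)) \<alpha>) summable_on UNIV"
    by (intro summable_on_cmult_right summable_wt) simp
  then show ?thesis
  proof (rule summable_on_comparison_test)
    fix \<alpha> :: "'n bidx"
    let ?g = "bideg \<alpha>"
    obtain I J where \<alpha>: "\<alpha> = (I, J)" by (cases \<alpha>)
    have "(fact ?g :: real) \<le> 2 ^ ?g * fact (mdeg I) * fact (mdeg J)" using fact_add_le by (simp add: \<alpha>)
    also have "\<dots> \<le> 2 ^ ?g * (R ^ mdeg I * real (mfact I)) * (R ^ mdeg J * real (mfact J))"
      unfolding R_def by (intro mult_mono fact_le_mfact) auto
    also have "\<dots> = (2 * R) ^ ?g * (real (mfact I) * real (mfact J))"
      by (simp add: \<alpha> power_add power_mult_distrib mult_ac)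
    finally have "1 / (real (mfact I) * real (mfact J)) \<le> (2 * R) ^ ?g / fact ?g"
      using R mfact_pos[of I] mfact_pos[of J] by (simp add: field_simps)
    then have "1 / (real (mfact I) * real (mfact J)) * (\<rho> ^ ?g / (2 * hbar) ^ ?g) \<le> (2 * R) ^ ?g / fact ?g * (\<rho> ^ ?g / (2 * hbar) ^ ?g)"
      using \<rho> hbar by (intro mult_right_mono) auto
    then have "bcoef hbar \<alpha> * \<rho> ^ ?g \<le> (2 * R * \<rho> / (2 * hbar)) ^ ?g / fact ?g"
      by (simp add: bcoef_def \<alpha> power_divide power_mult_distrib mult_ac)
    also have "\<dots> \<le> D * wt (1/4) \<alpha> / fact ?g" using D by (intro divide_right_mono) auto
    finally have 1: "bcoef hbar \<alpha> * \<rho> ^ ?g \<le> D * wt (1/4) \<alpha> / fact ?g" .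
    have "norm (a \<alpha>) * bcoef hbar \<alpha> * \<rho> ^ ?g \<le> (kn (1/4) a * wt (1/4) \<alpha>) * (D * wt (1/4) \<alpha> / fact ?g)"
      unfolding mult.assoc[of "norm (a \<alpha>)"]
      using 1 norm_le_kn[OF a, of "1/4" \<alpha>] kn_nonneg[OF a, of "1/4"] bcoef_pos[OF hbar, of \<alpha>] \<rho>
      by (intro mult_mono) auto
    also have "\<dots> = (kn (1/4) a * D) * (wt (1/4) \<alpha> * wt (1/4) \<alpha> / wt 1 \<alpha>)" by simp
    also have "wt (1/4) \<alpha> * wt (1/4) \<alpha> / wt 1 \<alpha> = wt (1/4 + 1/4 - 1) \<alpha>" by (simp only: powr_add powr_diff)
    finally show "norm (a \<alpha>) * bcoef hbar \<alpha> * \<rho> ^ ?g \<le> kn (1/4) a * D * wt (-(1/2)) \<alpha>" by simp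
    show "0 \<le> norm (a \<alpha>) * bcoef hbar \<alpha> * \<rho> ^ ?g" using bcoef_pos[OF hbar, of \<alpha>] \<rho> by simp
  qed
qed

lemma norm_monomial_le:
  assumes "\<And>k. norm (z $ k) \<le> \<rho>" "\<And>k. norm (w $ k) \<le> \<rho>"
  shows "norm (of_real (bcoef hbar \<alpha>) * pw z (fst \<alpha>) * pw w (snd \<alpha>)) \<le> bcoef hbar \<alpha> * \<rho> ^ bideg \<alpha>"
proof -
  have "norm (pw z (fst \<alpha>)) * norm (pw w (snd \<alpha>)) \<le> \<rho> ^ mdeg (fst \<alpha>) * \<rho> ^ mdeg (snd \<alpha>)"
    using order_trans[OF norm_ge_zero assms(1)] by (intro mult_mono norm_pw_le assms) auto
  then show ?thesis
    using bcoef_pos[OF hbar, of \<alpha>] by (simp add: norm_mult bideg_def power_add mult.assoc)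
qed

lemma taylor_abs_summable:
  assumes "a \<in> V"
  shows "(\<lambda>\<alpha>. norm (a \<alpha> * poly_eval (wick_basis hbar \<alpha>) z)) summable_on UNIV"
proof (rule summable_on_comparison_test[OF bcoef_summable[OF assms, of "norm z"]])
  fix \<alpha> :: "'n bidx"
  have "norm (poly_eval (wick_basis hbar \<alpha>) z) \<le> bcoef hbar \<alpha> * norm z ^ bideg \<alpha>"
    unfolding poly_eval_basis[OF hbar]
    by (rule norm_monomial_le) (auto simp: cvec_def norm_nth_le Finite_Cartesian_Product.norm_nth_le)
  then show "norm (a \<alpha> * poly_eval (wick_basis hbar \<alpha>) z) \<le> norm (a \<alpha>) * bcoef hbar \<alpha> * norm z ^ bideg \<alpha>"
    by (simp add: norm_mult mult.assoc mult_left_mono)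
qed auto

lemma taylor_has_sum:
  assumes "a \<in> V"
  shows "((\<lambda>\<alpha>. a \<alpha> * poly_eval (wick_basis hbar \<alpha>) z) has_sum taylor_sum hbar a z) UNIV"
  unfolding taylor_sum_def using abs_summable_summable[OF taylor_abs_summable[OF assms, of z]]
  by (rule has_sum_infsum)

text \<open>
  Up to powers of \<open>2 hbar\<close>, Wirtinger derivatives act on Taylor coefficients as shifts.
\<close>

definition shift :: "nat ^ 'n \<Rightarrow> nat ^ 'n \<Rightarrow> ('n bidx \<Rightarrow> complex) \<Rightarrow> 'n bidx \<Rightarrow> complex" where
  "shift A B a = (\<lambda>(I, J). a (I + A, J + B))"

lemma shift_in_V: assumes "a \<in> V" shows "shift A B a \<in> V"
proof (rule subfactorialI)
  fix \<epsilon> :: real assume e: "0 < \<epsilon>" "\<epsilon> < 1"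
  let ?b = "mdeg A + mdeg B"
  obtain C where C: "C > 0" "\<And>k. 2 ^ k \<le> C * fact k powr (\<epsilon>/2)"
    using power_le_fact_powr[of "\<epsilon>/2" 2] e by auto
  have "norm (shift A B a \<alpha>) \<le> (kn (\<epsilon>/2) a * (2 ^ ?b * C * fact ?b)) * wt \<epsilon> \<alpha>" for \<alpha>
  proof -
    obtain I J where \<alpha>: "\<alpha> = (I, J)" by (cases \<alpha>)
    let ?g = "bideg \<alpha>"
    have "norm (shift A B a \<alpha>) \<le> kn (\<epsilon>/2) a * wt (\<epsilon>/2) (I + A, J + B)"
      unfolding shift_def \<alpha> prod.case using e by (intro norm_le_kn assms) auto
    also have "\<dots> \<le> kn (\<epsilon>/2) a * (2 ^ ?b * C * fact ?b * wt \<epsilon> \<alpha>)"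
    proof (rule mult_left_mono)
      show "0 \<le> kn (\<epsilon>/2) a" using kn_nonneg[OF assms, of "\<epsilon>/2"] e by simp
      show "wt (\<epsilon>/2) (I + A, J + B) \<le> 2 ^ ?b * C * fact ?b * wt \<epsilon> \<alpha>"
      proof -
      have g: "bideg (I + A, J + B) = ?g + ?b" by (simp add: \<alpha>)
      have "wt (\<epsilon>/2) (I + A, J + B) \<le> (2 ^ (?g + ?b) * fact ?g * fact ?b) powr (\<epsilon>/2)"
        unfolding g using e fact_add_le[of ?g ?b] by (intro powr_mono2) auto
      also have "\<dots> = (2 ^ (?g + ?b)) powr (\<epsilon>/2) * fact ?g powr (\<epsilon>/2) * fact ?b powr (\<epsilon>/2)"
        by (simp add: powr_mult)
      also have "\<dots> \<le> 2 ^ (?g + ?b) * fact ?g powr (\<epsilon>/2) * fact ?b"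
      proof (intro mult_mono)
        have p: "x powr (\<epsilon>/2) \<le> x" if "x \<ge> 1" for x :: real
          using powr_mono[of "\<epsilon>/2" 1 x] e that by simp
        show "(2 ^ (?g + ?b)) powr (\<epsilon>/2) \<le> (2::real) ^ (?g + ?b)" "fact ?b powr (\<epsilon>/2) \<le> (fact ?b :: real)"
          by (rule p, simp)+
      qed auto
      also have "\<dots> \<le> (C * fact ?g powr (\<epsilon>/2) * 2 ^ ?b) * fact ?g powr (\<epsilon>/2) * fact ?b"
        unfolding power_add by (intro mult_right_mono C) auto
      also have "\<dots> = 2 ^ ?b * C * fact ?b * (fact ?g powr (\<epsilon>/2) * fact ?g powr (\<epsilon>/2))" by simp
      also have "fact ?g powr (\<epsilon>/2) * fact ?g powr (\<epsilon>/2) = wt \<epsilon> \<alpha>" by (simp flip: powr_add)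
      finally show ?thesis .
      qed
    qed
    finally show ?thesis by (simp add: mult_ac)
  qed
  then show "\<exists>c. \<forall>\<alpha>. norm (shift A B a \<alpha>) \<le> c * wt \<epsilon> \<alpha>" by blast
qed

text \<open>
  Terms without the variable \<open>k\<close> have derivative zero. The Boolean \<open>z\<close> selects which of the two multiindices is shifted.
\<close>

lemma infsum_idx_shift:
  fixes g :: "'n bidx \<Rightarrow> complex"
  assumes z: "z \<Longrightarrow> h = (\<lambda>(I, J). (I + idx k, J))" and w: "\<not> z \<Longrightarrow> h = (\<lambda>(I, J). (I, J + idx k))"
    and g: "\<And>I J. (if z then I $ k else J $ k) = 0 \<Longrightarrow> g (I, J) = 0"
  shows "(\<Sum>\<^sub>\<infinity>\<alpha>. g \<alpha>) = (\<Sum>\<^sub>\<infinity>\<alpha>. g (h \<alpha>))"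
proof -
  have inj: "inj h" using z w by (cases z) (auto simp: inj_def)
  have "(\<Sum>\<^sub>\<infinity>\<alpha>. g \<alpha>) = (\<Sum>\<^sub>\<infinity>\<alpha>\<in>range h. g \<alpha>)"
  proof (rule infsum_cong_neutral)
    fix \<alpha> assume \<alpha>: "\<alpha> \<in> UNIV - range h"
    obtain I J where IJ: "\<alpha> = (I, J)" by (cases \<alpha>)
    have "(if z then I $ k else J $ k) = 0"
    proof (rule ccontr)
      assume n: "(if z then I $ k else J $ k) \<noteq> 0"
      show False
      proof (cases z)
        case True
        then have "I = (I - idx k) + idx k" using n idx_add_eq_iff[of k "I - idx k" I] by (simp add: add.commute)
        then have "\<alpha> = h (I - idx k, J)" using z[OF True] IJ by simp
        then show False using \<alpha> by blast
      next
        case False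
        then have "J = (J - idx k) + idx k" using n idx_add_eq_iff[of k "J - idx k" J] by (simp add: add.commute)
        then have "\<alpha> = h (I, J - idx k)" using w[OF False] IJ by simp
        then show False using \<alpha> by blast
      qed
    qed
    then show "g \<alpha> = 0" using g IJ by simp
  qed auto
  also have "\<dots> = (\<Sum>\<^sub>\<infinity>\<alpha>. g (h \<alpha>))" using infsum_reindex[OF inj, of g] by (simp add: comp_def)
  finally show ?thesis .
qed

text \<open>
  On the line \<open>p + s * axis k b\<close> the conjugate variables are replaced by \<open>cvec p + axis k (cnj b * s)\<close>. For real \<open>s\<close>
  these are the conjugates, and for complex \<open>s\<close> every term is holomorphic. In the unit disc all components stay
  below \<open>\<rho> = norm p + 1\<close>, and differentiation costs a factor at most \<open>2 ^ |\<alpha>|\<close>, so that \<open>M\<close> is a summable majorant of the terms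
  and of their derivatives.
\<close>

lemma taylor_sum_directional:
  assumes a: "a \<in> V" and b: "norm b = 1"
  shows "((\<lambda>t::real. taylor_sum hbar a (p + t *\<^sub>R axis k b)) has_vector_derivative
     (b * taylor_sum hbar (shift (idx k) 0 a) p + cnj b * taylor_sum hbar (shift 0 (idx k) a) p) / (2 * hbar)) (at 0)"
proof -
  define z where "z s = p + axis k (b * s)" for s
  define w where "w s = cvec p + axis k (cnj b * s)" for s
  define f where "f \<alpha> s = a \<alpha> * (of_real (bcoef hbar \<alpha>) * pw (z s) (fst \<alpha>) * pw (w s) (snd \<alpha>))" for \<alpha> s
  define dz where "dz \<alpha> s = a \<alpha> * (of_real (bcoef hbar \<alpha>) * (of_nat (fst \<alpha> $ k) * pw (z s) (fst \<alpha> - idx k) * pw (w s) (snd \<alpha>)))" for \<alpha> s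
  define dw where "dw \<alpha> s = a \<alpha> * (of_real (bcoef hbar \<alpha>) * (pw (z s) (fst \<alpha>) * (of_nat (snd \<alpha> $ k) * pw (w s) (snd \<alpha> - idx k))))" for \<alpha> s
  define \<rho> where "\<rho> = norm p + 1"
  have \<rho>: "\<rho> \<ge> 1" by (simp add: \<rho>_def)
  define M where "M \<alpha> = norm (a \<alpha>) * bcoef hbar \<alpha> * (2 * \<rho>) ^ bideg \<alpha>" for \<alpha>
  have M: "M summable_on UNIV" unfolding M_def using \<rho> by (intro bcoef_summable a) auto
  have zle: "norm (z s $ j) \<le> \<rho>" and wle: "norm (w s $ j) \<le> \<rho>" if s: "s \<in> ball 0 1" for s j
  proof -
    have p: "norm (p $ j) \<le> norm p" by (rule Finite_Cartesian_Product.norm_nth_le)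
    have "norm (axis k (b * s) $ j) \<le> 1" "norm (axis k (cnj b * s) $ j) \<le> 1"
      using s b by (auto simp: axis_def norm_mult)
    then show "norm (z s $ j) \<le> \<rho>" "norm (w s $ j) \<le> \<rho>"
      using p norm_triangle_ineq[of "p $ j" "axis k (b * s) $ j"] norm_triangle_ineq[of "cnj (p $ j)" "axis k (cnj b * s) $ j"]
      by (auto simp: z_def w_def \<rho>_def cvec_def)
  qed
  have mdeg_minus: "mdeg (I - idx k) \<le> mdeg I" for I :: "nat ^ 'n" by (rule mdeg_mono) (simp add: less_eq_vec_def)
  have comp_le: "I $ k \<le> mdeg I" for I :: "nat ^ 'n" unfolding mdeg_def by (rule member_le_sum) auto
  have pz: "norm (pw (z s) I) \<le> \<rho> ^ mdeg I" "norm (pw (z s) (I - idx k)) \<le> \<rho> ^ mdeg I"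
    "norm (pw (w s) I) \<le> \<rho> ^ mdeg I" "norm (pw (w s) (I - idx k)) \<le> \<rho> ^ mdeg I" if s: "s \<in> ball 0 1" for s I
    using norm_pw_le[of "z s" \<rho>, OF zle[OF s]] norm_pw_le[of "w s" \<rho>, OF wle[OF s]]
      power_increasing[OF mdeg_minus[of I] \<rho>] by (meson order_trans)+
  have Mge: "norm (a \<alpha>) * (bcoef hbar \<alpha> * (real n * (\<rho> ^ mdeg (fst \<alpha>) * \<rho> ^ mdeg (snd \<alpha>)))) \<le> M \<alpha>"
    if "n \<le> 2 ^ bideg \<alpha>" for n \<alpha>
  proof -
    have "real n \<le> real (2 ^ bideg \<alpha>)" using that by (rule of_nat_mono)
    then have "real n * (\<rho> ^ mdeg (fst \<alpha>) * \<rho> ^ mdeg (snd \<alpha>)) \<le> 2 ^ bideg \<alpha> * \<rho> ^ bideg \<alpha>"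
      using \<rho> by (simp add: bideg_def power_add mult_right_mono)
    then show ?thesis unfolding M_def mult.assoc power_mult_distrib
      using bcoef_pos[OF hbar, of \<alpha>] by (intro mult_left_mono) auto
  qed
  have fM: "norm (f \<alpha> s) \<le> M \<alpha>" if s: "s \<in> ball 0 1" for \<alpha> s
  proof -
    have "norm (f \<alpha> s) = norm (a \<alpha>) * (bcoef hbar \<alpha> * (real 1 * (norm (pw (z s) (fst \<alpha>)) * norm (pw (w s) (snd \<alpha>)))))"
      using bcoef_pos[OF hbar, of \<alpha>] by (simp add: f_def norm_mult mult_ac)
    also have "\<dots> \<le> norm (a \<alpha>) * (bcoef hbar \<alpha> * (real 1 * (\<rho> ^ mdeg (fst \<alpha>) * \<rho> ^ mdeg (snd \<alpha>))))"
      using bcoef_pos[OF hbar, of \<alpha>] \<rho> by (intro mult_left_mono mult_mono pz s) auto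
    also have "\<dots> \<le> M \<alpha>" by (rule Mge) simp
    finally show ?thesis .
  qed
  have dzM: "norm (dz \<alpha> s) \<le> norm (a \<alpha>) * (bcoef hbar \<alpha> * (real (fst \<alpha> $ k) * (\<rho> ^ mdeg (fst \<alpha>) * \<rho> ^ mdeg (snd \<alpha>))))"
    and dwM: "norm (dw \<alpha> s) \<le> norm (a \<alpha>) * (bcoef hbar \<alpha> * (real (snd \<alpha> $ k) * (\<rho> ^ mdeg (fst \<alpha>) * \<rho> ^ mdeg (snd \<alpha>))))"
    if s: "s \<in> ball 0 1" for \<alpha> s
  proof -
    have "norm (dz \<alpha> s) = norm (a \<alpha>) * (bcoef hbar \<alpha> * (real (fst \<alpha> $ k) * (norm (pw (z s) (fst \<alpha> - idx k)) * norm (pw (w s) (snd \<alpha>)))))"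
      using bcoef_pos[OF hbar, of \<alpha>] by (simp add: dz_def norm_mult mult_ac)
    also have "\<dots> \<le> norm (a \<alpha>) * (bcoef hbar \<alpha> * (real (fst \<alpha> $ k) * (\<rho> ^ mdeg (fst \<alpha>) * \<rho> ^ mdeg (snd \<alpha>))))"
      using bcoef_pos[OF hbar, of \<alpha>] \<rho> by (intro mult_left_mono mult_mono pz s) auto
    finally show "norm (dz \<alpha> s) \<le> \<dots>" .
    have "norm (dw \<alpha> s) = norm (a \<alpha>) * (bcoef hbar \<alpha> * (real (snd \<alpha> $ k) * (norm (pw (z s) (fst \<alpha>)) * norm (pw (w s) (snd \<alpha> - idx k)))))"
      using bcoef_pos[OF hbar, of \<alpha>] by (simp add: dw_def norm_mult mult_ac)
    also have "\<dots> \<le> norm (a \<alpha>) * (bcoef hbar \<alpha> * (real (snd \<alpha> $ k) * (\<rho> ^ mdeg (fst \<alpha>) * \<rho> ^ mdeg (snd \<alpha>))))"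
      using bcoef_pos[OF hbar, of \<alpha>] \<rho> by (intro mult_left_mono mult_mono pz s) auto
    finally show "norm (dw \<alpha> s) \<le> \<dots>" .
  qed
  have two: "fst \<alpha> $ k + snd \<alpha> $ k \<le> 2 ^ bideg \<alpha>" for \<alpha>
    using comp_le[of "fst \<alpha>"] comp_le[of "snd \<alpha>"] less_exp[of "bideg \<alpha>"] unfolding bideg_def by linarith
  have dM: "norm (b * dz \<alpha> s + cnj b * dw \<alpha> s) \<le> M \<alpha>" if s: "s \<in> ball 0 1" for \<alpha> s
  proof -
    have "norm (b * dz \<alpha> s + cnj b * dw \<alpha> s) \<le> norm (dz \<alpha> s) + norm (dw \<alpha> s)"
      using norm_triangle_ineq[of "b * dz \<alpha> s" "cnj b * dw \<alpha> s"] b by (simp add: norm_mult)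
    also have "\<dots> \<le> norm (a \<alpha>) * (bcoef hbar \<alpha> * (real (fst \<alpha> $ k + snd \<alpha> $ k) * (\<rho> ^ mdeg (fst \<alpha>) * \<rho> ^ mdeg (snd \<alpha>))))"
      using dzM[OF s, of \<alpha>] dwM[OF s, of \<alpha>] by (simp add: algebra_simps)
    also have "\<dots> \<le> M \<alpha>" by (rule Mge[OF two])
    finally show ?thesis .
  qed
  have der: "(f \<alpha> has_field_derivative b * dz \<alpha> s + cnj b * dw \<alpha> s) (at s)" for \<alpha> s
    unfolding f_def z_def w_def
    by (rule derivative_eq_intros DERIV_pw_line refl)+ (simp add: dz_def dw_def z_def w_def algebra_simps)
  have ab: "norm (dz \<alpha> 0) \<le> M \<alpha>" "norm (dw \<alpha> 0) \<le> M \<alpha>" for \<alpha>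
  proof -
    have "fst \<alpha> $ k \<le> 2 ^ bideg \<alpha>" "snd \<alpha> $ k \<le> 2 ^ bideg \<alpha>" using two[of \<alpha>] by auto
    then show "norm (dz \<alpha> 0) \<le> M \<alpha>" "norm (dw \<alpha> 0) \<le> M \<alpha>"
      using dzM[of 0 \<alpha>] dwM[of 0 \<alpha>] Mge by (meson centre_in_ball order_trans zero_less_one)+
  qed
  have sdz: "(\<lambda>\<alpha>. dz \<alpha> 0) summable_on UNIV" and sdw: "(\<lambda>\<alpha>. dw \<alpha> 0) summable_on UNIV"
    by (rule abs_summable_summable, rule summable_on_comparison_test[OF M], use ab in auto)+
  have z0: "z 0 = p" "w 0 = cvec p" by (simp_all add: z_def w_def axis_def vec_eq_iff)
  have sum_dz: "(\<Sum>\<^sub>\<infinity>\<alpha>. dz \<alpha> 0) = taylor_sum hbar (shift (idx k) 0 a) p / (2 * hbar)"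
  proof -
    have "(\<Sum>\<^sub>\<infinity>\<alpha>. dz \<alpha> 0) = (\<Sum>\<^sub>\<infinity>\<alpha>. dz ((\<lambda>(I, J). (I + idx k, J)) \<alpha>) 0)"
      by (rule infsum_idx_shift[where z = True and k = k]) (auto simp: dz_def)
    also have "\<dots> = (\<Sum>\<^sub>\<infinity>\<alpha>. 1 / (2 * hbar) * (shift (idx k) 0 a \<alpha> * poly_eval (wick_basis hbar \<alpha>) p))"
    proof (rule infsum_cong)
      fix \<alpha> :: "'n bidx"
      obtain I J where \<alpha>: "\<alpha> = (I, J)" by (cases \<alpha>)
      have "complex_of_real (bcoef hbar (I + idx k, J)) * of_nat ((I + idx k) $ k) = of_real (bcoef hbar (I, J) / (2 * hbar))"
        using arg_cong[OF bcoef_idx(1)[OF hbar, of I k J], of complex_of_real] by (simp add: idx_component)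
      moreover have "dz ((\<lambda>(I, J). (I + idx k, J)) \<alpha>) 0 = a (I + idx k, J) *
          (complex_of_real (bcoef hbar (I + idx k, J)) * of_nat ((I + idx k) $ k)) * pw p I * pw (cvec p) J"
        by (simp add: dz_def \<alpha> z0 mult_ac)
      ultimately show "dz ((\<lambda>(I, J). (I + idx k, J)) \<alpha>) 0 = 1 / (2 * hbar) * (shift (idx k) 0 a \<alpha> * poly_eval (wick_basis hbar \<alpha>) p)"
        by (simp add: poly_eval_basis[OF hbar] shift_def \<alpha>)
    qed
    also have "\<dots> = 1 / (2 * hbar) * taylor_sum hbar (shift (idx k) 0 a) p"
      unfolding taylor_sum_def by (rule infsum_cmult_right')
    finally show ?thesis by simp
  qed
  have sum_dw: "(\<Sum>\<^sub>\<infinity>\<alpha>. dw \<alpha> 0) = taylor_sum hbar (shift 0 (idx k) a) p / (2 * hbar)"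
  proof -
    have "(\<Sum>\<^sub>\<infinity>\<alpha>. dw \<alpha> 0) = (\<Sum>\<^sub>\<infinity>\<alpha>. dw ((\<lambda>(I, J). (I, J + idx k)) \<alpha>) 0)"
      by (rule infsum_idx_shift[where z = False and k = k]) (auto simp: dw_def)
    also have "\<dots> = (\<Sum>\<^sub>\<infinity>\<alpha>. 1 / (2 * hbar) * (shift 0 (idx k) a \<alpha> * poly_eval (wick_basis hbar \<alpha>) p))"
    proof (rule infsum_cong)
      fix \<alpha> :: "'n bidx"
      obtain I J where \<alpha>: "\<alpha> = (I, J)" by (cases \<alpha>)
      have "complex_of_real (bcoef hbar (I, J + idx k)) * of_nat ((J + idx k) $ k) = of_real (bcoef hbar (I, J) / (2 * hbar))"
        using arg_cong[OF bcoef_idx(2)[OF hbar, of I J k], of complex_of_real] by (simp add: idx_component)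
      moreover have "dw ((\<lambda>(I, J). (I, J + idx k)) \<alpha>) 0 = a (I, J + idx k) *
          (complex_of_real (bcoef hbar (I, J + idx k)) * of_nat ((J + idx k) $ k)) * pw p I * pw (cvec p) J"
        by (simp add: dw_def \<alpha> z0 mult_ac)
      ultimately show "dw ((\<lambda>(I, J). (I, J + idx k)) \<alpha>) 0 = 1 / (2 * hbar) * (shift 0 (idx k) a \<alpha> * poly_eval (wick_basis hbar \<alpha>) p)"
        by (simp add: poly_eval_basis[OF hbar] shift_def \<alpha>)
    qed
    also have "\<dots> = 1 / (2 * hbar) * taylor_sum hbar (shift 0 (idx k) a) p"
      unfolding taylor_sum_def by (rule infsum_cmult_right')
    finally show ?thesis by simp
  qed
  obtain e :: "'n bidx \<Rightarrow> nat" where e: "inj e" using enumeration by blast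
  have "((\<lambda>s. \<Sum>\<^sub>\<infinity>\<alpha>. f \<alpha> s) has_field_derivative (\<Sum>\<^sub>\<infinity>\<alpha>. b * dz \<alpha> 0 + cnj b * dw \<alpha> 0)) (at (of_real 0))"
    using has_field_derivative_infsum[OF e der fM dM M] by simp
  then have "((\<lambda>t. \<Sum>\<^sub>\<infinity>\<alpha>. f \<alpha> (of_real t)) has_vector_derivative (\<Sum>\<^sub>\<infinity>\<alpha>. b * dz \<alpha> 0 + cnj b * dw \<alpha> 0)) (at 0)"
    by (rule has_vector_derivative_real_field)
  moreover have "(\<lambda>t. \<Sum>\<^sub>\<infinity>\<alpha>. f \<alpha> (of_real t)) = (\<lambda>t. taylor_sum hbar a (p + t *\<^sub>R axis k b))"
  proof
    fix t :: real
    have "z (of_real t) = p + t *\<^sub>R axis k b" "w (of_real t) = cvec (p + t *\<^sub>R axis k b)"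
      by (auto simp: z_def w_def vec_eq_iff axis_def cvec_def scaleR_conv_of_real[where 'a=complex] mult.commute)
    then show "(\<Sum>\<^sub>\<infinity>\<alpha>. f \<alpha> (of_real t)) = taylor_sum hbar a (p + t *\<^sub>R axis k b)"
      by (simp add: f_def taylor_sum_def poly_eval_basis[OF hbar])
  qed
  moreover have "(\<Sum>\<^sub>\<infinity>\<alpha>. b * dz \<alpha> 0 + cnj b * dw \<alpha> 0) =
      (b * taylor_sum hbar (shift (idx k) 0 a) p + cnj b * taylor_sum hbar (shift 0 (idx k) a) p) / (2 * hbar)"
    by (subst infsum_add) (auto simp: sdz sdw summable_on_cmult_right infsum_cmult_right' sum_dz sum_dw add_divide_distrib)
  ultimately show ?thesis by simp
qed

lemma wirtinger_taylor_sum: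
  assumes a: "a \<in> V"
  shows "wirtinger_z k (taylor_sum hbar a) = (\<lambda>p. taylor_sum hbar (shift (idx k) 0 a) p / (2 * hbar))"
    and "wirtinger_zbar k (taylor_sum hbar a) = (\<lambda>p. taylor_sum hbar (shift 0 (idx k) a) p / (2 * hbar))"
proof -
  note D = taylor_sum_directional[OF a, THEN vector_derivative_at]
  show "wirtinger_z k (taylor_sum hbar a) = (\<lambda>p. taylor_sum hbar (shift (idx k) 0 a) p / (2 * hbar))"
    unfolding wirtinger_z_def using hbar by (auto simp: D fun_eq_iff field_simps)
  show "wirtinger_zbar k (taylor_sum hbar a) = (\<lambda>p. taylor_sum hbar (shift 0 (idx k) a) p / (2 * hbar))"
    unfolding wirtinger_zbar_def using hbar by (auto simp: D fun_eq_iff field_simps)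
qed

lemma taylor_sum_scale: "taylor_sum hbar (fam_scale c a) = (\<lambda>p. c * taylor_sum hbar a p)"
  by (auto simp: taylor_sum_def fam_scale_def mult.assoc infsum_cmult_right' fun_eq_iff)

lemma taylor_sum_zero: "taylor_sum hbar a 0 = a (0, 0)" for a :: "'n bidx \<Rightarrow> complex"
proof -
  have "cvec (0 :: complex ^ 'n) = 0" by (simp add: cvec_def vec_eq_iff)
  then have "poly_eval (wick_basis hbar \<alpha>) 0 = (if \<alpha> = (0, 0) then 1 else 0)" for \<alpha> :: "'n bidx"
    by (cases \<alpha>) (auto simp: poly_eval_basis[OF hbar] pw_at_zero bcoef_def)
  then have "taylor_sum hbar a 0 = (\<Sum>\<^sub>\<infinity>\<alpha>\<in>{(0, 0)}. a \<alpha> * (if \<alpha> = (0, 0) then 1 else 0))"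
    unfolding taylor_sum_def by (intro infsum_cong_neutral) auto
  then show ?thesis by simp
qed

definition multiplicities :: "'n list \<Rightarrow> nat ^ 'n" where "multiplicities ks = (\<chi> k. count_list ks k)"

lemma multiplicities_simps [simp]: "multiplicities [] = 0" "multiplicities (k # ks) = multiplicities ks + idx k"
  by (auto simp: multiplicities_def vec_eq_iff idx_component)

lemma iterated_wirtinger:
  assumes a: "a \<in> V"
  shows "foldr wirtinger_z ks (foldr wirtinger_zbar ls (taylor_sum hbar a)) =
    taylor_sum hbar (fam_scale (of_real ((1 / (2 * hbar)) ^ (length ks + length ls))) (shift (multiplicities ks) (multiplicities ls) a))"
proof -
  have scale_V: "fam_scale c (shift A B a) \<in> V" for c A B by (intro V_scale shift_in_V a)
  have sh: "shift A B (fam_scale c (shift A' B' a)) = fam_scale c (shift (A' + A) (B' + B) a)" for c A B A' B'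
    by (auto simp: shift_def fam_scale_def fun_eq_iff ac_simps)
  have zbar: "foldr wirtinger_zbar ls (taylor_sum hbar a) =
      taylor_sum hbar (fam_scale (of_real ((1 / (2 * hbar)) ^ length ls)) (shift 0 (multiplicities ls) a))"
  proof (induction ls)
    case Nil
    have "fam_scale (of_real ((1 / (2 * hbar)) ^ length ([] :: 'n list))) (shift 0 (multiplicities []) a) = a"
      by (auto simp: fam_scale_def shift_def)
    then show ?case by simp
  next
    case (Cons l ls)
    show ?case
      by (simp add: Cons wirtinger_taylor_sum(2)[OF scale_V] sh) (simp add: taylor_sum_scale)
  qed
  show ?thesis
  proof (induction ks)
    case Nil
    show ?case by (simp add: zbar)
  next
    case (Cons k ks)
    show ?case by (simp add: Cons wirtinger_taylor_sum(1)[OF scale_V] sh) (simp add: taylor_sum_scale)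
  qed
qed

lemma taylor_expansion_taylor_sum:
  assumes a: "a \<in> V" shows "taylor_expansion hbar (taylor_sum hbar a) a"
  unfolding taylor_expansion_def
proof (intro conjI allI)
  fix ks ls :: "'n list"
  have "(complex_of_real (2 * hbar)) ^ m * of_real ((1 / (2 * hbar)) ^ m) = 1" for m
    using hbar by (simp add: power_divide)
  then show "a (\<chi> k. count_list ks k, \<chi> k. count_list ls k) = of_real ((2 * hbar) ^ (length ks + length ls)) *
      foldr wirtinger_z ks (foldr wirtinger_zbar ls (taylor_sum hbar a)) 0"
    unfolding iterated_wirtinger[OF a] taylor_sum_zero
    by (simp add: fam_scale_def shift_def multiplicities_def mult.assoc[symmetric])
qed (rule taylor_has_sum[OF a])

text \<open>
  Every pair of multiindices is the pair of multiplicities of two sequences of variables, so the iterated derivatives at the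
  origin determine all coefficients.
\<close>

lemma taylor_coefficients_unique:
  assumes "taylor_expansion hbar f a" "taylor_expansion hbar f b" shows "a = (b :: 'n bidx \<Rightarrow> complex)"
proof
  fix \<alpha> :: "'n bidx"
  have "\<exists>ks. I = (\<chi> k. count_list ks k)" for I :: "nat ^ 'n"
  proof (induction "mdeg I" arbitrary: I)
    case 0
    then have "I = multiplicities []" by (auto simp: mdeg_def vec_eq_iff)
    then show ?case unfolding multiplicities_def by blast
  next
    case (Suc m)
    then have "mdeg I \<noteq> 0" by linarith
    then obtain k where "I $ k > 0" by (auto simp: mdeg_def)
    then have I: "idx k + (I - idx k) = I" by (simp add: idx_add_eq_iff)
    then have "mdeg I = 1 + mdeg (I - idx k)" by (metis mdeg_add mdeg_idx)
    then obtain ks where "I - idx k = multiplicities ks" using Suc(1)[of "I - idx k"] Suc(2) unfolding multiplicities_def by auto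
    then have "I = multiplicities (k # ks)" using I by (simp add: add.commute)
    then show ?case unfolding multiplicities_def by blast
  qed
  then obtain ks ls where "\<alpha> = (\<chi> k. count_list ks k, \<chi> k. count_list ls k)" by (metis surj_pair)
  then show "a \<alpha> = b \<alpha>" using assms unfolding taylor_expansion_def by metis
qed

lemma taylor_sum_wick_coords: "taylor_sum hbar (wick_coords hbar f) = poly_eval f" for f :: "'n zpoly"
proof
  fix z
  have "taylor_sum hbar (wick_coords hbar f) z =
      (\<Sum>\<^sub>\<infinity>\<alpha>\<in>Poly_Mapping.keys f. wick_coords hbar f \<alpha> * poly_eval (wick_basis hbar \<alpha>) z)"
    unfolding taylor_sum_def
    by (rule infsum_cong_neutral) (use hbar in \<open>auto simp: wick_coords_eq in_keys_iff\<close>)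
  also have "\<dots> = (\<Sum>\<alpha>\<in>Poly_Mapping.keys f. wick_coords hbar f \<alpha> * poly_eval (wick_basis hbar \<alpha>) z)" by simp
  also have "\<dots> = poly_eval f z"
    unfolding poly_eval_pw[of f] using hbar
    by (intro sum.cong refl) (simp add: poly_eval_basis wick_coords_eq bcoef_def)
  finally show "taylor_sum hbar (wick_coords hbar f) z = poly_eval f z" .
qed

end

section \<open>Real-analyticity\<close>

text \<open>
  Polynomials with two independent vectors of variables. They will be evaluated at the real and the imaginary
  parts of a displacement, in which the translates of the basis monomials are polynomials.
\<close>

definition evalp :: "'n::finite zpoly \<Rightarrow> complex ^ 'n \<Rightarrow> complex ^ 'n \<Rightarrow> complex" where
  "evalp f x y = (\<Sum>\<alpha>\<in>Poly_Mapping.keys f. Poly_Mapping.lookup f \<alpha> * (pw x (fst \<alpha>) * pw y (snd \<alpha>)))"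

text \<open>
  This norm is submultiplicative and bounds the sum of the absolute values of all monomials on the unit polydisc.
\<close>

definition l1norm :: "'n::finite zpoly \<Rightarrow> real" where
  "l1norm f = (\<Sum>\<alpha>\<in>Poly_Mapping.keys f. norm (Poly_Mapping.lookup f \<alpha>))"

lemma evalp_superset:
  assumes "finite S" "Poly_Mapping.keys f \<subseteq> S"
  shows "evalp f x y = (\<Sum>\<alpha>\<in>S. Poly_Mapping.lookup f \<alpha> * (pw x (fst \<alpha>) * pw y (snd \<alpha>)))"
  unfolding evalp_def by (rule sum.mono_neutral_left) (use assms in \<open>auto simp: in_keys_iff\<close>)

lemma l1norm_superset:
  assumes "finite S" "Poly_Mapping.keys f \<subseteq> S"
  shows "l1norm f = (\<Sum>\<alpha>\<in>S. norm (Poly_Mapping.lookup f \<alpha>))"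
  unfolding l1norm_def by (rule sum.mono_neutral_left) (use assms in \<open>auto simp: in_keys_iff\<close>)

lemma evalp_add: "evalp (f + g) x y = evalp f x y + evalp g x y"
proof -
  let ?S = "Poly_Mapping.keys f \<union> Poly_Mapping.keys g"
  have S: "finite ?S" "Poly_Mapping.keys (f + g) \<subseteq> ?S" using Poly_Mapping.keys_add[of f g] by auto
  show ?thesis
    unfolding evalp_superset[OF S] evalp_superset[OF S(1), of f, OF Un_upper1] evalp_superset[OF S(1), of g, OF Un_upper2]
    by (simp add: lookup_add distrib_right sum.distrib)
qed

lemma l1norm_add: "l1norm (f + g) \<le> l1norm f + l1norm g"
proof -
  let ?S = "Poly_Mapping.keys f \<union> Poly_Mapping.keys g"
  have S: "finite ?S" "Poly_Mapping.keys (f + g) \<subseteq> ?S" using Poly_Mapping.keys_add[of f g] by auto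
  show ?thesis
    unfolding l1norm_superset[OF S] l1norm_superset[OF S(1), of f, OF Un_upper1] l1norm_superset[OF S(1), of g, OF Un_upper2]
    by (simp add: lookup_add sum.distrib[symmetric] sum_mono norm_triangle_ineq)
qed

lemma evalp_zero [simp]: "evalp 0 x y = 0" and l1norm_zero [simp]: "l1norm 0 = 0"
  by (simp_all add: evalp_def l1norm_def)

lemma evalp_sum: "evalp (\<Sum>i\<in>A. f i) x y = (\<Sum>i\<in>A. evalp (f i) x y)"
  by (induction A rule: infinite_finite_induct) (simp_all add: evalp_add)

lemma l1norm_sum: "l1norm (\<Sum>i\<in>A. f i) \<le> (\<Sum>i\<in>A. l1norm (f i))"
proof (induction A rule: infinite_finite_induct)
  case (insert x F)
  then show ?case using l1norm_add[of "f x" "\<Sum>i\<in>F. f i"] by simp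
qed simp_all

lemma l1norm_nonneg: "0 \<le> l1norm f"
  unfolding l1norm_def by (rule sum_nonneg) simp

lemma evalp_single [simp]: "evalp (Poly_Mapping.single \<alpha> c) x y = c * (pw x (fst \<alpha>) * pw y (snd \<alpha>))"
  by (cases "c = 0") (simp_all add: evalp_def)

lemma l1norm_single [simp]: "l1norm (Poly_Mapping.single \<alpha> c) = norm c"
  by (cases "c = 0") (simp_all add: l1norm_def)

lemma zpoly_sum_singles:
  "f = (\<Sum>\<alpha>\<in>Poly_Mapping.keys f. Poly_Mapping.single \<alpha> (Poly_Mapping.lookup f \<alpha>))" for f :: "'n::finite zpoly"
  by (auto simp: poly_mapping_eq_iff fun_eq_iff lookup_sum lookup_single when_def in_keys_iff)

lemma zpoly_mult_sum_singles:
  "f * g = (\<Sum>\<alpha>\<in>Poly_Mapping.keys f. \<Sum>\<beta>\<in>Poly_Mapping.keys g.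
     Poly_Mapping.single (\<alpha> + \<beta>) (Poly_Mapping.lookup f \<alpha> * Poly_Mapping.lookup g \<beta>))" for f g :: "'n::finite zpoly"
proof -
  have "f * g = (\<Sum>\<alpha>\<in>Poly_Mapping.keys f. Poly_Mapping.single \<alpha> (Poly_Mapping.lookup f \<alpha>)) *
      (\<Sum>\<beta>\<in>Poly_Mapping.keys g. Poly_Mapping.single \<beta> (Poly_Mapping.lookup g \<beta>))"
    by (rule arg_cong2[OF zpoly_sum_singles zpoly_sum_singles])
  then show ?thesis by (simp only: sum_product mult_single)
qed

lemma evalp_mult: "evalp (f * g) x y = evalp f x y * evalp g x y"
  by (subst zpoly_mult_sum_singles) (simp add: evalp_sum evalp_def[of f] evalp_def[of g] sum_product pw_add mult_ac)

lemma l1norm_mult: "l1norm (f * g) \<le> l1norm f * l1norm g"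
proof -
  have "l1norm (f * g) \<le> (\<Sum>\<alpha>\<in>Poly_Mapping.keys f. \<Sum>\<beta>\<in>Poly_Mapping.keys g.
     l1norm (Poly_Mapping.single (\<alpha> + \<beta>) (Poly_Mapping.lookup f \<alpha> * Poly_Mapping.lookup g \<beta>)))"
    by (subst zpoly_mult_sum_singles) (intro order_trans[OF l1norm_sum] sum_mono l1norm_sum)
  then show ?thesis by (simp add: l1norm_def[of f] l1norm_def[of g] sum_product norm_mult)
qed

lemma evalp_one [simp]: "evalp 1 x y = 1" and l1norm_one [simp]: "l1norm 1 = 1"
  using evalp_single[of 0 1 x y] l1norm_single[of 0 1] by simp_all

lemma evalp_power: "evalp (f ^ m) x y = evalp f x y ^ m"
  by (induction m) (simp_all add: evalp_mult)

lemma l1norm_power: "l1norm (f ^ m) \<le> l1norm f ^ m"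
proof (induction m)
  case (Suc m)
  have "l1norm (f * f ^ m) \<le> l1norm f * l1norm (f ^ m)" by (rule l1norm_mult)
  also have "\<dots> \<le> l1norm f * l1norm f ^ m" by (intro mult_left_mono Suc l1norm_nonneg)
  finally show ?case by simp
qed simp

lemma evalp_prod: "evalp (\<Prod>i\<in>A. f i) x y = (\<Prod>i\<in>A. evalp (f i) x y)"
  by (induction A rule: infinite_finite_induct) (simp_all add: evalp_mult)

lemma l1norm_prod: "l1norm (\<Prod>i\<in>A. f i) \<le> (\<Prod>i\<in>A. l1norm (f i))"
proof (induction A rule: infinite_finite_induct)
  case (insert x F)
  have "l1norm (f x * (\<Prod>i\<in>F. f i)) \<le> l1norm (f x) * l1norm (\<Prod>i\<in>F. f i)" by (rule l1norm_mult)
  also have "\<dots> \<le> l1norm (f x) * (\<Prod>i\<in>F. l1norm (f i))" by (intro mult_left_mono insert.IH l1norm_nonneg)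
  finally show ?case using insert by simp
qed simp_all

lemma pw_idx [simp]: "pw z (idx k) = z $ k"
proof -
  have "pw z (idx k) = (\<Prod>j\<in>UNIV. if j = k then z $ k else 1)"
    unfolding pw_def by (intro prod.cong) (auto simp: idx_component)
  then show ?thesis by simp
qed

text \<open>
  With \<open>c = p\<^sub>k\<close> and \<open>w = \<i>\<close> this is \<open>p\<^sub>k + x\<^sub>k + \<i> y\<^sub>k\<close>; the conjugate coordinate has \<open>c = cnj p\<^sub>k\<close> and \<open>w = -\<i>\<close>.
\<close>

definition affine :: "complex \<Rightarrow> complex \<Rightarrow> 'n::finite \<Rightarrow> 'n zpoly" where
  "affine c w k = Poly_Mapping.single 0 c + Poly_Mapping.single (idx k, 0) 1 + Poly_Mapping.single (0, idx k) w"

lemma evalp_affine: "evalp (affine c w k) x y = c + x $ k + w * y $ k"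
  by (simp add: affine_def evalp_add)

lemma l1norm_affine: "norm w = 1 \<Longrightarrow> l1norm (affine c w k) \<le> norm c + 2"
  using l1norm_add[of "Poly_Mapping.single 0 c + Poly_Mapping.single (idx k, 0) 1" "Poly_Mapping.single (0, idx k) w"]
    l1norm_add[of "Poly_Mapping.single 0 c" "Poly_Mapping.single (idx k, 0) 1"]
  by (simp add: affine_def)

text \<open>
  The basis monomial at \<open>p + u\<close> as a polynomial in the real and imaginary parts of \<open>u\<close>.
\<close>

definition translate :: "real \<Rightarrow> complex ^ 'n::finite \<Rightarrow> 'n bidx \<Rightarrow> 'n zpoly" where
  "translate hbar p \<alpha> = Poly_Mapping.single 0 (of_real (bcoef hbar \<alpha>)) *
     ((\<Prod>k\<in>UNIV. affine (p $ k) \<i> k ^ (fst \<alpha> $ k)) * (\<Prod>k\<in>UNIV. affine (cnj (p $ k)) (-\<i>) k ^ (snd \<alpha> $ k)))"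

lemma evalp_translate:
  assumes "hbar > 0"
  shows "evalp (translate hbar p \<alpha>) (\<chi> k. of_real (Re (u $ k))) (\<chi> k. of_real (Im (u $ k))) =
    poly_eval (wick_basis hbar \<alpha>) (p + u)"
proof -
  have 1: "p $ k + of_real (Re (u $ k)) + \<i> * of_real (Im (u $ k)) = (p + u) $ k" for k
    using complex_eq[of "u $ k"] by simp
  have 2: "cnj (p $ k) + of_real (Re (u $ k)) + (-\<i>) * of_real (Im (u $ k)) = cvec (p + u) $ k" for k
    by (simp add: cvec_def complex_eq_iff)
  show ?thesis unfolding translate_def poly_eval_basis[OF assms] evalp_mult evalp_prod evalp_power evalp_affine
      evalp_single vec_lambda_beta 1 2 by (simp add: pw_def)
qed

lemma l1norm_translate:
  assumes "hbar > 0"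
  shows "l1norm (translate hbar p \<alpha>) \<le> bcoef hbar \<alpha> * (norm p + 2) ^ bideg \<alpha>"
proof -
  have aff: "l1norm (affine c w k) \<le> norm p + 2" if "norm w = 1" "norm c \<le> norm p" for c w and k :: 'a
    using l1norm_affine[OF that(1), of c k] that(2) by linarith
  have pr: "l1norm (\<Prod>k\<in>UNIV. affine (c k) w k ^ (I $ k)) \<le> (norm p + 2) ^ mdeg I"
    if "norm w = 1" "\<And>k. norm (c k) \<le> norm p" for c w and I :: "nat ^ 'a"
  proof -
    have "l1norm (\<Prod>k\<in>UNIV. affine (c k) w k ^ (I $ k)) \<le> (\<Prod>k\<in>UNIV. (norm p + 2) ^ (I $ k))"
    proof (rule order_trans[OF l1norm_prod], rule prod_mono, intro conjI l1norm_nonneg)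
      fix k
      show "l1norm (affine (c k) w k ^ (I $ k)) \<le> (norm p + 2) ^ (I $ k)"
        by (rule order_trans[OF l1norm_power]) (intro power_mono aff that l1norm_nonneg)
    qed
    then show ?thesis by (simp add: mdeg_def power_sum)
  qed
  have "l1norm (translate hbar p \<alpha>) \<le> l1norm (Poly_Mapping.single 0 (complex_of_real (bcoef hbar \<alpha>)) :: 'a zpoly) *
      (l1norm (\<Prod>k\<in>UNIV. affine (p $ k) \<i> k ^ (fst \<alpha> $ k)) * l1norm (\<Prod>k\<in>UNIV. affine (cnj (p $ k)) (-\<i>) k ^ (snd \<alpha> $ k)))"
    unfolding translate_def by (intro order_trans[OF l1norm_mult] mult_left_mono l1norm_mult l1norm_nonneg)
  also have "\<dots> \<le> bcoef hbar \<alpha> * ((norm p + 2) ^ mdeg (fst \<alpha>) * (norm p + 2) ^ mdeg (snd \<alpha>))"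
    using bcoef_pos[OF assms, of \<alpha>]
    by (intro mult_mono pr mult_nonneg_nonneg l1norm_nonneg) (auto simp: Finite_Cartesian_Product.norm_nth_le)
  finally show ?thesis by (simp add: bideg_def power_add)
qed

text \<open>
  Exponents of the real coordinates, which are indexed by the standard basis of the Euclidean space, as a pair of multiindices.
\<close>

definition real_exponents :: "(complex ^ 'n::finite \<Rightarrow> nat) \<Rightarrow> 'n bidx" where
  "real_exponents N = (\<chi> k. N (axis k 1), \<chi> k. N (axis k \<i>))"

lemma Basis_complex_vec: "(Basis :: (complex ^ 'n::finite) set) = range (\<lambda>k. axis k 1) \<union> range (\<lambda>k. axis k \<i>)"
  by (auto simp: Basis_vec_def Basis_complex_def)

lemma bij_real_exponents: "bij_betw (real_exponents :: (complex ^ 'n::finite \<Rightarrow> nat) \<Rightarrow> _) (Basis \<rightarrow>\<^sub>E UNIV) UNIV"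
  unfolding bij_betw_def
proof
  show "inj_on (real_exponents :: (complex ^ 'n \<Rightarrow> nat) \<Rightarrow> _) (Basis \<rightarrow>\<^sub>E UNIV)"
  proof (rule inj_onI)
    fix N N' :: "complex ^ 'n \<Rightarrow> nat"
    assume N: "N \<in> Basis \<rightarrow>\<^sub>E UNIV" "N' \<in> Basis \<rightarrow>\<^sub>E UNIV" "real_exponents N = real_exponents N'"
    have "N b = N' b" if "b \<in> Basis" for b
      using that N(3) by (auto simp: Basis_complex_vec real_exponents_def vec_eq_iff)
    then show "N = N'" by (rule PiE_ext[OF N(1,2)])
  qed
  show "(real_exponents :: (complex ^ 'n \<Rightarrow> nat) \<Rightarrow> _) ` (Basis \<rightarrow>\<^sub>E UNIV) = UNIV"
  proof (intro equalityI subsetI UNIV_I)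
    fix \<alpha> :: "'n bidx"
    define N :: "complex ^ 'n \<Rightarrow> nat" where "N = restrict (\<lambda>b. (\<Sum>k\<in>UNIV. if b = axis k 1 then fst \<alpha> $ k else 0) +
      (\<Sum>k\<in>UNIV. if b = axis k \<i> then snd \<alpha> $ k else 0)) Basis"
    have B: "axis k 1 \<in> (Basis :: (complex ^ 'n) set)" "axis k \<i> \<in> (Basis :: (complex ^ 'n) set)" for k
      by (auto simp: Basis_complex_vec)
    have "N (axis k 1) = fst \<alpha> $ k" "N (axis k \<i>) = snd \<alpha> $ k" for k
      by (simp_all add: N_def B axis_eq_axis)
    then have "real_exponents N = \<alpha>" by (simp add: real_exponents_def)
    moreover have "N \<in> Basis \<rightarrow>\<^sub>E UNIV" by (simp add: N_def)
    ultimately show "\<alpha> \<in> real_exponents ` (Basis \<rightarrow>\<^sub>E UNIV)" by (metis image_eqI)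
  qed
qed

lemma prod_Basis_power:
  fixes u :: "complex ^ 'n::finite"
  shows "complex_of_real (\<Prod>b\<in>Basis. (u \<bullet> b) ^ N b) =
    pw (\<chi> k. of_real (Re (u $ k))) (fst (real_exponents N)) * pw (\<chi> k. of_real (Im (u $ k))) (snd (real_exponents N))"
proof -
  have "(\<Prod>b\<in>Basis. (u \<bullet> b) ^ N b) = (\<Prod>b\<in>range (\<lambda>k. axis k 1). (u \<bullet> b) ^ N b) * (\<Prod>b\<in>range (\<lambda>k. axis k \<i>). (u \<bullet> b) ^ N b)"
    unfolding Basis_complex_vec by (rule prod.union_disjoint) (auto simp: axis_eq_axis)
  also have "(\<Prod>b\<in>range (\<lambda>k. axis k 1). (u \<bullet> b) ^ N b) = (\<Prod>k\<in>UNIV. Re (u $ k) ^ N (axis k 1))"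
    by (subst prod.reindex) (auto simp: inj_on_def axis_eq_axis inner_axis inner_complex_def)
  also have "(\<Prod>b\<in>range (\<lambda>k. axis k \<i>). (u \<bullet> b) ^ N b) = (\<Prod>k\<in>UNIV. Im (u $ k) ^ N (axis k \<i>))"
    by (subst prod.reindex) (auto simp: inj_on_def axis_eq_axis inner_axis inner_complex_def)
  finally show ?thesis by (simp add: pw_def real_exponents_def)
qed

text \<open>
  Each translated monomial has \<open>l1norm\<close> at most \<open>bcoef hbar \<alpha> * (norm p + 2) ^ |\<alpha>|\<close>. Together with the coefficients \<open>a\<^sub>\<alpha>\<close> this is
  summable, so the double series over \<open>\<alpha>\<close> and the monomials in the real coordinates converges absolutely on the unit ball around
  \<open>p\<close> and may be summed over \<open>\<alpha>\<close> first.
\<close>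

lemma (in wick) real_analytic_taylor_sum:
  assumes a: "a \<in> V" shows "real_analytic (taylor_sum hbar a)"
  unfolding real_analytic_def
proof
  fix p :: "complex ^ 'n"
  define h where "h = (\<lambda>(\<alpha>, \<beta>). a \<alpha> * Poly_Mapping.lookup (translate hbar p \<alpha>) \<beta>)"
  have fin_sum: "((\<lambda>\<beta>. norm (Poly_Mapping.lookup f \<beta>)) has_sum l1norm f) UNIV" for f :: "'n zpoly"
    unfolding l1norm_def by (rule has_sum_finite_neutralI) (auto simp: in_keys_iff)
  have h: "(\<lambda>x. norm (h x)) summable_on (UNIV \<times> UNIV)"
  proof (rule summable_on_SigmaI)
    fix \<alpha> :: "'n bidx"
    show "((\<lambda>\<beta>. norm (h (\<alpha>, \<beta>))) has_sum norm (a \<alpha>) * l1norm (translate hbar p \<alpha>)) UNIV"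
      unfolding h_def prod.case norm_mult by (intro has_sum_cmult_right fin_sum)
  next
    show "(\<lambda>\<alpha>. norm (a \<alpha>) * l1norm (translate hbar p \<alpha>)) summable_on UNIV"
    proof (rule summable_on_comparison_test[OF bcoef_summable[OF a, of "norm p + 2"]])
      fix \<alpha> :: "'n bidx"
      show "norm (a \<alpha>) * l1norm (translate hbar p \<alpha>) \<le> norm (a \<alpha>) * bcoef hbar \<alpha> * (norm p + 2) ^ bideg \<alpha>"
        using l1norm_translate[OF hbar, of p \<alpha>] by (simp add: mult.assoc mult_left_mono)
    qed (auto simp: l1norm_nonneg)
  qed auto
  define c where "c \<beta> = (\<Sum>\<^sub>\<infinity>\<alpha>. h (\<alpha>, \<beta>))" for \<beta>
  have "((\<lambda>N. (\<Prod>b\<in>Basis. ((x - p) \<bullet> b) ^ N b) *\<^sub>R c (real_exponents N)) has_sum taylor_sum hbar a x)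
      (Basis \<rightarrow>\<^sub>E UNIV)" if x: "x \<in> ball p 1" for x
  proof -
    define u where "u = x - p"
    define X Y :: "complex ^ 'n" where "X = (\<chi> k. of_real (Re (u $ k)))" and "Y = (\<chi> k. of_real (Im (u $ k)))"
    define m where "m \<beta> = pw X (fst \<beta>) * pw Y (snd \<beta>)" for \<beta>
    have "norm (u $ k) \<le> 1" for k
      using x Finite_Cartesian_Product.norm_nth_le[of u k] by (simp add: u_def dist_norm norm_minus_commute)
    then have "norm (X $ k) \<le> 1" "norm (Y $ k) \<le> 1" for k
      using abs_Re_le_cmod[of "u $ k"] abs_Im_le_cmod[of "u $ k"] by (simp_all add: X_def Y_def) (meson order_trans)+
    then have m: "norm (m \<beta>) \<le> 1" for \<beta>
      using norm_pw_le[of X 1 "fst \<beta>"] norm_pw_le[of Y 1 "snd \<beta>"] by (simp add: m_def norm_mult mult_le_one)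
    define g where "g = (\<lambda>(\<alpha>, \<beta>). h (\<alpha>, \<beta>) * m \<beta>)"
    have g: "g summable_on (UNIV \<times> UNIV)"
    proof (rule abs_summable_summable, rule summable_on_comparison_test[OF h])
      fix z :: "'n bidx \<times> 'n bidx"
      show "norm (g z) \<le> norm (h z)"
        using m[of "snd z"] by (simp add: g_def norm_mult mult_left_le case_prod_unfold)
    qed auto
    then have gs: "(g has_sum infsum g (UNIV \<times> UNIV)) (UNIV \<times> UNIV)" by (rule has_sum_infsum)
    have "((\<lambda>\<alpha>. a \<alpha> * poly_eval (wick_basis hbar \<alpha>) (p + u)) has_sum infsum g (UNIV \<times> UNIV)) UNIV"
    proof (rule has_sum_SigmaD[OF gs])
      fix \<alpha> :: "'n bidx"
      have "((\<lambda>\<beta>. Poly_Mapping.lookup (translate hbar p \<alpha>) \<beta> * m \<beta>) has_sum evalp (translate hbar p \<alpha>) X Y) UNIV"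
        unfolding evalp_def m_def by (rule has_sum_finite_neutralI) (auto simp: in_keys_iff)
      then show "((\<lambda>\<beta>. g (\<alpha>, \<beta>)) has_sum a \<alpha> * poly_eval (wick_basis hbar \<alpha>) (p + u)) UNIV"
        unfolding g_def h_def prod.case mult.assoc X_def Y_def evalp_translate[OF hbar]
        by (rule has_sum_cmult_right)
    qed
    then have S: "infsum g (UNIV \<times> UNIV) = taylor_sum hbar a x"
      using taylor_has_sum[OF a, of x] by (simp add: u_def has_sum_unique)
    have "((\<lambda>\<beta>. c \<beta> * m \<beta>) has_sum infsum g (UNIV \<times> UNIV)) UNIV"
    proof (rule has_sum_SigmaD)
      show "((\<lambda>(\<beta>, \<alpha>). g (\<alpha>, \<beta>)) has_sum infsum g (UNIV \<times> UNIV)) (UNIV \<times> UNIV)"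
        using gs has_sum_swap by blast
      fix \<beta> :: "'n bidx"
      have "(\<lambda>(\<beta>, \<alpha>). norm (h (\<alpha>, \<beta>))) summable_on (UNIV \<times> UNIV)"
        using h summable_on_swap[of "\<lambda>x. norm (h x)" UNIV UNIV] by blast
      then have "(\<lambda>\<alpha>. norm (h (\<alpha>, \<beta>))) summable_on UNIV"
        using summable_on_SigmaD1[of "\<lambda>\<beta> \<alpha>. norm (h (\<alpha>, \<beta>))" UNIV "\<lambda>_. UNIV" \<beta>] by simp
      then have "(\<lambda>\<alpha>. h (\<alpha>, \<beta>)) summable_on UNIV" by (rule abs_summable_summable)
      then have "((\<lambda>\<alpha>. h (\<alpha>, \<beta>)) has_sum c \<beta>) UNIV" unfolding c_def by (rule has_sum_infsum)
      then show "((\<lambda>\<alpha>. case (\<beta>, \<alpha>) of (\<beta>, \<alpha>) \<Rightarrow> g (\<alpha>, \<beta>)) has_sum c \<beta> * m \<beta>) UNIV"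
        unfolding g_def prod.case by (rule has_sum_cmult_left)
    qed
    then have "((\<lambda>N. c (real_exponents N) * m (real_exponents N)) has_sum taylor_sum hbar a x) (Basis \<rightarrow>\<^sub>E UNIV)"
      unfolding S using has_sum_reindex_bij_betw[OF bij_real_exponents, of "\<lambda>\<beta>. c \<beta> * m \<beta>"] by simp
    moreover have "c (real_exponents N) * m (real_exponents N) = (\<Prod>b\<in>Basis. ((x - p) \<bullet> b) ^ N b) *\<^sub>R c (real_exponents N)" for N
      unfolding scaleR_conv_of_real u_def[symmetric] prod_Basis_power by (simp add: m_def X_def Y_def mult.commute)
    ultimately show ?thesis by simp
  qed
  then show "\<exists>r>0. \<exists>c. \<forall>x\<in>ball p r. ((\<lambda>N. (\<Prod>b\<in>Basis. ((x - p) \<bullet> b) ^ N b) *\<^sub>R c N) has_sum taylor_sum hbar a x)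
      (Basis \<rightarrow>\<^sub>E UNIV)"
    by (intro exI[of _ 1] conjI exI[of _ "\<lambda>N. c (real_exponents N)"]) auto
qed

theorem theorem3p19:
  fixes hbar :: real
  assumes "hbar > 0"
  shows
    "(\<forall>(f :: 'n::finite zpoly) m l \<gamma>. l < 2 ^ m \<longrightarrow>
        hnorm (wick_struct hbar) m l \<gamma> (wick_coords hbar f) < \<infinity>) \<and>
     frechet_algebra_completion
       poly_scale (UNIV :: 'n zpoly set) (wick_topology hbar) (wick_mult hbar)
       fam_scale (hat_space (wick_struct hbar)) (hat_topology (wick_struct hbar))
       (hat_mult (wick_struct hbar)) (wick_coords hbar) \<and>
     strongly_nuclear fam_scale
       (hat_space (wick_struct hbar) :: ('n bidx \<Rightarrow> complex) set) (hat_topology (wick_struct hbar)) \<and>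
     absolute_schauder_basis fam_scale
       (hat_space (wick_struct hbar) :: ('n bidx \<Rightarrow> complex) set) (hat_topology (wick_struct hbar))
       (\<lambda>\<alpha>. wick_coords hbar (wick_basis hbar \<alpha>)) \<and>
     (\<forall>f :: 'n zpoly. taylor_sum hbar (wick_coords hbar f) = poly_eval f) \<and>
     (hat_space (wick_struct hbar) :: ('n bidx \<Rightarrow> complex) set) = {a. subfactorial bideg a} \<and>
     (\<forall>a \<in> (hat_space (wick_struct hbar) :: ('n bidx \<Rightarrow> complex) set).
        taylor_expansion hbar (taylor_sum hbar a) a) \<and>
     bij_betw (taylor_sum hbar) (hat_space (wick_struct hbar) :: ('n bidx \<Rightarrow> complex) set)
       {f. real_analytic f \<and> (\<exists>a. taylor_expansion hbar f a \<and> subfactorial bideg a)} \<and>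
     lcs_isomorphic
       fam_scale (hat_space (wick_struct hbar) :: ('n bidx \<Rightarrow> complex) set)
         (hat_topology (wick_struct hbar))
       fam_scale {a :: 'n bidx \<Rightarrow> complex. subfactorial bideg a} (kothe_topology bideg)"
proof -
  interpret wick hbar "TYPE('n)" by unfold_locales (rule assms)
  have basis: "(\<lambda>\<alpha>. wick_coords hbar (wick_basis hbar \<alpha>)) = (unit_family :: 'n bidx \<Rightarrow> _)"
    by (simp add: wick_coords_basis[OF assms] fun_eq_iff)
  have hat_space_polynomials: "wick_coords hbar f \<in> hat_space C" for f :: "'n zpoly"
    using wick_coords_in_V by (simp add: hat_space_eq)
  have bij: "bij_betw (taylor_sum hbar) V {f. real_analytic f \<and> (\<exists>a. taylor_expansion hbar f a \<and> subfactorial bideg a)}"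
    unfolding bij_betw_def
  proof (intro conjI equalityI subsetI)
    show "inj_on (taylor_sum hbar) V"
    proof (rule inj_onI)
      fix a b assume ab: "a \<in> V" "b \<in> V" "taylor_sum hbar a = taylor_sum hbar b"
      show "a = b"
        using taylor_coefficients_unique[OF taylor_expansion_taylor_sum[OF ab(1)]] taylor_expansion_taylor_sum[OF ab(2)] ab(3)
        by simp
    qed
    fix f assume "f \<in> taylor_sum hbar ` V"
    then obtain a where a: "a \<in> V" "f = taylor_sum hbar a" by blast
    then have "taylor_expansion hbar f a \<and> subfactorial bideg a"
      using taylor_expansion_taylor_sum[OF a(1)] by simp
    then show "f \<in> {f. real_analytic f \<and> (\<exists>a. taylor_expansion hbar f a \<and> subfactorial bideg a)}"
      using real_analytic_taylor_sum[OF a(1)] a(2) by blast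
  next
    fix f assume "f \<in> {f. real_analytic f \<and> (\<exists>a. taylor_expansion hbar f a \<and> subfactorial bideg (a :: 'n bidx \<Rightarrow> complex))}"
    then obtain a :: "'n bidx \<Rightarrow> complex" where a: "taylor_expansion hbar f a" "a \<in> V" by blast
    have "f = taylor_sum hbar a"
    proof
      fix z
      have "((\<lambda>\<alpha>. a \<alpha> * poly_eval (wick_basis hbar \<alpha>) z) has_sum f z) UNIV"
        using a(1) unfolding taylor_expansion_def by (rule conjE) (erule spec)
      then show "f z = taylor_sum hbar a z" unfolding taylor_sum_def by (rule infsumI[symmetric])
    qed
    then show "f \<in> taylor_sum hbar ` V" using a(2) by (rule image_eqI)
  qed
  have iso: "lcs_isomorphic fam_scale V K.T fam_scale V (kothe_topology bideg)"
    unfolding lcs_isomorphic_def kothe_topology_eq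
    by (intro exI[of _ id]) (auto simp: lin_on_def homeomorphic_map_id)
  show ?thesis
  proof (intro conjI)
    show "\<forall>(f :: 'n zpoly) m l \<gamma>. l < 2 ^ m \<longrightarrow> hnorm (wick_struct hbar) m l \<gamma> (wick_coords hbar f) < \<infinity>"
      using hat_space_polynomials unfolding hat_space_def by blast
    show "strongly_nuclear fam_scale (hat_space C) (hat_topology C)"
      unfolding hat_space_eq hat_topology_eq by (rule strongly_nuclear_kothe)
    show "absolute_schauder_basis fam_scale (hat_space C) (hat_topology C) (\<lambda>\<alpha>. wick_coords hbar (wick_basis hbar \<alpha>))"
      unfolding hat_space_eq hat_topology_eq basis by (rule absolute_schauder_basis_kothe)
    show "\<forall>a \<in> hat_space C. taylor_expansion hbar (taylor_sum hbar a) a"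
      unfolding hat_space_eq using taylor_expansion_taylor_sum by blast
    show "bij_betw (taylor_sum hbar) (hat_space C) {f. real_analytic f \<and> (\<exists>a. taylor_expansion hbar f a \<and> subfactorial bideg a)}"
      unfolding hat_space_eq by (rule bij)
    show "lcs_isomorphic fam_scale (hat_space C) (hat_topology C) fam_scale {a :: 'n bidx \<Rightarrow> complex. subfactorial bideg a} (kothe_topology bideg)"
      unfolding hat_space_eq hat_topology_eq by (rule iso)
  qed (use completion_wick taylor_sum_wick_coords hat_space_eq in auto)
qed

end
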